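(* Let $d>1$ be an integer. There exists a constant $c_d>0$, depending only on $d$, with the following property. Let $L_0$ be a subfield of $\overline{\mathbb{Q}}$ and let $(K_i)_{i\in\mathbb{N}}$ be a sequence of number fields (subfields of $\overline{\mathbb{Q}}$) with degrees $d_i=[K_i:\mathbb{Q}]$ satisfying $1<d_i\le d$ for all $i\in\mathbb{N}$, such that the family $L_0,K_1,K_2,K_3,\ldots$ is linearly disjoint over $\mathbb{Q}$. Let $L_n=L_0\prod_{i=1}^nK_i$, $R_n=\mathcal{O}_{L_0}\prod_{i=1}^n\mathcal{O}_{K_i}$ and $R=\bigcup_nR_n$. If $m\in\mathbb{N}$ and $\alpha\in R$ satisfy $L_{m-1}(\alpha)=L_m$, then $$H(\alpha)\ \geq\ c_d\,|\Delta_{K_m}|^{\frac{1}{2d_m(d_m-1)}}.$$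
   Context: $\overline{\mathbb{Q}}$ is a fixed algebraic closure of $\mathbb{Q}$. For a field $K\subseteq\overline{\mathbb{Q}}$ (possibly of infinite degree over $\mathbb{Q}$), $\mathcal{O}_K$ is its ring of algebraic integers; for a number field $K$, $\Delta_K$ is its discriminant. For subrings $S_i$ of $\overline{\mathbb{Q}}$, the product $\prod_i S_i$ denotes the composite ring, i.e. the smallest subring of $\overline{\mathbb{Q}}$ containing all $S_i$. Thus $L_n$ is the compositum of the fields $L_0,K_1,\ldots,K_n$, and $R_n$ is the subring generated by $\mathcal{O}_{L_0},\mathcal{O}_{K_1},\ldots,\mathcal{O}_{K_n}$. A family $L_0,K_1,K_2,\ldots$ is linearly disjoint over $\mathbb{Q}$ if every finite subfamily is linearly disjoint over $\mathbb{Q}$ (the natural map from the tensor product over $\mathbb{Q}$ to $\overline{\mathbb{Q}}$ is injective); this is equivalent to $[L_n:L_{n-1}]=[K_n:\mathbb{Q}]$ for every $n\in\mathbb{N}=\{1,2,\ldots\}$. $H$ is the absolute multiplicative Weil height: for $\alpha$ in a number field $K$, $H(\alpha)=\prod_v\max\{1,|\alpha|_v\}^{d_v/[K:\mathbb{Q}]}$, the product over all places $v$ of $K$, where $|\cdot|_v$ extends the usual archimedean or $p$-adic absolute value on $\mathbb{Q}$ and $d_v=[K_v:\mathbb{Q}_v]$ (here $d_v$ is the local degree); this is independent of the choice of $K\ni\alpha$. *)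

theory Defs
  imports
    "HOL-Analysis.Analysis"
    "HOL-Algebra.Algebra"
    "HOL-Algebra.Algebraic_Closure_Type"
    "HOL-Library.Poly_Mapping"
    "Jordan_Normal_Form.Determinant"
begin

section \<open>Subfields of the algebraic numbers\<close>

text \<open>The algebraic closure of the rationals is realised inside the complex numbers.\<close>

abbreviation CC :: "complex ring" where
  "CC \<equiv> ring_of_type_algebra"

definition Qbar :: "complex set" where
  "Qbar = {x. algebraic x}"

definition number_field :: "complex set \<Rightarrow> bool" where
  "number_field K \<longleftrightarrow> subfield K CC \<and> K \<subseteq> Qbar \<and> ring.finite_dimension CC \<rat> K"

definition ext_degree :: "complex set \<Rightarrow> nat" where
  "ext_degree K = ring.dim CC \<rat> K"

definition ring_of_integers :: "complex set \<Rightarrow> complex set" where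
  "ring_of_integers K = {x \<in> K. algebraic_int x}"

definition L_field :: "complex set \<Rightarrow> (nat \<Rightarrow> complex set) \<Rightarrow> nat \<Rightarrow> complex set" where
  "L_field L0 K n = generate_ring CC (L0 \<union> (\<Union>i\<in>{1..n}. K i))"

definition R_ring :: "complex set \<Rightarrow> (nat \<Rightarrow> complex set) \<Rightarrow> nat \<Rightarrow> complex set" where
  "R_ring L0 K n =
     generate_ring CC (ring_of_integers L0 \<union> (\<Union>i\<in>{1..n}. ring_of_integers (K i)))"


section \<open>Linear disjointness\<close>

text \<open>
  For a finite family \<open>F i\<close> (\<open>i \<in> I\<close>) of \<open>\<rat>\<close>-vector spaces, the tensor product is the free
  \<open>\<rat>\<close>-vector space on \<open>PiE I F\<close> modulo the span of the multilinearity relations. The natural map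
  sends the class of a tuple to the product of its entries.
\<close>

definition tensor_scale :: "rat \<Rightarrow> ('a \<Rightarrow>\<^sub>0 rat) \<Rightarrow> ('a \<Rightarrow>\<^sub>0 rat)" where
  "tensor_scale c x = Poly_Mapping.map ((*) c) x"

lemma lookup_tensor_scale [simp]:
  "Poly_Mapping.lookup (tensor_scale c x) t = c * Poly_Mapping.lookup x t"
  by (simp add: tensor_scale_def Poly_Mapping.map.rep_eq when_def)

lemma vector_space_tensor_scale: "vector_space tensor_scale"
  by unfold_locales
    (auto intro!: poly_mapping_eqI simp: Poly_Mapping.lookup_add algebra_simps)

definition tensor_free :: "'i set \<Rightarrow> ('i \<Rightarrow> complex set) \<Rightarrow> (('i \<Rightarrow> complex) \<Rightarrow>\<^sub>0 rat) set" where
  "tensor_free I F = {x. Poly_Mapping.keys x \<subseteq> PiE I F}"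

definition tensor_relations :: "'i set \<Rightarrow> ('i \<Rightarrow> complex set) \<Rightarrow> (('i \<Rightarrow> complex) \<Rightarrow>\<^sub>0 rat) set" where
  "tensor_relations I F = module.span tensor_scale
     {Poly_Mapping.single (t(i := of_rat a * x + of_rat b * y)) 1
        - tensor_scale a (Poly_Mapping.single (t(i := x)) 1)
        - tensor_scale b (Poly_Mapping.single (t(i := y)) 1)
      | t i a b x y. t \<in> PiE I F \<and> i \<in> I \<and> x \<in> F i \<and> y \<in> F i}"

definition tensor_eval :: "'i set \<Rightarrow> (('i \<Rightarrow> complex) \<Rightarrow>\<^sub>0 rat) \<Rightarrow> complex" where
  "tensor_eval I x =
     (\<Sum>t\<in>Poly_Mapping.keys x. of_rat (Poly_Mapping.lookup x t) * (\<Prod>i\<in>I. t i))"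

definition linearly_disjoint_finite :: "'i set \<Rightarrow> ('i \<Rightarrow> complex set) \<Rightarrow> bool" where
  "linearly_disjoint_finite I F \<longleftrightarrow>
     (\<forall>x\<in>tensor_free I F. \<forall>y\<in>tensor_free I F.
        tensor_eval I x = tensor_eval I y \<longrightarrow> x - y \<in> tensor_relations I F)"

definition linearly_disjoint :: "'i set \<Rightarrow> ('i \<Rightarrow> complex set) \<Rightarrow> bool" where
  "linearly_disjoint I F \<longleftrightarrow> (\<forall>J\<subseteq>I. finite J \<longrightarrow> linearly_disjoint_finite J F)"


section \<open>Discriminant\<close>

definition field_embeddings :: "complex set \<Rightarrow> (complex \<Rightarrow> complex) set" where
  "field_embeddings K = Ring.ring_hom (CC\<lparr>carrier := K\<rparr>) CC \<inter> extensional K"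

definition integral_basis :: "complex set \<Rightarrow> complex list \<Rightarrow> bool" where
  "integral_basis K bs \<longleftrightarrow> distinct bs
     \<and> \<not> module.dependent (\<lambda>(k::int) x::complex. of_int k * x) (set bs)
     \<and> module.span (\<lambda>(k::int) x::complex. of_int k * x) (set bs) = ring_of_integers K"

text \<open>
  The square of \<open>det (\<sigma>\<^sub>i \<omega>\<^sub>j)\<close> depends neither on the integral basis \<open>\<omega>\<close> nor on the orderings. It is
  a rational integer, regarded here as a complex number.
\<close>

definition discriminant :: "complex set \<Rightarrow> complex" where
  "discriminant K = (SOME D. \<exists>bs \<sigma>s. integral_basis K bs
     \<and> distinct \<sigma>s \<and> set \<sigma>s = field_embeddings K \<and> length \<sigma>s = length bs
     \<and> D = (Determinant.det (mat (length bs) (length bs) (\<lambda>(i, j). (\<sigma>s ! i) (bs ! j)))) ^ 2)"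


section \<open>Places and the Weil height\<close>

definition padic_abs :: "nat \<Rightarrow> rat \<Rightarrow> real" where
  "padic_abs p q = (if q = 0 then 0 else
     (case quotient_of q of (a, b) \<Rightarrow>
        real p powi (int (multiplicity (int p) b) - int (multiplicity (int p) a))))"

definition absolute_value_on :: "complex set \<Rightarrow> (complex \<Rightarrow> real) \<Rightarrow> bool" where
  "absolute_value_on K v \<longleftrightarrow> v \<in> extensional K
     \<and> (\<forall>x\<in>K. v x \<ge> 0) \<and> (\<forall>x\<in>K. v x = 0 \<longleftrightarrow> x = 0)
     \<and> (\<forall>x\<in>K. \<forall>y\<in>K. v (x * y) = v x * v y)
     \<and> (\<forall>x\<in>K. \<forall>y\<in>K. v (x + y) \<le> v x + v y)"

text \<open>
  A place is represented by the unique absolute value in its class that restricts to the usual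
  archimedean or to a usual p-adic absolute value on \<open>\<rat>\<close>.
\<close>

definition places :: "complex set \<Rightarrow> (complex \<Rightarrow> real) set" where
  "places K = {v. absolute_value_on K v \<and>
     ((\<forall>q. v (of_rat q) = \<bar>of_rat q\<bar>) \<or>
      (\<exists>p. Factorial_Ring.prime p \<and> (\<forall>q. v (of_rat q) = padic_abs p q)))}"

definition cauchy_seqs :: "complex set \<Rightarrow> (complex \<Rightarrow> real) \<Rightarrow> (nat \<Rightarrow> complex) set" where
  "cauchy_seqs K v = {x. (\<forall>n. x n \<in> K) \<and>
     (\<forall>e>0. \<exists>N. \<forall>m\<ge>N. \<forall>n\<ge>N. v (x m - x n) < e)}"

definition null_seqs :: "complex set \<Rightarrow> (complex \<Rightarrow> real) \<Rightarrow> (nat \<Rightarrow> complex) set" where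
  "null_seqs K v = {x. (\<forall>n. x n \<in> K) \<and> (\<lambda>n. v (x n)) \<longlonglongrightarrow> 0}"

definition cauchy_ring :: "complex set \<Rightarrow> (complex \<Rightarrow> real) \<Rightarrow> (nat \<Rightarrow> complex) ring" where
  "cauchy_ring K v = \<lparr>carrier = cauchy_seqs K v,
     monoid.mult = (\<lambda>x y n. x n * y n), monoid.one = (\<lambda>n. 1),
     ring.zero = (\<lambda>n. 0), ring.add = (\<lambda>x y n. x n + y n)\<rparr>"

definition completion :: "complex set \<Rightarrow> (complex \<Rightarrow> real) \<Rightarrow> (nat \<Rightarrow> complex) set ring" where
  "completion K v = cauchy_ring K v Quot null_seqs K v"

text \<open>The completion of \<open>\<rat>\<close>, viewed as a subfield of the completion of \<open>K\<close>.\<close>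

definition rat_completion :: "complex set \<Rightarrow> (complex \<Rightarrow> real) \<Rightarrow> (nat \<Rightarrow> complex) set set" where
  "rat_completion K v = {null_seqs K v +>\<^bsub>cauchy_ring K v\<^esub> x | x. x \<in> cauchy_seqs \<rat> v}"

definition local_degree :: "complex set \<Rightarrow> (complex \<Rightarrow> real) \<Rightarrow> nat" where
  "local_degree K v =
     ring.dim (completion K v) (rat_completion K v) (carrier (completion K v))"

text \<open>
  Only finitely many places contribute a factor different from 1, and the product is restricted to
  these because \<^const>\<open>prod\<close> is 1 over an infinite set.
\<close>

definition weil_height_in :: "complex set \<Rightarrow> complex \<Rightarrow> real" where
  "weil_height_in K \<alpha> = (\<Prod>v\<in>{v \<in> places K. max 1 (v \<alpha>) \<noteq> 1}.
     max 1 (v \<alpha>) powr (real (local_degree K v) / real (ext_degree K)))"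

text \<open>The height does not depend on the number field containing \<open>\<alpha>\<close>; we take \<open>\<rat>(\<alpha>)\<close>.\<close>

definition weil_height :: "complex \<Rightarrow> real" where
  "weil_height \<alpha> = weil_height_in (generate_field CC {\<alpha>}) \<alpha>"

end

theory Submission
  imports Defs "Jordan_Normal_Form.Char_Poly"
begin

text \<open>
  Write \<open>k = [K\<^sub>m : \<rat>]\<close>. Take \<open>l \<ge> m\<close> with \<open>\<alpha> \<in> R\<^sub>l\<close>, let \<open>L'\<close> be the ring generated by
  \<open>L\<^sub>0\<close> and the \<open>K\<^sub>i\<close> with \<open>i \<le> l\<close>, \<open>i \<noteq> m\<close>, and let \<open>R' \<subseteq> L'\<close> be the ring generated by the
  corresponding rings of integers. If \<open>\<omega>\<close> is an integral basis of \<open>K\<^sub>m\<close>, then the sums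
  \<open>\<Sum>\<^sub>j a\<^sub>j \<omega>\<^sub>j\<close> with \<open>a\<^sub>j \<in> R'\<close> form a ring containing \<open>\<alpha>\<close>; hence \<open>\<alpha>\<^sup>i = \<Sum>\<^sub>j B\<^sub>i\<^sub>j \<omega>\<^sub>j\<close> for a
  matrix \<open>B\<close> of algebraic integers in \<open>L'\<close> (\<open>basis_combinations_subring\<close>).

  Linear disjointness says that each of the \<open>k\<close> embeddings \<open>\<sigma>\<close> of \<open>K\<^sub>m\<close> extends to a ring
  homomorphism on \<open>L' K\<^sub>m\<close> that fixes \<open>L'\<close> (\<open>extension_exists\<close>). Let \<open>\<alpha>\<^sub>\<sigma>\<close> be the image of
  \<open>\<alpha>\<close>. It is a conjugate of \<open>\<alpha>\<close>, and the \<open>\<alpha>\<^sub>\<sigma>\<close> are distinct: if two of them were equal, then the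
  corresponding extensions would agree on a field containing \<open>L\<^sub>m\<^sub>-\<^sub>1\<close> and \<open>\<alpha>\<close>, hence on
  \<open>L\<^sub>m \<supseteq> K\<^sub>m\<close>. Applying the extensions to
  the expansions of the powers of \<open>\<alpha>\<close> gives the matrix identity
  \<open>(\<alpha>\<^sub>\<sigma>\<^sup>i) = (\<sigma> \<omega>\<^sub>j) \<cdot> B\<^sup>t\<close>. The Vandermonde determinant on the left is not zero, so \<open>\<beta> = det B\<close>
  is a nonzero algebraic integer, and the square of \<open>det (\<sigma> \<omega>\<^sub>j)\<close> is the discriminant \<open>\<Delta>\<close> of \<open>K\<^sub>m\<close>.

  Apply all automorphisms \<open>\<tau>\<close> of a large finite Galois extension of \<open>\<rat>\<close> to this identity. They
  change \<open>det (\<sigma> \<omega>\<^sub>j)\<close> at most by a sign (\<open>galois_D\<close>), the product of the \<open>\<bar>\<tau> \<beta>\<bar>\<close> is at least 1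
  (\<open>norm_ge_1\<close>), and the Leibniz formula bounds the Vandermonde determinant by
  \<open>k! (\<Prod>\<^sub>\<sigma> max 1 \<bar>\<tau> \<alpha>\<^sub>\<sigma>\<bar>)\<^bsup>k-1\<^esup>\<close>. As \<open>\<alpha>\<close> is an algebraic integer, only the archimedean places enter
  its height, so the geometric mean of \<open>max 1 \<bar>\<tau> \<alpha>\<^sub>\<sigma>\<bar>\<close> over all \<open>\<tau>\<close> is at most \<open>H(\<alpha>)\<close>. Taking
  geometric means,
  \<open>\<bar>\<Delta>\<bar>\<^bsup>1/2\<^esup> \<le> k! H(\<alpha>)\<^bsup>k(k-1)\<^esup>\<close> (\<open>height_bound\<close>), which gives the claim with \<open>c = 1/d!\<close>.

  The height is a product over places and involves the degrees of completions. Three facts connect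
  it with absolute values of conjugates: an absolute value that is at most 1 on the rational
  integers is so on all algebraic integers (\<open>integral_bound\<close>), every archimedean place comes from an embedding
  (\<open>archimedean_place\<close>), and the local degree of such a place is 1 or 2 according to whether the
  embedding is real (\<open>local_degree_real\<close>, \<open>local_degree_complex\<close>).
\<close>

text \<open>Below, the short names and the index notation refer to polynomials over a type and to vectors.\<close>

hide_const (open) Polynomials.degree Polynomials.lead_coeff Module.smult up_ring.coeff up_ring.monom
unbundle no vec_syntax
no_notation fps_nth (infixl "$" 75)

section \<open>Subrings of the complex numbers and integral elements\<close>

locale complex_subring =
  fixes S :: "complex set"
  assumes one_mem [simp]: "1 \<in> S"
    and add_mem [simp]: "x \<in> S \<Longrightarrow> y \<in> S \<Longrightarrow> x + y \<in> S"
    and mult_mem [simp]: "x \<in> S \<Longrightarrow> y \<in> S \<Longrightarrow> x * y \<in> S"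
    and uminus_mem [simp]: "x \<in> S \<Longrightarrow> - x \<in> S"
begin

lemma zero_mem [simp]: "0 \<in> S"
  using add_mem[OF one_mem uminus_mem[OF one_mem]] by simp

lemma diff_mem [simp]: "x \<in> S \<Longrightarrow> y \<in> S \<Longrightarrow> x - y \<in> S"
  using add_mem[of x "- y"] by simp

lemma power_mem [simp]: "x \<in> S \<Longrightarrow> x ^ n \<in> S"
  by (induction n) auto

lemma sum_mem [simp]: "(\<And>i. i \<in> A \<Longrightarrow> f i \<in> S) \<Longrightarrow> sum f A \<in> S"
  by (induction A rule: infinite_finite_induct) auto

lemma prod_mem [simp]: "(\<And>i. i \<in> A \<Longrightarrow> f i \<in> S) \<Longrightarrow> prod f A \<in> S"
  by (induction A rule: infinite_finite_induct) auto

lemma of_nat_mem [simp]: "of_nat n \<in> S"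
  by (induction n) auto

lemma of_int_mem [simp]: "of_int k \<in> S"
  by (cases k) auto

lemma signof_mem [simp]: "signof p \<in> S"
  by (simp add: sign_def)

lemma det_mem:
  assumes "A \<in> carrier_mat n n" "\<And>i j. i < n \<Longrightarrow> j < n \<Longrightarrow> A $$ (i, j) \<in> S"
  shows "Determinant.det A \<in> S"
  unfolding det_def'[OF assms(1)]
  by (intro sum_mem mult_mem signof_mem prod_mem)
     (auto intro!: assms(2) simp: permutes_in_image[of _ "{0..<n}", simplified])

definition polys :: "complex poly set" where
  "polys = {p. \<forall>i. coeff p i \<in> S}"

lemma polys_coeff: "p \<in> polys \<Longrightarrow> coeff p i \<in> S"
  by (simp add: polys_def)

lemma polys_0 [simp]: "0 \<in> polys" and polys_1 [simp]: "1 \<in> polys"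
  by (auto simp: polys_def one_pCons coeff_pCons split: nat.splits)

lemma polys_pCons [simp]: "pCons a p \<in> polys \<longleftrightarrow> a \<in> S \<and> p \<in> polys"
  by (auto simp: polys_def coeff_pCons split: nat.splits)

lemma polys_add [simp]: "p \<in> polys \<Longrightarrow> q \<in> polys \<Longrightarrow> p + q \<in> polys"
  and polys_diff [simp]: "p \<in> polys \<Longrightarrow> q \<in> polys \<Longrightarrow> p - q \<in> polys"
  and polys_uminus [simp]: "p \<in> polys \<Longrightarrow> - p \<in> polys"
  and polys_mult [simp]: "p \<in> polys \<Longrightarrow> q \<in> polys \<Longrightarrow> p * q \<in> polys"
  and polys_smult [simp]: "a \<in> S \<Longrightarrow> p \<in> polys \<Longrightarrow> smult a p \<in> polys"
  and polys_monom [simp]: "a \<in> S \<Longrightarrow> monom a n \<in> polys"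
  by (auto simp: polys_def coeff_mult)

lemma polys_sum [simp]: "(\<And>i. i \<in> A \<Longrightarrow> f i \<in> polys) \<Longrightarrow> sum f A \<in> polys"
  by (induction A rule: infinite_finite_induct) auto

lemma polys_prod [simp]: "(\<And>i. i \<in> A \<Longrightarrow> f i \<in> polys) \<Longrightarrow> prod f A \<in> polys"
  by (induction A rule: infinite_finite_induct) auto

lemma polys_pderiv [simp]: "p \<in> polys \<Longrightarrow> pderiv p \<in> polys"
  by (auto simp: polys_def coeff_pderiv simp del: of_nat_Suc)

lemma polys_pcompose [simp]: "p \<in> polys \<Longrightarrow> q \<in> polys \<Longrightarrow> pcompose p q \<in> polys"
  by (induction p) (auto simp: pcompose_pCons)

lemma polys_eval [simp]: "p \<in> polys \<Longrightarrow> x \<in> S \<Longrightarrow> poly p x \<in> S"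
  by (induction p) auto

lemma polys_det:
  assumes "A \<in> carrier_mat n n" "\<And>i j. i < n \<Longrightarrow> j < n \<Longrightarrow> A $$ (i, j) \<in> polys"
  shows "Determinant.det A \<in> polys"
proof -
  have "signof p \<in> polys" for p :: "nat \<Rightarrow> nat"
    by (simp add: sign_def)
  then show ?thesis
    unfolding det_def'[OF assms(1)]
    by (intro polys_sum polys_mult polys_prod)
       (auto intro!: assms(2) simp: permutes_in_image[of _ "{0..<n}", simplified])
qed

text \<open>
  Division stays inside \<open>S[X]\<close> because the leading coefficient of the divisor is 1.
\<close>

lemma polys_divide_monic:
  assumes "h \<in> polys" "lead_coeff h = 1" "p \<in> polys"
  shows "\<exists>q\<in>polys. \<exists>r\<in>polys. p = q * h + r \<and> (r = 0 \<or> degree r < degree h)"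
  using assms(3)
proof (induction p)
  case 0
  show ?case by (intro bexI[of _ 0]) auto
next
  case (pCons a p)
  then obtain q r where qr: "q \<in> polys" "r \<in> polys" "p = q * h + r" "r = 0 \<or> degree r < degree h"
    by auto
  define c where "c = coeff (pCons a r) (degree h)"
  define r' where "r' = pCons a r - smult c h"
  have ar: "pCons a r \<in> polys" using qr pCons.prems by simp
  then have c: "c \<in> S" unfolding c_def by (rule polys_coeff)
  have "degree (pCons a r) \<le> degree h" using qr(4) by auto
  then have "degree r' \<le> degree h"
    unfolding r'_def by (intro degree_diff_le) auto
  moreover have "coeff r' (degree h) = 0" using assms(2) by (simp add: r'_def c_def)
  ultimately have "r' = 0 \<or> degree r' < degree h"
    by (metis le_neq_implies_less leading_coeff_0_iff)
  moreover have "pCons a p = pCons c q * h + r'" by (simp add: qr(3) r'_def)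
  ultimately show ?case
    using c qr(1) ar assms(1) by (intro bexI[of _ "pCons c q"] bexI[of _ r']) (auto simp: r'_def)
qed

definition integral :: "complex \<Rightarrow> bool" where
  "integral x \<longleftrightarrow> (\<exists>p\<in>polys. lead_coeff p = 1 \<and> poly p x = 0)"

definition combinations :: "complex set \<Rightarrow> complex set" where
  "combinations W = {\<Sum>w\<in>W. c w * w |c. \<forall>w. c w \<in> S}"

lemma combinations_add: "x \<in> combinations W \<Longrightarrow> y \<in> combinations W \<Longrightarrow> x + y \<in> combinations W"
proof -
  assume "x \<in> combinations W" "y \<in> combinations W"
  then obtain c d where "x = (\<Sum>w\<in>W. c w * w)" "y = (\<Sum>w\<in>W. d w * w)" "\<forall>w. c w \<in> S" "\<forall>w. d w \<in> S"
    by (auto simp: combinations_def)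
  then have "x + y = (\<Sum>w\<in>W. (c w + d w) * w)" "\<forall>w. c w + d w \<in> S"
    by (auto simp: sum.distrib algebra_simps)
  then show ?thesis unfolding combinations_def by (intro CollectI exI[of _ "\<lambda>w. c w + d w"]) auto
qed

lemma combinations_scale: "a \<in> S \<Longrightarrow> x \<in> combinations W \<Longrightarrow> a * x \<in> combinations W"
proof -
  assume a: "a \<in> S" "x \<in> combinations W"
  then obtain c where "x = (\<Sum>w\<in>W. c w * w)" "\<forall>w. c w \<in> S"
    by (auto simp: combinations_def)
  then have "a * x = (\<Sum>w\<in>W. (a * c w) * w)" "\<forall>w. a * c w \<in> S"
    using a by (auto simp: sum_distrib_left algebra_simps)
  then show ?thesis unfolding combinations_def by (intro CollectI exI[of _ "\<lambda>w. a * c w"]) auto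
qed

lemma combinations_0: "0 \<in> combinations W"
  unfolding combinations_def by (rule CollectI, rule exI[of _ "\<lambda>_. 0"]) auto

lemma combinations_sum: "(\<And>i. i \<in> A \<Longrightarrow> f i \<in> combinations W) \<Longrightarrow> sum f A \<in> combinations W"
  by (induction A rule: infinite_finite_induct) (auto simp: combinations_0 combinations_add)

lemma combinations_base: "finite W \<Longrightarrow> w \<in> W \<Longrightarrow> w \<in> combinations W"
proof -
  assume "finite W" "w \<in> W"
  have "(\<Sum>v\<in>W. (if v = w then 1 else 0) * v) = (\<Sum>v\<in>W. if v = w then v else 0)"
    by (intro sum.cong) auto
  also have "\<dots> = w"
    using \<open>finite W\<close> \<open>w \<in> W\<close> by simp
  finally have "w = (\<Sum>v\<in>W. (if v = w then 1 else 0) * v)" ..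
  then show ?thesis
    unfolding combinations_def by (intro CollectI exI[of _ "\<lambda>v. if v = w then 1 else 0"]) auto
qed

lemma combinations_stable:
  assumes "\<And>w. w \<in> W \<Longrightarrow> x * w \<in> combinations W" "y \<in> combinations W"
  shows "x * y \<in> combinations W"
proof -
  obtain c where c: "y = (\<Sum>w\<in>W. c w * w)" "\<forall>w. c w \<in> S"
    using assms by (auto simp: combinations_def)
  have "x * y = (\<Sum>w\<in>W. c w * (x * w))"
    by (simp add: c sum_distrib_left algebra_simps)
  also have "\<dots> \<in> combinations W"
    by (rule combinations_sum, rule combinations_scale) (use c assms(1) in auto)
  finally show ?thesis .
qed

text \<open>
  The determinant trick: multiplication by \<open>x\<close> acts on the generators \<open>W\<close> by a matrix over \<open>S\<close>, with
  the vector of generators as an eigenvector for \<open>x\<close>. The membership of 1 makes this vector nonzero,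
  and the characteristic polynomial is monic.
\<close>

lemma integral_of_stable:
  assumes "finite W" "1 \<in> W" "\<And>w. w \<in> W \<Longrightarrow> x * w \<in> combinations W"
  shows "integral x"
proof -
  obtain ws where ws: "set ws = W" "distinct ws"
    using finite_distinct_list[OF assms(1)] by auto
  define n where "n = length ws"
  have "\<forall>w\<in>W. \<exists>c. x * w = (\<Sum>v\<in>W. c v * v) \<and> (\<forall>v. c v \<in> S)"
    using assms(3) unfolding combinations_def by blast
  then obtain c where c: "\<And>w. w \<in> W \<Longrightarrow> x * w = (\<Sum>v\<in>W. c w v * v)" "\<And>w v. w \<in> W \<Longrightarrow> c w v \<in> S"
    by metis
  define A where "A = Matrix.mat n n (\<lambda>(i, j). c (ws ! i) (ws ! j))"
  define v where "v = Matrix.vec n (\<lambda>i. ws ! i)"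
  have A: "A \<in> carrier_mat n n" and v: "v \<in> carrier_vec n" by (auto simp: A_def v_def)
  obtain i where i: "i < n" "ws ! i = 1"
    using assms(2) ws by (metis in_set_conv_nth n_def)
  have "v \<noteq> 0\<^sub>v n"
  proof
    assume "v = 0\<^sub>v n"
    then have "v $ i = 0" using i by simp
    then show False using i by (simp add: v_def)
  qed
  moreover have "A *\<^sub>v v = x \<cdot>\<^sub>v v"
  proof (rule eq_vecI)
    fix i assume i: "i < dim_vec (x \<cdot>\<^sub>v v)"
    then have "i < n" by (simp add: v_def)
    have "(A *\<^sub>v v) $ i = (\<Sum>j<n. c (ws ! i) (ws ! j) * ws ! j)"
      using \<open>i < n\<close> by (auto simp: A_def v_def scalar_prod_def atLeast0LessThan)
    also have "\<dots> = (\<Sum>u\<in>W. c (ws ! i) u * u)"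
      using ws by (intro sum.reindex_bij_betw[of "\<lambda>j. ws ! j"]) (auto simp: n_def bij_betw_nth)
    also have "\<dots> = x * ws ! i"
      using c(1)[of "ws ! i"] ws \<open>i < n\<close> by (auto simp: n_def)
    finally show "(A *\<^sub>v v) $ i = (x \<cdot>\<^sub>v v) $ i"
      using \<open>i < n\<close> by (simp add: v_def)
  qed (auto simp: A_def v_def)
  ultimately have "eigenvalue A x"
    using A v unfolding eigenvalue_def eigenvector_def by auto
  then have "poly (char_poly A) x = 0"
    using eigenvalue_root_char_poly[OF A] by simp
  moreover have "char_poly A \<in> polys"
    unfolding char_poly_def
  proof (rule polys_det[of _ n])
    show "char_poly_matrix A \<in> carrier_mat n n" using A by simp
    fix i j assume "i < n" "j < n"
    then show "char_poly_matrix A $$ (i, j) \<in> polys"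
      using c(2)[of "ws ! i" "ws ! j"] ws by (auto simp: char_poly_matrix_def A_def n_def)
  qed
  ultimately show ?thesis
    unfolding integral_def using degree_monic_char_poly[OF A] by blast
qed

text \<open>
  Sums and products act on the finitely many monomials \<open>x\<^sup>i y\<^sup>j\<close> with exponents below the degrees
  of the two monic equations, which reduce the overflowing powers.
\<close>

lemma integral_add_mult:
  assumes "integral x" "integral y"
  shows "integral (x + y) \<and> integral (x * y)"
proof -
  from assms obtain p q where p: "p \<in> polys" "lead_coeff p = 1" "poly p x = 0"
    and q: "q \<in> polys" "lead_coeff q = 1" "poly q y = 0"
    unfolding integral_def by blast
  define n m where "n = degree p" and "m = degree q"
  have pos: "n > 0" "m > 0"
    using p q unfolding n_def m_def by (metis degree_eq_zeroE gr0I coeff_pCons_0 poly_const_conv zero_neq_one)+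
  define W where "W = (\<lambda>(i, j). x ^ i * y ^ j) ` ({..<n} \<times> {..<m})"
  have fin: "finite W" by (simp add: W_def)
  have one: "1 \<in> W" unfolding W_def using pos by (force intro!: image_eqI[of _ _ "(0,0)"])
  have W: "x ^ i * y ^ j \<in> combinations W" if "i < n" "j < m" for i j
    using that by (intro combinations_base fin) (auto simp: W_def)
  have red: "z ^ degree r = (\<Sum>k<degree r. (- coeff r k) * z ^ k)"
    if "poly r z = 0" "lead_coeff r = 1" for r :: "complex poly" and z
  proof -
    have "0 = (\<Sum>k\<le>degree r. coeff r k * z ^ k)" using that by (simp add: poly_altdef)
    also have "\<dots> = (\<Sum>k<degree r. coeff r k * z ^ k) + z ^ degree r"
      using that by (simp add: lessThan_Suc_atMost[symmetric])
    finally show ?thesis by (simp add: sum_negf eq_neg_iff_add_eq_0 add.commute)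
  qed
  have xW: "x * w \<in> combinations W" if "w \<in> W" for w
  proof -
    from that obtain i j where ij: "i < n" "j < m" "w = x ^ i * y ^ j" by (auto simp: W_def)
    show ?thesis
    proof (cases "Suc i < n")
      case True
      then show ?thesis using W[of "Suc i" j] ij by (simp add: mult.assoc)
    next
      case False
      then have "n = Suc i" using ij by simp
      then have "x * w = x ^ n * y ^ j" by (simp add: ij)
      also have "\<dots> = (\<Sum>k<n. (- coeff p k) * (x ^ k * y ^ j))"
        using red[OF p(3,2)] by (simp add: n_def sum_distrib_right mult.assoc)
      also have "\<dots> \<in> combinations W"
        by (intro combinations_sum combinations_scale W) (use p(1) ij in \<open>auto simp: polys_coeff\<close>)
      finally show ?thesis .
    qed
  qed
  have yW: "y * w \<in> combinations W" if "w \<in> W" for w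
  proof -
    from that obtain i j where ij: "i < n" "j < m" "w = x ^ i * y ^ j" by (auto simp: W_def)
    show ?thesis
    proof (cases "Suc j < m")
      case True
      then show ?thesis using W[of i "Suc j"] ij by (simp add: mult_ac)
    next
      case False
      then have "m = Suc j" using ij by simp
      then have "y * w = x ^ i * y ^ m" by (simp add: ij)
      also have "\<dots> = (\<Sum>k<m. (- coeff q k) * (x ^ i * y ^ k))"
        using red[OF q(3,2)] by (simp add: m_def sum_distrib_left mult_ac)
      also have "\<dots> \<in> combinations W"
        by (intro combinations_sum combinations_scale W) (use q(1) ij in \<open>auto simp: polys_coeff\<close>)
      finally show ?thesis .
    qed
  qed
  have "integral (x + y)"
    using xW yW by (intro integral_of_stable[OF fin one]) (simp add: combinations_add distrib_right)
  moreover have "integral (x * y)"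
    using xW yW by (intro integral_of_stable[OF fin one]) (simp add: combinations_stable mult.assoc)
  ultimately show ?thesis ..
qed

lemma integral_base: "x \<in> S \<Longrightarrow> integral x"
  unfolding integral_def by (intro bexI[of _ "[:- x, 1:]"]) auto

lemma complex_subring_integral: "complex_subring {x. integral x}"
proof
  fix x y :: complex
  show "1 \<in> {x. integral x}" by (simp add: integral_base)
  show "x + y \<in> {x. integral x}" "x * y \<in> {x. integral x}"
    if "x \<in> {x. integral x}" "y \<in> {x. integral x}"
    using that integral_add_mult by auto
  show "- x \<in> {x. integral x}" if "x \<in> {x. integral x}"
    using integral_add_mult[of "-1" x] integral_base[of "-1"] that by auto
qed

end

interpretation Ints: complex_subring \<int>
  by unfold_locales auto

lemma algebraic_int_iff_integral: "algebraic_int x \<longleftrightarrow> Ints.integral x"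
  unfolding Ints.integral_def algebraic_int.simps Ints.polys_def by auto

interpretation Alg_ints: complex_subring "{x. algebraic_int x}"
  using Ints.complex_subring_integral by (simp add: algebraic_int_iff_integral)

section \<open>Subfields, minimal polynomials and primitive elements\<close>

locale complex_subfield = complex_subring S for S +
  assumes inverse_mem [simp]: "x \<in> S \<Longrightarrow> inverse x \<in> S"

interpretation Rats: complex_subfield \<rat>
  by unfold_locales auto

lemma CC_simps [simp]:
  "carrier CC = UNIV" "x \<otimes>\<^bsub>CC\<^esub> y = x * y" "x \<oplus>\<^bsub>CC\<^esub> y = x + y" "\<one>\<^bsub>CC\<^esub> = 1" "\<zero>\<^bsub>CC\<^esub> = 0"
  by (auto simp: ring_of_type_algebra_def)

lemma field_CC: "Ring.field CC"
  by (rule field_from_type_algebra)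

interpretation CC: Ring.cring CC
  by (rule cring_from_type_algebra)

lemma CC_minus [simp]: "\<ominus>\<^bsub>CC\<^esub> x = - x"
  using CC.minus_equality[of "- x" x] by simp

lemma CC_inv: "x \<noteq> 0 \<Longrightarrow> inv\<^bsub>CC\<^esub> x = inverse x"
  using CC.comm_inv_char[of x "inverse x"] by simp

lemma subring_CC_iff: "subring E CC \<longleftrightarrow> complex_subring E"
proof
  assume E: "subring E CC"
  show "complex_subring E"
    using subringE(3,5,6,7)[OF E] by unfold_locales auto
next
  assume "complex_subring E"
  then interpret complex_subring E .
  show "subring E CC"
    by (rule CC.subringI) auto
qed

lemma subfield_CC_iff: "subfield E CC \<longleftrightarrow> complex_subfield E"
proof
  assume E: "subfield E CC"
  then interpret complex_subring E
    using subfieldE(1)[OF E] by (simp add: subring_CC_iff)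
  show "complex_subfield E"
  proof
    show "inverse x \<in> E" if "x \<in> E" for x
      using CC.subfield_m_inv(1)[OF E, of x] that by (cases "x = 0") (auto simp: CC_inv)
  qed
next
  assume "complex_subfield E"
  then interpret complex_subfield E .
  have "subring E CC"
    using complex_subring_axioms by (simp add: subring_CC_iff)
  then show "subfield E CC"
    by (rule field.subfieldI'[OF field_CC]) (auto simp: CC_inv)
qed

context complex_subfield
begin

lemma divide_mem [simp]: "x \<in> S \<Longrightarrow> y \<in> S \<Longrightarrow> x / y \<in> S"
  by (simp add: divide_inverse)

lemma Rats_subset: "\<rat> \<subseteq> S"
proof
  fix x :: complex assume "x \<in> \<rat>"
  then obtain a b :: int where "x = of_int a / of_int b"
    by (elim Rats_cases') blast
  then show "x \<in> S" by simp
qed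

definition minpoly :: "complex poly \<Rightarrow> complex \<Rightarrow> bool" where
  "minpoly m x \<longleftrightarrow> m \<in> polys \<and> lead_coeff m = 1 \<and> poly m x = 0 \<and>
     (\<forall>q\<in>polys. q \<noteq> 0 \<longrightarrow> poly q x = 0 \<longrightarrow> degree m \<le> degree q)"

lemma minpolyD:
  assumes "minpoly m x"
  shows "m \<in> polys" "lead_coeff m = 1" "poly m x = 0" "m \<noteq> 0" "degree m > 0"
    "q \<in> polys \<Longrightarrow> q \<noteq> 0 \<Longrightarrow> poly q x = 0 \<Longrightarrow> degree m \<le> degree q"
proof -
  show *: "m \<in> polys" "lead_coeff m = 1" "poly m x = 0"
    "q \<in> polys \<Longrightarrow> q \<noteq> 0 \<Longrightarrow> poly q x = 0 \<Longrightarrow> degree m \<le> degree q"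
    using assms by (auto simp: minpoly_def)
  then show "m \<noteq> 0" by auto
  show "degree m > 0"
    using * by (metis degree_eq_zeroE gr0I coeff_pCons_0 poly_const_conv zero_neq_one)
qed

lemma integral_of_root:
  assumes "p \<in> polys" "p \<noteq> 0" "poly p x = 0"
  shows "integral x"
  unfolding integral_def
  by (intro bexI[of _ "smult (inverse (lead_coeff p)) p"]) (use assms in \<open>auto simp: polys_coeff\<close>)

lemma minpoly_exists:
  assumes "integral x"
  shows "\<exists>m. minpoly m x"
proof -
  define P where "P = (\<lambda>p. p \<in> polys \<and> p \<noteq> 0 \<and> poly p x = 0)"
  have "\<exists>p. P p"
    using assms unfolding integral_def P_def by (metis leading_coeff_0_iff zero_neq_one)
  then obtain p where p: "P p" "\<And>q. P q \<Longrightarrow> degree p \<le> degree q"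
    using ex_has_least_nat[of P _ degree] by blast
  have "minpoly (smult (inverse (lead_coeff p)) p) x"
    unfolding minpoly_def using p by (auto simp: P_def polys_coeff)
  then show ?thesis ..
qed

lemma minpoly_dvd:
  assumes m: "minpoly m x" and q: "q \<in> polys" "poly q x = 0"
  shows "\<exists>s\<in>polys. q = s * m"
proof -
  obtain s r where sr: "s \<in> polys" "r \<in> polys" "q = s * m + r" "r = 0 \<or> degree r < degree m"
    using polys_divide_monic[OF minpolyD(1,2)[OF m] q(1)] by blast
  then have "poly r x = 0" using q minpolyD(3)[OF m] by simp
  then have "r = 0" using minpolyD(6)[OF m sr(2)] sr(4) by force
  then show ?thesis using sr by auto
qed

text \<open>
  A minimal polynomial is irreducible, so it is also minimal for each of its roots. This makes the
  relation of being conjugate symmetric.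
\<close>

lemma minpoly_conjugate:
  assumes m: "minpoly m x" and y: "poly m y = 0"
  shows "minpoly m y"
proof -
  note mD = minpolyD[OF m]
  have "integral y" using mD(1,4) y by (rule integral_of_root)
  then obtain m' where m': "minpoly m' y" using minpoly_exists by blast
  obtain s where s: "s \<in> polys" "m = s * m'" using minpoly_dvd[OF m' mD(1) y] by blast
  have "s \<noteq> 0" "m' \<noteq> 0" using s mD(4) by auto
  then have deg: "degree m = degree s + degree m'" by (simp add: s degree_mult_eq)
  have "poly s x \<noteq> 0"
    using mD(6)[OF s(1)] \<open>s \<noteq> 0\<close> deg minpolyD(5)[OF m'] by force
  then have "poly m' x = 0" using s mD(3) by auto
  then have "degree m \<le> degree m'" using mD(6)[of m'] minpolyD(1)[OF m'] \<open>m' \<noteq> 0\<close> by auto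
  then show ?thesis
    unfolding minpoly_def using mD y minpolyD(6)[OF m'] by (meson le_trans)
qed

text \<open>
  A multiple root would be annihilated by the derivative, which has smaller degree.
\<close>

lemma minpoly_rsquarefree:
  assumes m: "minpoly m x"
  shows "rsquarefree m"
  unfolding rsquarefree_roots
proof (intro allI notI)
  fix y assume y: "poly m y = 0 \<and> poly (pderiv m) y = 0"
  have "minpoly m y" using minpoly_conjugate[OF m] y by blast
  note mD = minpolyD[OF this]
  have "pderiv m \<noteq> 0" using mD(5) by (simp add: pderiv_eq_0_iff)
  then have "degree m \<le> degree (pderiv m)" using mD(1) y by (intro mD(6)) auto
  then show False using mD(5) by (simp add: degree_pderiv)
qed

lemma minpoly_card_roots:
  assumes m: "minpoly m x"
  shows "card {z. poly m z = 0} = degree m"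
proof -
  have "m = (\<Prod>z | poly m z = 0. [:- z, 1:])"
    using complex_poly_decompose_rsquarefree[OF minpoly_rsquarefree[OF m]] minpolyD(2)[OF m] by simp
  then have "degree m = degree (\<Prod>z | poly m z = 0. [:- z, 1:])" by (rule arg_cong)
  also have "\<dots> = (\<Sum>z | poly m z = 0. degree [:- z, 1:])"
    by (rule degree_prod_eq_sum_degree) auto
  finally show ?thesis by simp
qed

text \<open>
  The ring \<open>S[x]\<close>. For algebraic \<open>x\<close> it is the field \<open>S(x)\<close> (\<open>adj_subfield\<close>).
\<close>

definition adj :: "complex \<Rightarrow> complex set" where
  "adj x = (\<lambda>p. poly p x) ` polys"

lemma base_in_adj: "S \<subseteq> adj x"
proof
  fix a assume "a \<in> S"
  then show "a \<in> adj x" unfolding adj_def by (intro image_eqI[of _ _ "[:a:]"]) auto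
qed

lemma gen_in_adj: "x \<in> adj x"
  unfolding adj_def by (intro image_eqI[of _ _ "[:0, 1:]"]) auto

lemma adj_subset:
  assumes "complex_subring T" "S \<subseteq> T" "x \<in> T"
  shows "adj x \<subseteq> T"
proof -
  interpret T: complex_subring T by fact
  show ?thesis
    using assms(2,3) by (auto simp: adj_def polys_def T.polys_def subset_iff intro!: T.polys_eval)
qed

lemma complex_subring_adj: "complex_subring (adj x)"
proof
  show "1 \<in> adj x" using base_in_adj one_mem by blast
  show "a + b \<in> adj x" "a * b \<in> adj x" if ab: "a \<in> adj x" "b \<in> adj x" for a b
  proof -
    from ab obtain p q where "p \<in> polys" "q \<in> polys" "a = poly p x" "b = poly q x"
      by (auto simp: adj_def)
    then have "p + q \<in> polys" "a + b = poly (p + q) x" "p * q \<in> polys" "a * b = poly (p * q) x"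
      by simp_all
    then show "a + b \<in> adj x" "a * b \<in> adj x"
      unfolding adj_def by blast+
  qed
  show "- a \<in> adj x" if "a \<in> adj x" for a
  proof -
    from that obtain p where "p \<in> polys" "a = poly p x" by (auto simp: adj_def)
    then show ?thesis unfolding adj_def by (intro image_eqI[of _ _ "- p"]) auto
  qed
qed

text \<open>
  Every element \<open>a\<close> of \<open>S[x]\<close> is algebraic, and the minimal equation
  \<open>c + a \<cdot> q(a) = 0\<close> exhibits the inverse of \<open>a\<close> as a polynomial in \<open>a\<close>.
\<close>

lemma adj_subfield:
  assumes "integral x"
  shows "complex_subfield (adj x)"
proof -
  interpret A: complex_subring "adj x" by (rule complex_subring_adj)
  have "inverse a \<in> adj x" if a: "a \<in> adj x" for a
  proof (cases "a = 0")
    case False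
    have "adj x \<subseteq> {y. integral y}"
      by (rule adj_subset[OF complex_subring_integral]) (use assms integral_base in auto)
    then obtain m where m: "minpoly m a" using a minpoly_exists by blast
    obtain c q where mq: "m = pCons c q" by (cases m)
    then have cq: "c \<in> S" "q \<in> polys" "c + a * poly q a = 0"
      using minpolyD(1,3)[OF m] by simp_all
    \<comment> \<open>The constant coefficient cannot vanish: otherwise \<open>q\<close> would be a shorter annihilator of \<open>a\<close>.\<close>
    have "c \<noteq> 0"
    proof
      assume "c = 0"
      then have "poly q a = 0" using cq(3) False by simp
      moreover have "q \<noteq> 0" using \<open>c = 0\<close> mq minpolyD(4)[OF m] by auto
      ultimately have "degree m \<le> degree q" using minpolyD(6)[OF m cq(2)] by blast
      then show False using \<open>q \<noteq> 0\<close> by (simp add: mq)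
    qed
    have "a * poly q a = - c" using cq(3) by (simp only: add_eq_0_iff)
    then have "a * (- (inverse c * poly q a)) = 1" using \<open>c \<noteq> 0\<close> by (simp add: field_simps)
    then have "inverse a = - (inverse c * poly q a)" by (rule inverse_unique)
    moreover have "q \<in> A.polys" using cq(2) base_in_adj by (auto simp: polys_def A.polys_def)
    moreover have "inverse c \<in> adj x" using cq(1) base_in_adj inverse_mem by blast
    ultimately show ?thesis using a by simp
  qed simp
  then show ?thesis by unfold_locales
qed

text \<open>
  For all but finitely many \<open>c\<close>, the number \<open>b\<close> is the only common root of \<open>g(X)\<close> and
  \<open>f(\<theta> - c X)\<close>, where \<open>f\<close>, \<open>g\<close> are the minimal polynomials of \<open>a\<close>, \<open>b\<close>. Its minimal
  polynomial over \<open>S(\<theta>)\<close> divides both and has simple roots, so it is linear.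
\<close>

lemma primitive_element2:
  assumes a: "integral a" and b: "integral b"
  shows "\<exists>c::nat. a \<in> adj (a + of_nat c * b) \<and> b \<in> adj (a + of_nat c * b)"
proof -
  obtain f g where f: "minpoly f a" and g: "minpoly g b" using minpoly_exists a b by blast
  have fin: "finite {z. poly f z = 0}" "finite {z. poly g z = 0}"
    using minpolyD(4)[OF f] minpolyD(4)[OF g] poly_roots_finite by blast+
  \<comment> \<open>Outside these finitely many coefficients there is no second common root.\<close>
  define B where "B = (\<lambda>(u, v). (u - a) / (b - v)) ` ({z. poly f z = 0} \<times> {z. poly g z = 0})"
  have "finite B" using fin by (simp add: B_def)
  have "\<exists>c::nat. of_nat c \<notin> B"
  proof (rule ccontr)
    assume "\<not> (\<exists>c::nat. of_nat c \<notin> B)"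
    then have "range (of_nat :: nat \<Rightarrow> complex) \<subseteq> B" by auto
    moreover have "infinite (range (of_nat :: nat \<Rightarrow> complex))"
      by (auto intro!: range_inj_infinite injI)
    ultimately show False using \<open>finite B\<close> finite_subset by metis
  qed
  then obtain c :: nat where c: "of_nat c \<notin> B" ..
  define \<theta> where "\<theta> = a + of_nat c * b"
  have \<theta>: "integral \<theta>"
    unfolding \<theta>_def using integral_add_mult a b integral_base by simp
  interpret T: complex_subfield "adj \<theta>" using adj_subfield[OF \<theta>] .
  have sub: "polys \<subseteq> T.polys" using base_in_adj by (auto simp: polys_def T.polys_def)
  have "T.integral b"
    using b sub unfolding integral_def T.integral_def by blast
  then obtain h where h: "T.minpoly h b" using T.minpoly_exists by blast
  have "poly g b = 0" "g \<in> T.polys" using minpolyD[OF g] sub by auto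
  then obtain s where s: "g = s * h" using T.minpoly_dvd[OF h] by blast
  define F where "F = pcompose f [:\<theta>, - of_nat c:]"
  have "poly F b = 0"
    using minpolyD(3)[OF f] by (simp add: F_def poly_pcompose \<theta>_def)
  moreover have "F \<in> T.polys"
    unfolding F_def using minpolyD(1)[OF f] sub by (intro T.polys_pcompose) (auto simp: gen_in_adj)
  ultimately obtain t where t: "F = t * h" using T.minpoly_dvd[OF h] by blast
  have "y = b" if y: "poly h y = 0" for y
  proof (rule ccontr)
    assume "y \<noteq> b"
    have "poly g y = 0" "poly F y = 0" using y s t by auto
    then have "poly f (\<theta> - of_nat c * y) = 0" by (simp add: F_def poly_pcompose mult.commute)
    moreover have "of_nat c = ((\<theta> - of_nat c * y) - a) / (b - y)"
      using \<open>y \<noteq> b\<close> by (simp add: \<theta>_def field_simps)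
    ultimately have "of_nat c \<in> B"
      unfolding B_def using \<open>poly g y = 0\<close> by (intro image_eqI[of _ _ "(\<theta> - of_nat c * y, y)"]) auto
    then show False using c by simp
  qed
  then have "{z. poly h z = 0} = {b}" using T.minpolyD(3)[OF h] by blast
  then have "degree h = 1" using T.minpoly_card_roots[OF h] by simp
  then have "coeff h 0 + b = 0"
    using T.minpolyD(2,3)[OF h] by (simp add: poly_altdef)
  then have "b = - coeff h 0" by (simp add: eq_neg_iff_add_eq_0 add.commute)
  then have bT: "b \<in> adj \<theta>" using T.minpolyD(1)[OF h] by (simp add: T.polys_coeff)
  have "a = \<theta> - of_nat c * b" by (simp add: \<theta>_def)
  then have "a \<in> adj \<theta>" using bT gen_in_adj by simp
  then show ?thesis using bT unfolding \<theta>_def by blast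
qed

text \<open>
  The primitive element is a combination of the given elements with coefficients in the natural
  numbers. This explicit shape is what later shows that conjugating it stays inside the field.
\<close>

lemma primitive_element:
  assumes "finite Z" "\<And>z. z \<in> Z \<Longrightarrow> integral z"
  shows "\<exists>c :: complex \<Rightarrow> nat. Z \<subseteq> adj (\<Sum>z\<in>Z. of_nat (c z) * z)"
  using assms
proof (induction Z rule: finite_induct)
  case empty
  then show ?case by simp
next
  case (insert b Z)
  then obtain c :: "complex \<Rightarrow> nat" where c: "Z \<subseteq> adj (\<Sum>z\<in>Z. of_nat (c z) * z)" by auto
  define a where "a = (\<Sum>z\<in>Z. of_nat (c z) * z)"
  interpret I: complex_subring "{x. integral x}" by (rule complex_subring_integral)
  have a: "a \<in> {x. integral x}"
    unfolding a_def using insert.prems by (intro I.sum_mem I.mult_mem) (auto intro: integral_base)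
  moreover have b: "integral b" using insert.prems by auto
  ultimately obtain k :: nat where k: "a \<in> adj (a + of_nat k * b)" "b \<in> adj (a + of_nat k * b)"
    using primitive_element2 by blast
  have "integral (a + of_nat k * b)"
    using a b integral_add_mult integral_base by auto
  then interpret T: complex_subfield "adj (a + of_nat k * b)" by (rule adj_subfield)
  have "adj a \<subseteq> adj (a + of_nat k * b)"
    using T.complex_subring_axioms base_in_adj k(1) by (rule adj_subset)
  moreover have "(\<Sum>z\<in>insert b Z. of_nat ((c(b := k)) z) * z) = a + of_nat k * b"
  proof -
    have "(\<Sum>z\<in>Z. of_nat ((c(b := k)) z) * z) = a"
      unfolding a_def using insert.hyps by (intro sum.cong) auto
    then show ?thesis using insert.hyps by simp
  qed
  ultimately show ?case
    using k c unfolding a_def[symmetric] by (intro exI[of _ "c(b := k)"]) auto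
qed

end

lemma algebraic_iff_integral: "algebraic x \<longleftrightarrow> Rats.integral x"
proof
  assume "algebraic x"
  then obtain p where "\<forall>i. coeff p i \<in> \<rat>" "p \<noteq> 0" "poly p x = 0"
    unfolding algebraic_altdef by blast
  then show "Rats.integral x"
    by (intro Rats.integral_of_root[of p]) (auto simp: Rats.polys_def)
next
  assume "Rats.integral x"
  then obtain p where "p \<in> Rats.polys" "lead_coeff p = 1" "poly p x = 0"
    unfolding Rats.integral_def by blast
  then show "algebraic x"
    unfolding algebraic_altdef by (intro exI[of _ p]) (auto simp: Rats.polys_def)
qed

section \<open>Galois extensions of the rational numbers\<close>

locale complex_hom = complex_subring M for M +
  fixes h :: "complex \<Rightarrow> complex"
  assumes hom_one [simp]: "h 1 = 1"
    and hom_add: "x \<in> M \<Longrightarrow> y \<in> M \<Longrightarrow> h (x + y) = h x + h y"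
    and hom_mult: "x \<in> M \<Longrightarrow> y \<in> M \<Longrightarrow> h (x * y) = h x * h y"
begin

lemma hom_zero [simp]: "h 0 = 0"
  using hom_add[of 0 0] by simp

lemma hom_uminus: "x \<in> M \<Longrightarrow> h (- x) = - h x"
  using hom_add[of x "- x"] by (simp add: eq_neg_iff_add_eq_0 add.commute)

lemma hom_diff: "x \<in> M \<Longrightarrow> y \<in> M \<Longrightarrow> h (x - y) = h x - h y"
  using hom_add[of x "- y"] hom_uminus[of y] by simp

lemma hom_power: "x \<in> M \<Longrightarrow> h (x ^ n) = h x ^ n"
  by (induction n) (auto simp: hom_mult)

lemma hom_sum: "(\<And>i. i \<in> A \<Longrightarrow> f i \<in> M) \<Longrightarrow> h (sum f A) = (\<Sum>i\<in>A. h (f i))"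
  by (induction A rule: infinite_finite_induct) (auto simp: hom_add)

lemma hom_prod: "(\<And>i. i \<in> A \<Longrightarrow> f i \<in> M) \<Longrightarrow> h (prod f A) = (\<Prod>i\<in>A. h (f i))"
  by (induction A rule: infinite_finite_induct) (auto simp: hom_mult)

lemma hom_of_nat [simp]: "h (of_nat n) = of_nat n"
  by (induction n) (auto simp: hom_add)

lemma hom_of_int [simp]: "h (of_int k) = of_int k"
  by (cases k) (auto simp: hom_uminus hom_diff)

text \<open>
  A rational number solves a linear equation over the integers, which are fixed.
\<close>

lemma hom_rat: "x \<in> \<rat> \<Longrightarrow> x \<in> M \<Longrightarrow> h x = x"
proof -
  assume x: "x \<in> \<rat>" "x \<in> M"
  then obtain a b :: int where ab: "b > 0" "x = of_int a / of_int b"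
    by (elim Rats_cases') blast
  then have "of_int b * x = of_int a" by simp
  then have "h (of_int b * x) = of_int a" by simp
  then have "of_int b * h x = of_int b * x"
    using x(2) \<open>of_int b * x = of_int a\<close> by (metis hom_mult hom_of_int of_int_mem)
  then show ?thesis using ab(1) by simp
qed

lemma hom_poly:
  assumes "\<rat> \<subseteq> M" "p \<in> Rats.polys" "x \<in> M"
  shows "h (poly p x) = poly p (h x)"
  using assms(2)
proof (induction p)
  case (pCons a p)
  then have "p \<in> Rats.polys" by simp
  then have "p \<in> polys"
    using assms(1) by (auto simp: Rats.polys_def polys_def)
  then have "poly p x \<in> M"
    using assms(3) by (rule polys_eval)
  then show ?case using pCons assms by (auto simp: hom_add hom_mult hom_rat)
qed auto

lemma hom_det:
  assumes "A \<in> carrier_mat n n" "\<And>i j. i < n \<Longrightarrow> j < n \<Longrightarrow> A $$ (i, j) \<in> M"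
  shows "h (Determinant.det A) = Determinant.det (map_mat h A)"
proof -
  have mem: "A $$ (i, p i) \<in> M" if "p permutes {0..<n}" "i < n" for p i
    using assms(2)[of i "p i"] that permutes_in_image[of p "{0..<n}" i] by simp
  have A': "map_mat h A \<in> carrier_mat n n" using assms(1) by simp
  have "h (signof p * (\<Prod>i = 0..<n. A $$ (i, p i))) = signof p * (\<Prod>i = 0..<n. h (A $$ (i, p i)))"
    if "p permutes {0..<n}" for p
  proof -
    have 1: "(\<Prod>i = 0..<n. A $$ (i, p i)) \<in> M"
      by (rule prod_mem, rule mem[OF that]) auto
    have 2: "h (\<Prod>i = 0..<n. A $$ (i, p i)) = (\<Prod>i = 0..<n. h (A $$ (i, p i)))"
      by (rule hom_prod, rule mem[OF that]) auto
    show ?thesis using 1 2 by (simp add: hom_mult)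
  qed
  moreover have "signof p * (\<Prod>i = 0..<n. A $$ (i, p i)) \<in> M" if "p permutes {0..<n}" for p
    using mem[OF that] by (intro mult_mem prod_mem) auto
  ultimately show ?thesis
    unfolding det_def'[OF assms(1)] det_def'[OF A']
    using assms(1) by (subst hom_sum) (auto intro!: sum.cong prod.cong simp: permutes_in_image)
qed

lemma hom_algebraic_int:
  assumes "x \<in> M" "algebraic_int x" "\<rat> \<subseteq> M"
  shows "algebraic_int (h x)"
proof -
  from assms(2) obtain p where p: "p \<in> Ints.polys" "lead_coeff p = 1" "poly p x = 0"
    unfolding algebraic_int_iff_integral Ints.integral_def by blast
  have "p \<in> Rats.polys" using p(1) Ints_subset_Rats by (auto simp: Ints.polys_def Rats.polys_def)
  then have "poly p (h x) = 0" using hom_poly[OF assms(3) _ assms(1), of p] p(3) by simp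
  then show ?thesis using p unfolding algebraic_int_iff_integral Ints.integral_def by blast
qed

lemma hom_coeff_prod_linear:
  assumes "finite A" "\<And>r. r \<in> A \<Longrightarrow> a r \<in> M"
  shows "h (coeff (\<Prod>r\<in>A. [:- a r, 1:]) i) = coeff (\<Prod>r\<in>A. [:- h (a r), 1:]) i"
  using assms
proof (induction A arbitrary: i rule: finite_induct)
  case empty
  then show ?case by (auto simp: one_pCons coeff_pCons split: nat.splits)
next
  case (insert r A)
  have "(\<Prod>r\<in>A. [:- a r, 1:]) \<in> polys" using insert.prems by auto
  then have "coeff (\<Prod>r\<in>A. [:- a r, 1:]) j \<in> M" for j by (rule polys_coeff)
  then show ?case
    using insert by (auto simp: coeff_pCons hom_add hom_mult hom_diff hom_uminus split: nat.splits)
qed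

lemma hom_nonzero:
  assumes "complex_subfield M" "x \<in> M" "x \<noteq> 0"
  shows "h x \<noteq> 0"
proof
  interpret complex_subfield M by fact
  assume "h x = 0"
  have "h x * h (inverse x) = 1"
    using hom_mult[of x "inverse x"] assms by simp
  with \<open>h x = 0\<close> show False by simp
qed

lemma hom_inj:
  assumes "complex_subfield M"
  shows "inj_on h M"
proof (rule inj_onI)
  fix x y assume xy: "x \<in> M" "y \<in> M" "h x = h y"
  then have "h (x - y) = 0" by (simp add: hom_diff)
  then show "x = y" using hom_nonzero[OF assms, of "x - y"] xy by auto
qed

end

text \<open>
  The substitution \<open>p(\<theta>) \<mapsto> p(r)\<close>. It is independent of the choice of \<open>p\<close> exactly when \<open>r\<close> is a
  conjugate of \<open>\<theta>\<close> (\<open>conj_map_poly\<close>).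
\<close>

definition conj_map :: "complex \<Rightarrow> complex \<Rightarrow> complex \<Rightarrow> complex" where
  "conj_map \<theta> r x = poly (SOME p. p \<in> Rats.polys \<and> poly p \<theta> = x) r"

lemma conj_map_poly:
  assumes f: "Rats.minpoly f \<theta>" and r: "poly f r = 0" and p: "p \<in> Rats.polys"
  shows "conj_map \<theta> r (poly p \<theta>) = poly p r"
proof -
  define q where "q = (SOME q. q \<in> Rats.polys \<and> poly q \<theta> = poly p \<theta>)"
  have "q \<in> Rats.polys \<and> poly q \<theta> = poly p \<theta>"
    unfolding q_def by (rule someI[of _ p]) (use p in auto)
  then have "q - p \<in> Rats.polys" "poly (q - p) \<theta> = 0" using p by auto
  then obtain s where "q - p = s * f" using Rats.minpoly_dvd[OF f] by blast
  then have "poly (q - p) r = 0" using r by simp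
  then show ?thesis by (simp add: conj_map_def q_def)
qed

lemma conj_map_hom:
  assumes f: "Rats.minpoly f \<theta>" and r: "poly f r = 0"
  shows "complex_hom (Rats.adj \<theta>) (conj_map \<theta> r)"
proof -
  have "Rats.integral \<theta>"
    using Rats.minpolyD[OF f] unfolding Rats.integral_def by blast
  then interpret complex_subfield "Rats.adj \<theta>" by (rule Rats.adj_subfield)
  note cp = conj_map_poly[OF f r]
  show ?thesis
  proof
    show "conj_map \<theta> r 1 = 1" using cp[of 1] by simp
    fix x y assume "x \<in> Rats.adj \<theta>" "y \<in> Rats.adj \<theta>"
    then obtain p q where "p \<in> Rats.polys" "q \<in> Rats.polys" "x = poly p \<theta>" "y = poly q \<theta>"
      by (auto simp: Rats.adj_def)
    then show "conj_map \<theta> r (x + y) = conj_map \<theta> r x + conj_map \<theta> r y"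
      "conj_map \<theta> r (x * y) = conj_map \<theta> r x * conj_map \<theta> r y"
      using cp[of "p + q"] cp[of "p * q"] cp[of p] cp[of q] by auto
  qed
qed

lemma conj_map_gen:
  assumes f: "Rats.minpoly f \<theta>" and r: "poly f r = 0"
  shows "conj_map \<theta> r \<theta> = r"
  using conj_map_poly[OF f r, of "[:0, 1:]"] by simp

lemma integral_gen: "Rats.minpoly f \<theta> \<Longrightarrow> Rats.integral \<theta>"
  using Rats.minpolyD[of f \<theta>] unfolding Rats.integral_def by blast

text \<open>
  The field \<open>\<rat>(\<delta>)\<close> contains all conjugates of \<open>\<delta>\<close>, so it is Galois over \<open>\<rat>\<close>. Its
  automorphisms \<open>\<tau> r\<close> are indexed by the conjugates \<open>r \<in> \<Gamma>\<close> of \<open>\<delta>\<close>, with \<open>\<tau> r \<delta> = r\<close>.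
\<close>

locale galois_field =
  fixes \<delta> f
  assumes minpoly: "Rats.minpoly f \<delta>"
    and normal: "{r. poly f r = 0} \<subseteq> Rats.adj \<delta>"
begin

definition "M = Rats.adj \<delta>"
definition "\<Gamma> = {r. poly f r = 0}"
definition "\<tau> = conj_map \<delta>"

sublocale M: complex_subfield M
  unfolding M_def using Rats.adj_subfield[OF integral_gen[OF minpoly]] .

lemma Rats_M: "\<rat> \<subseteq> M"
  by (rule M.Rats_subset)

lemma finite_\<Gamma>: "finite \<Gamma>"
  unfolding \<Gamma>_def using Rats.minpolyD(4)[OF minpoly] by (rule poly_roots_finite)

lemma \<delta>_\<Gamma>: "\<delta> \<in> \<Gamma>"
  unfolding \<Gamma>_def using Rats.minpolyD(3)[OF minpoly] by simp

lemma \<Gamma>_M: "\<Gamma> \<subseteq> M"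
  unfolding \<Gamma>_def M_def by (rule normal)

lemma \<tau>_hom: "r \<in> \<Gamma> \<Longrightarrow> complex_hom M (\<tau> r)"
  unfolding \<Gamma>_def M_def \<tau>_def using conj_map_hom[OF minpoly] by simp

lemma \<tau>_poly: "r \<in> \<Gamma> \<Longrightarrow> p \<in> Rats.polys \<Longrightarrow> \<tau> r (poly p \<delta>) = poly p r"
  unfolding \<Gamma>_def \<tau>_def using conj_map_poly[OF minpoly] by simp

lemma \<tau>_\<delta>: "r \<in> \<Gamma> \<Longrightarrow> \<tau> r \<delta> = r"
  unfolding \<Gamma>_def \<tau>_def using conj_map_gen[OF minpoly] by simp

lemma M_cases:
  assumes "x \<in> M"
  obtains p where "p \<in> Rats.polys" "x = poly p \<delta>"
  using assms unfolding M_def Rats.adj_def by auto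

lemma \<tau>_M: "r \<in> \<Gamma> \<Longrightarrow> x \<in> M \<Longrightarrow> \<tau> r x \<in> M"
proof -
  assume r: "r \<in> \<Gamma>" and "x \<in> M"
  then obtain p where p: "p \<in> Rats.polys" "x = poly p \<delta>" by (elim M_cases)
  have "p \<in> M.polys" using p(1) Rats_M by (auto simp: Rats.polys_def M.polys_def)
  then show ?thesis using p r \<Gamma>_M by (auto simp: \<tau>_poly intro!: M.polys_eval)
qed

lemma \<tau>_\<Gamma>: "s \<in> \<Gamma> \<Longrightarrow> r \<in> \<Gamma> \<Longrightarrow> \<tau> s r \<in> \<Gamma>"
proof -
  assume s: "s \<in> \<Gamma>" and r: "r \<in> \<Gamma>"
  interpret complex_hom M "\<tau> s" using \<tau>_hom[OF s] .
  have "\<tau> s (poly f r) = poly f (\<tau> s r)"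
    using r \<Gamma>_M Rats.minpolyD(1)[OF minpoly] by (intro hom_poly Rats_M) auto
  then show ?thesis using r by (simp add: \<Gamma>_def)
qed

lemma \<tau>_inj: "s \<in> \<Gamma> \<Longrightarrow> inj_on (\<tau> s) M"
  using complex_hom.hom_inj[OF \<tau>_hom M.complex_subfield_axioms] .

lemma \<tau>_bij: "s \<in> \<Gamma> \<Longrightarrow> bij_betw (\<tau> s) \<Gamma> \<Gamma>"
  unfolding bij_betw_def
  using endo_inj_surj[OF finite_\<Gamma>] \<tau>_\<Gamma> inj_on_subset[OF \<tau>_inj \<Gamma>_M] by blast

text \<open>
  The group law: composition corresponds to acting on the index.
\<close>

lemma \<tau>_comp: "s \<in> \<Gamma> \<Longrightarrow> r \<in> \<Gamma> \<Longrightarrow> x \<in> M \<Longrightarrow> \<tau> s (\<tau> r x) = \<tau> (\<tau> s r) x"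
proof -
  assume s: "s \<in> \<Gamma>" and r: "r \<in> \<Gamma>" and "x \<in> M"
  then obtain p where p: "p \<in> Rats.polys" "x = poly p \<delta>" by (elim M_cases)
  interpret complex_hom M "\<tau> s" using \<tau>_hom[OF s] .
  have "r \<in> M" using r \<Gamma>_M by auto
  then show ?thesis using p s r \<tau>_\<Gamma>[OF s r] by (simp add: \<tau>_poly hom_poly[OF Rats_M])
qed

lemma right_mult_bij: "s \<in> \<Gamma> \<Longrightarrow> bij_betw (\<lambda>r. \<tau> r s) \<Gamma> \<Gamma>"
proof -
  assume s: "s \<in> \<Gamma>"
  obtain t where t: "t \<in> \<Gamma>" "\<tau> s t = \<delta>"
    using \<tau>_bij[OF s] \<delta>_\<Gamma> unfolding bij_betw_def by (metis imageE)
  have "inj_on (\<lambda>r. \<tau> r s) \<Gamma>"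
  proof (rule inj_onI)
    fix r r' assume r: "r \<in> \<Gamma>" "r' \<in> \<Gamma>" "\<tau> r s = \<tau> r' s"
    have "\<tau> r (\<tau> s t) = \<tau> r' (\<tau> s t)"
      using r s t \<Gamma>_M by (subst (1 2) \<tau>_comp) auto
    then show "r = r'" using t r by (simp add: \<tau>_\<delta>)
  qed
  moreover have "(\<lambda>r. \<tau> r s) ` \<Gamma> \<subseteq> \<Gamma>" using s \<tau>_\<Gamma> by auto
  ultimately show ?thesis
    unfolding bij_betw_def using endo_inj_surj[OF finite_\<Gamma>] by blast
qed

text \<open>
  Write \<open>x = q(\<delta>)\<close> with \<open>q\<close> of degree less than \<open>f\<close>. If \<open>x\<close> is fixed, then \<open>q - x\<close> vanishes at all
  conjugates of \<open>\<delta>\<close>, which are too many unless \<open>q\<close> is constant.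
\<close>

lemma fixed_rational:
  assumes x: "x \<in> M" and inv: "\<And>r. r \<in> \<Gamma> \<Longrightarrow> \<tau> r x = x"
  shows "x \<in> \<rat>"
proof -
  note fD = Rats.minpolyD[OF minpoly]
  obtain p where p: "p \<in> Rats.polys" "x = poly p \<delta>" using x by (elim M_cases)
  obtain s q where sq: "s \<in> Rats.polys" "q \<in> Rats.polys" "p = s * f + q" "q = 0 \<or> degree q < degree f"
    using Rats.polys_divide_monic[OF fD(1,2) p(1)] by blast
  have q: "poly q r = x" if "r \<in> \<Gamma>" for r
  proof -
    have "poly p r = x" using inv[OF that] p that by (simp add: \<tau>_poly)
    then show ?thesis using sq(3) that by (simp add: \<Gamma>_def)
  qed
  have "q = [:x:]"
  proof (rule ccontr)
    assume "q \<noteq> [:x:]"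
    then have "q - [:x:] \<noteq> 0" by simp
    have "degree f = card \<Gamma>" unfolding \<Gamma>_def using Rats.minpoly_card_roots[OF minpoly] by simp
    also have "\<dots> \<le> card {r. poly (q - [:x:]) r = 0}"
      using \<open>q - [:x:] \<noteq> 0\<close> q by (intro card_mono poly_roots_finite) auto
    also have "\<dots> \<le> degree (q - [:x:])"
      using \<open>q - [:x:] \<noteq> 0\<close> by (rule card_poly_roots_bound)
    also have "\<dots> \<le> max (degree q) (degree [:x:])" by (rule degree_diff_le_max)
    also have "\<dots> = degree q" by simp
    also have "\<dots> < degree f" using sq(4) fD(5) by auto
    finally show False by simp
  qed
  then show ?thesis using sq(2) by simp
qed

text \<open>
  The norm of a nonzero algebraic integer is a nonzero rational integer.
\<close>

lemma norm_ge_1: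
  assumes x: "x \<in> M" "algebraic_int x" "x \<noteq> 0"
  shows "(\<Prod>r\<in>\<Gamma>. cmod (\<tau> r x)) \<ge> 1"
proof -
  define N where "N = (\<Prod>r\<in>\<Gamma>. \<tau> r x)"
  have "N \<in> M" unfolding N_def using x \<tau>_M by auto
  have "N \<in> \<rat>"
  proof (rule fixed_rational[OF \<open>N \<in> M\<close>])
    fix s assume s: "s \<in> \<Gamma>"
    interpret complex_hom M "\<tau> s" using \<tau>_hom[OF s] .
    have "\<tau> s N = (\<Prod>r\<in>\<Gamma>. \<tau> (\<tau> s r) x)"
      unfolding N_def using s x \<tau>_M by (subst hom_prod) (auto intro!: prod.cong simp: \<tau>_comp)
    also have "\<dots> = N" unfolding N_def by (rule prod.reindex_bij_betw[OF \<tau>_bij[OF s]])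
    finally show "\<tau> s N = N" .
  qed
  moreover have "algebraic_int N"
    using Alg_ints.prod_mem[of \<Gamma> "\<lambda>r. \<tau> r x"] complex_hom.hom_algebraic_int[OF \<tau>_hom x(1,2) Rats_M]
    unfolding N_def by simp
  ultimately have "N \<in> \<int>" by (rule rational_algebraic_int_is_int[rotated])
  then obtain k :: int where k: "N = of_int k" by (elim Ints_cases)
  have "N \<noteq> 0"
    unfolding N_def using finite_\<Gamma> complex_hom.hom_nonzero[OF \<tau>_hom M.complex_subfield_axioms x(1,3)] by simp
  then have "cmod N \<ge> 1" by (simp add: k)
  then show ?thesis unfolding N_def by (simp add: prod_norm)
qed

text \<open>
  The automorphisms permute the factors, so the coefficients are fixed. Consequently the orbit of
  \<open>x\<close> contains every conjugate of \<open>x\<close> (\<open>conjugate_in_orbit\<close>).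
\<close>

lemma orbit_poly_rational:
  assumes x: "x \<in> M"
  shows "(\<Prod>r\<in>\<Gamma>. [:- \<tau> r x, 1:]) \<in> Rats.polys"
  unfolding Rats.polys_def
proof (intro CollectI allI)
  fix i
  define P where "P = (\<Prod>r\<in>\<Gamma>. [:- \<tau> r x, 1:])"
  have "P \<in> M.polys" unfolding P_def using x \<tau>_M by auto
  then have "coeff P i \<in> M" by (rule M.polys_coeff)
  then show "coeff P i \<in> \<rat>"
  proof (rule fixed_rational)
    fix s assume s: "s \<in> \<Gamma>"
    interpret complex_hom M "\<tau> s" using \<tau>_hom[OF s] .
    have "\<tau> s (coeff P i) = coeff (\<Prod>r\<in>\<Gamma>. [:- \<tau> s (\<tau> r x), 1:]) i"
      unfolding P_def using x \<tau>_M by (intro hom_coeff_prod_linear finite_\<Gamma>)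
    also have "(\<Prod>r\<in>\<Gamma>. [:- \<tau> s (\<tau> r x), 1:]) = (\<Prod>r\<in>\<Gamma>. [:- \<tau> (\<tau> s r) x, 1:])"
      using s x by (intro prod.cong) (auto simp: \<tau>_comp)
    also have "\<dots> = P"
      unfolding P_def using prod.reindex_bij_betw[OF \<tau>_bij[OF s], of "\<lambda>r. [:- \<tau> r x, 1:]"] by simp
    finally show "\<tau> s (coeff P i) = coeff P i" .
  qed
qed

lemma conjugate_in_orbit:
  assumes x: "x \<in> M" and y: "\<And>p. p \<in> Rats.polys \<Longrightarrow> poly p x = 0 \<Longrightarrow> poly p y = 0"
  shows "\<exists>s\<in>\<Gamma>. y = \<tau> s x"
proof -
  define P where "P = (\<Prod>r\<in>\<Gamma>. [:- \<tau> r x, 1:])"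
  have "\<tau> \<delta> x = x"
    using x by (elim M_cases) (simp add: \<tau>_poly[OF \<delta>_\<Gamma>])
  then have "poly P x = 0"
    unfolding P_def using finite_\<Gamma> \<delta>_\<Gamma> by (auto simp: poly_prod intro!: bexI[of _ \<delta>])
  then have "poly P y = 0"
    using y orbit_poly_rational[OF x] unfolding P_def by blast
  then show ?thesis
    unfolding P_def using finite_\<Gamma> by (auto simp: poly_prod)
qed

text \<open>
  A conjugate is \<open>\<tau> s x\<close> for some \<open>s\<close>, and right translation by \<open>s\<close> permutes the group.
\<close>

lemma prod_orbit_conjugate:
  fixes F :: "complex \<Rightarrow> real"
  assumes x: "x \<in> M" and y: "\<And>p. p \<in> Rats.polys \<Longrightarrow> poly p x = 0 \<Longrightarrow> poly p y = 0"
  shows "(\<Prod>r\<in>\<Gamma>. F (\<tau> r y)) = (\<Prod>r\<in>\<Gamma>. F (\<tau> r x))"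
proof -
  obtain s where s: "s \<in> \<Gamma>" "y = \<tau> s x" using conjugate_in_orbit[OF x y] by blast
  have "(\<Prod>r\<in>\<Gamma>. F (\<tau> r y)) = (\<Prod>r\<in>\<Gamma>. F (\<tau> (\<tau> r s) x))"
    using s x by (intro prod.cong) (auto simp: \<tau>_comp)
  also have "\<dots> = (\<Prod>r\<in>\<Gamma>. F (\<tau> r x))"
    using prod.reindex_bij_betw[OF right_mult_bij[OF s(1)], of "\<lambda>r. F (\<tau> r x)"] .
  finally show ?thesis .
qed

text \<open>
  The group acts transitively on the conjugates of \<open>x\<close>, and all fibres of \<open>r \<mapsto> \<tau> r x\<close> are
  translates of the stabiliser of \<open>x\<close>, hence of the same size \<open>c\<close>.
\<close>

lemma prod_orbit_power:
  fixes F :: "complex \<Rightarrow> real"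
  assumes x: "x \<in> M" and g: "Rats.minpoly g x"
  shows "\<exists>c. card \<Gamma> = c * degree g \<and> (\<Prod>r\<in>\<Gamma>. F (\<tau> r x)) = (\<Prod>y | poly g y = 0. F y) ^ c"
proof -
  note gD = Rats.minpolyD[OF g]
  define Y where "Y = {y. poly g y = 0}"
  have finY: "finite Y" unfolding Y_def using gD(4) by (rule poly_roots_finite)
  define c where "c = card {r\<in>\<Gamma>. \<tau> r x = x}"
  have maps: "(\<lambda>r. \<tau> r x) ` \<Gamma> \<subseteq> Y"
  proof safe
    fix r assume r: "r \<in> \<Gamma>"
    interpret complex_hom M "\<tau> r" using \<tau>_hom[OF r] .
    show "\<tau> r x \<in> Y" using hom_poly[OF Rats_M gD(1) x] gD(3) by (simp add: Y_def)
  qed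
  have fib: "card {r\<in>\<Gamma>. \<tau> r x = y} = c" if y: "y \<in> Y" for y
  proof -
    have "\<exists>s\<in>\<Gamma>. y = \<tau> s x"
    proof (rule conjugate_in_orbit[OF x])
      fix p assume "p \<in> Rats.polys" "poly p x = 0"
      then obtain q where "p = q * g" using Rats.minpoly_dvd[OF g] by blast
      then show "poly p y = 0" using y by (simp add: Y_def)
    qed
    then obtain s where s: "s \<in> \<Gamma>" "y = \<tau> s x" by blast
    have "{r\<in>\<Gamma>. \<tau> r x = y} = \<tau> s ` {r\<in>\<Gamma>. \<tau> r x = x}"
    proof safe
      fix r assume r: "r \<in> \<Gamma>" "y = \<tau> r x"
      obtain t where t: "t \<in> \<Gamma>" "r = \<tau> s t"
        using \<tau>_bij[OF s(1)] r(1) unfolding bij_betw_def by blast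
      have "\<tau> s (\<tau> t x) = \<tau> s x" using t s r x by (simp add: \<tau>_comp)
      then have "\<tau> t x = x" using \<tau>_inj[OF s(1)] x \<tau>_M[OF t(1) x] by (auto dest: inj_onD)
      then show "r \<in> \<tau> s ` {r\<in>\<Gamma>. \<tau> r x = x}" using t by auto
    next
      fix r assume r: "r \<in> \<Gamma>" "\<tau> r x = x"
      show "\<tau> s r \<in> \<Gamma>" using s r \<tau>_\<Gamma> by auto
      show "\<tau> (\<tau> s r) x = y" using s r x by (simp flip: \<tau>_comp)
    qed
    moreover have "inj_on (\<tau> s) {r\<in>\<Gamma>. \<tau> r x = x}"
      using \<tau>_inj[OF s(1)] \<Gamma>_M by (auto intro: inj_on_subset)
    ultimately show ?thesis unfolding c_def by (simp add: card_image)
  qed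
  have "card \<Gamma> = (\<Sum>y\<in>Y. card {r\<in>\<Gamma>. \<tau> r x = y})"
    using sum.group[OF finite_\<Gamma> finY maps, of "\<lambda>_. 1::nat"] by simp
  also have "\<dots> = c * degree g"
    using fib Rats.minpoly_card_roots[OF g] by (simp add: Y_def mult.commute)
  finally have 1: "card \<Gamma> = c * degree g" .
  have "(\<Prod>r\<in>\<Gamma>. F (\<tau> r x)) = (\<Prod>y\<in>Y. \<Prod>r | r \<in> \<Gamma> \<and> \<tau> r x = y. F (\<tau> r x))"
    using prod.group[OF finite_\<Gamma> finY maps, of "\<lambda>r. F (\<tau> r x)"] by simp
  also have "\<dots> = (\<Prod>y\<in>Y. \<Prod>r | r \<in> \<Gamma> \<and> \<tau> r x = y. F y)"
    by (intro prod.cong) auto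
  also have "\<dots> = (\<Prod>y\<in>Y. F y ^ c)"
    using fib by (intro prod.cong) auto
  also have "\<dots> = (\<Prod>y\<in>Y. F y) ^ c" by (simp add: prod_power_distrib)
  finally show ?thesis using 1 unfolding Y_def by blast
qed

end

text \<open>
  Adjoin all roots \<open>Z\<close> of the product of the minimal polynomials, by means of a primitive element
  \<open>\<delta> = \<Sum> c\<^sub>z z\<close>. A conjugation of \<open>\<delta>\<close> permutes \<open>Z\<close>, so it maps \<open>\<delta>\<close> to another combination of \<open>Z\<close>.
\<close>

lemma galois_closure_exists:
  assumes "finite A" "\<And>a. a \<in> A \<Longrightarrow> algebraic a"
  shows "\<exists>\<delta> f. galois_field \<delta> f \<and> A \<subseteq> Rats.adj \<delta>"
proof -
  have "\<forall>a\<in>A. \<exists>g. Rats.minpoly g a"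
    using assms(2) Rats.minpoly_exists unfolding algebraic_iff_integral by blast
  then obtain g where g: "\<And>a. a \<in> A \<Longrightarrow> Rats.minpoly (g a) a" by metis
  define P where "P = (\<Prod>a\<in>A. g a)"
  have P: "P \<in> Rats.polys" "P \<noteq> 0"
    unfolding P_def using assms(1) Rats.minpolyD[OF g] by auto
  define Z where "Z = {z. poly P z = 0}"
  have finZ: "finite Z" unfolding Z_def using P(2) by (rule poly_roots_finite)
  have AZ: "A \<subseteq> Z"
    unfolding Z_def P_def using assms(1) Rats.minpolyD(3)[OF g] by (auto simp: poly_prod)
  have intZ: "Rats.integral z" if "z \<in> Z" for z
    using Rats.integral_of_root[OF P] that unfolding Z_def by simp
  obtain c :: "complex \<Rightarrow> nat" where c: "Z \<subseteq> Rats.adj (\<Sum>z\<in>Z. of_nat (c z) * z)"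
    using Rats.primitive_element[OF finZ intZ] by blast
  define \<delta> where "\<delta> = (\<Sum>z\<in>Z. of_nat (c z) * z)"
  interpret I: complex_subring "{x. Rats.integral x}" by (rule Rats.complex_subring_integral)
  have "\<delta> \<in> {x. Rats.integral x}"
    unfolding \<delta>_def by (intro I.sum_mem I.mult_mem I.of_nat_mem) (simp add: intZ)
  then have int\<delta>: "Rats.integral \<delta>" by simp
  then obtain f where f: "Rats.minpoly f \<delta>" using Rats.minpoly_exists by blast
  interpret M: complex_subfield "Rats.adj \<delta>" using int\<delta> by (rule Rats.adj_subfield)
  have "{r. poly f r = 0} \<subseteq> Rats.adj \<delta>"
  proof safe
    fix r assume r: "poly f r = 0"
    interpret complex_hom "Rats.adj \<delta>" "conj_map \<delta> r" using conj_map_hom[OF f r] .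
    have ZM: "Z \<subseteq> Rats.adj \<delta>" using c unfolding \<delta>_def .
    have hZ: "conj_map \<delta> r z \<in> Z" if "z \<in> Z" for z
    proof -
      have "conj_map \<delta> r (poly P z) = poly P (conj_map \<delta> r z)"
        using ZM that by (intro hom_poly P M.Rats_subset) auto
      then show ?thesis using that by (simp add: Z_def)
    qed
    have "r = conj_map \<delta> r \<delta>" using conj_map_gen[OF f r] by simp
    also have "conj_map \<delta> r \<delta> = (\<Sum>z\<in>Z. of_nat (c z) * conj_map \<delta> r z)"
      unfolding \<delta>_def[of, symmetric] by (subst \<delta>_def, subst hom_sum) (use ZM in \<open>auto simp: hom_mult subset_iff intro!: sum.cong\<close>)
    also have "\<dots> \<in> Rats.adj \<delta>"
      using hZ ZM by (intro M.sum_mem M.mult_mem M.of_nat_mem) auto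
    finally show "r \<in> Rats.adj \<delta>" .
  qed
  with f have "galois_field \<delta> f" by unfold_locales
  moreover have "A \<subseteq> Rats.adj \<delta>" using AZ c unfolding \<delta>_def by blast
  ultimately show ?thesis by blast
qed

section \<open>Number fields and their embeddings\<close>

lemma subfield_Rats_CC: "subfield \<rat> CC"
  by (simp add: subfield_CC_iff Rats.complex_subfield_axioms)

text \<open>
  Multiplying by the leading coefficient \<open>c\<close> of an integral equation of degree \<open>n\<close> works: the
  equation times \<open>c\<^bsup>n-1\<^esup>\<close> is monic in \<open>c x\<close>.
\<close>

lemma algebraic_scale_integer:
  fixes x :: complex
  assumes "algebraic x"
  shows "\<exists>N::int. N > 0 \<and> algebraic_int (of_int N * x)"
proof -
  obtain p where p: "\<forall>i. coeff p i \<in> \<int>" "p \<noteq> 0" "poly p x = 0"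
    using assms unfolding algebraic_def by blast
  define n where "n = degree p"
  have npos: "n > 0"
    using p unfolding n_def by (metis degree_eq_zeroE gr0I leading_coeff_0_iff coeff_pCons_0 poly_const_conv)
  obtain c :: int where c: "lead_coeff p = of_int c" using p(1) Ints_cases by metis
  have c0: "c \<noteq> 0" using c p(2) by auto
  define q where "q = monom 1 n + (\<Sum>i<n. monom (coeff p i * of_int c ^ (n - 1 - i)) i)"
  have cq: "coeff q k = (if k = n then 1 else if k < n then coeff p k * of_int c ^ (n - 1 - k) else 0)" for k
    by (auto simp: q_def coeff_sum)
  have "q \<in> Ints.polys" using p(1) by (auto simp: Ints.polys_def cq)
  moreover have "degree q = n"
    by (intro antisym degree_le le_degree) (auto simp: cq)
  then have "lead_coeff q = 1" by (simp add: cq)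
  moreover have "poly q (of_int c * x) = 0"
  proof -
    have "poly q (of_int c * x) = (of_int c * x) ^ n + (\<Sum>i<n. coeff p i * of_int c ^ (n - 1 - i) * (of_int c * x) ^ i)"
      by (simp add: q_def poly_sum poly_monom)
    also have "(\<Sum>i<n. coeff p i * of_int c ^ (n - 1 - i) * (of_int c * x) ^ i) =
        (\<Sum>i<n. of_int c ^ (n - 1) * (coeff p i * x ^ i))"
    proof (intro sum.cong refl)
      fix i assume "i \<in> {..<n}"
      then have "(of_int c :: complex) ^ (n - 1) = of_int c ^ (n - 1 - i) * of_int c ^ i"
        by (simp flip: power_add)
      then show "coeff p i * of_int c ^ (n - 1 - i) * (of_int c * x) ^ i = of_int c ^ (n - 1) * (coeff p i * x ^ i)"
        by (simp add: power_mult_distrib)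
    qed
    also have "(of_int c * x) ^ n = of_int c ^ (n - 1) * (coeff p n * x ^ n)"
    proof -
      have "(of_int c :: complex) ^ n = of_int c ^ (n - 1) * coeff p n"
        using npos c by (cases n) (simp_all add: n_def mult.commute)
      then show ?thesis by (simp add: power_mult_distrib)
    qed
    also have "\<dots> + (\<Sum>i<n. of_int c ^ (n - 1) * (coeff p i * x ^ i)) =
        of_int c ^ (n - 1) * (\<Sum>i\<le>n. coeff p i * x ^ i)"
      by (simp add: sum_distrib_left distrib_left lessThan_Suc_atMost[symmetric] add.commute)
    also have "\<dots> = 0" using p(3) by (simp add: n_def poly_altdef)
    finally show ?thesis .
  qed
  ultimately have "algebraic_int (of_int c * x)"
    unfolding algebraic_int_iff_integral Ints.integral_def by blast
  then have "algebraic_int (of_int \<bar>c\<bar> * x)"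
    by (auto simp: abs_if)
  then show ?thesis using c0 by (intro exI[of _ "\<bar>c\<bar>"]) auto
qed

lemma number_field_primitive:
  assumes "number_field K"
  shows "\<exists>\<theta> f. Rats.minpoly f \<theta> \<and> K = Rats.adj \<theta> \<and> algebraic_int \<theta>"
proof -
  from assms interpret K: complex_subfield K
    by (simp add: number_field_def subfield_CC_iff)
  have fin: "CC.finite_dimension \<rat> K" and alg: "\<And>x. x \<in> K \<Longrightarrow> algebraic x"
    using assms by (auto simp: number_field_def Qbar_def)
  obtain n where n: "CC.dimension n \<rat> K" using fin by (rule CC.finite_dimensionE')
  obtain Us where Us: "CC.Span \<rat> Us = K"
    using CC.exists_base[OF subfield_Rats_CC n] by auto
  have UsK: "set Us \<subseteq> K"
    using CC.Span_base_incl[OF subfield_Rats_CC, of Us] Us by auto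
  obtain c :: "complex \<Rightarrow> nat" where c: "set Us \<subseteq> Rats.adj (\<Sum>z\<in>set Us. of_nat (c z) * z)"
    using Rats.primitive_element[of "set Us"] UsK alg unfolding algebraic_iff_integral by blast
  define \<eta> where "\<eta> = (\<Sum>z\<in>set Us. of_nat (c z) * z)"
  have \<eta>K: "\<eta> \<in> K" unfolding \<eta>_def using UsK by (intro K.sum_mem K.mult_mem) auto
  obtain N :: int where N: "N > 0" "algebraic_int (of_int N * \<eta>)"
    using algebraic_scale_integer[OF alg[OF \<eta>K]] by blast
  define \<theta> where "\<theta> = of_int N * \<eta>"
  have \<theta>K: "\<theta> \<in> K" unfolding \<theta>_def using \<eta>K by simp
  have int: "Rats.integral \<theta>" using alg[OF \<theta>K] by (simp add: algebraic_iff_integral)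
  interpret T: complex_subfield "Rats.adj \<theta>" using int by (rule Rats.adj_subfield)
  have "\<eta> = \<theta> / of_int N" using N by (simp add: \<theta>_def)
  then have "\<eta> \<in> Rats.adj \<theta>" using Rats.gen_in_adj by simp
  then have "Rats.adj \<eta> \<subseteq> Rats.adj \<theta>"
    by (intro Rats.adj_subset T.complex_subring_axioms T.Rats_subset)
  then have UsT: "set Us \<subseteq> Rats.adj \<theta>" using c unfolding \<eta>_def by auto
  have "CC.Span \<rat> Us \<subseteq> Rats.adj \<theta>"
  proof (rule CC.Span_min[OF subfield_Rats_CC])
    have "subring (Rats.adj \<theta>) CC" by (simp add: subring_CC_iff T.complex_subring_axioms)
    then show "subgroup (Rats.adj \<theta>) (add_monoid CC)" by (rule subring.axioms(1))
    show "\<rat> <#>\<^bsub>CC\<^esub> set Us \<subseteq> Rats.adj \<theta>"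
      using UsT T.Rats_subset by (auto simp: set_mult_def intro!: T.mult_mem)
  qed simp
  then have "K \<subseteq> Rats.adj \<theta>" by (simp only: Us)
  moreover have "Rats.adj \<theta> \<subseteq> K"
    by (rule Rats.adj_subset[OF K.complex_subring_axioms K.Rats_subset \<theta>K])
  ultimately show ?thesis
    using Rats.minpoly_exists[OF int] N(2) unfolding \<theta>_def by blast
qed

text \<open>
  The spaces \<open>E k\<close> spanned by the first \<open>k\<close> powers of \<open>\<theta>\<close> grow by one dimension at each step up
  to the degree of \<open>f\<close>, because a smaller relation would contradict minimality.
\<close>

lemma ext_degree_adj:
  assumes f: "Rats.minpoly f \<theta>"
  shows "ext_degree (Rats.adj \<theta>) = degree f"
proof -
  note fD = Rats.minpolyD[OF f]
  interpret T: complex_subfield "Rats.adj \<theta>" using integral_gen[OF f] by (rule Rats.adj_subfield)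
  define n where "n = degree f"
  define E where "E k = {\<Sum>i<k. q i * \<theta> ^ i |q. \<forall>i. q i \<in> \<rat>}" for k
  have "CC.dimension k \<rat> (E k)" if "k \<le> n" for k
    using that
  proof (induction k)
    case 0
    have "E 0 = {0}" by (auto simp: E_def intro!: exI[of _ "\<lambda>_. 0"])
    then show ?case using CC.zero_dim[of \<rat>] by simp
  next
    case (Suc k)
    have notin: "\<theta> ^ k \<notin> E k"
    proof
      assume "\<theta> ^ k \<in> E k"
      then obtain q where q: "\<And>i. q i \<in> \<rat>" "\<theta> ^ k = (\<Sum>i<k. q i * \<theta> ^ i)" by (auto simp: E_def)
      define P where "P = monom 1 k - (\<Sum>i<k. monom (q i) i)"
      have cP: "coeff P j = (if j = k then 1 else if j < k then - q j else 0)" for j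
        by (auto simp: P_def coeff_sum)
      have "P \<in> Rats.polys" using q(1) by (auto simp: Rats.polys_def cP)
      moreover have "P \<noteq> 0" using cP[of k] by auto
      moreover have "poly P \<theta> = 0" using q(2) by (simp add: P_def poly_sum poly_monom)
      ultimately have "n \<le> degree P" unfolding n_def by (rule fD(6))
      also have "degree P \<le> k" by (rule degree_le) (simp add: cP)
      finally show False using Suc.prems by simp
    qed
    have "CC.line_extension \<rat> (\<theta> ^ k) (E k) = E (Suc k)"
    proof safe
      fix u assume "u \<in> CC.line_extension \<rat> (\<theta> ^ k) (E k)"
      then obtain a q where "a \<in> \<rat>" "\<forall>i. q i \<in> \<rat>" "u = a * \<theta> ^ k + (\<Sum>i<k. q i * \<theta> ^ i)"
        by (auto simp: CC.line_extension_mem_iff E_def)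
      moreover have "(\<Sum>i<k. (q(k := a)) i * \<theta> ^ i) = (\<Sum>i<k. q i * \<theta> ^ i)"
        by (intro sum.cong) auto
      ultimately show "u \<in> E (Suc k)"
        unfolding E_def by (intro CollectI exI[of _ "q(k := a)"]) auto
    next
      fix u assume "u \<in> E (Suc k)"
      then obtain q where q: "\<forall>i. q i \<in> \<rat>" "u = q k * \<theta> ^ k + (\<Sum>i<k. q i * \<theta> ^ i)"
        by (auto simp: E_def add.commute)
      moreover have "(\<Sum>i<k. q i * \<theta> ^ i) \<in> E k" using q(1) unfolding E_def by blast
      ultimately show "u \<in> CC.line_extension \<rat> (\<theta> ^ k) (E k)"
        unfolding CC.line_extension_mem_iff CC_simps by blast
    qed
    moreover have "CC.dimension (Suc k) \<rat> (CC.line_extension \<rat> (\<theta> ^ k) (E k))"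
      by (rule CC.Suc_dim[OF _ notin Suc.IH]) (use Suc.prems in auto)
    ultimately show ?case by (simp only:)
  qed
  then have "CC.dimension n \<rat> (E n)" by simp
  moreover have "E n = Rats.adj \<theta>"
  proof safe
    fix x assume "x \<in> E n"
    then obtain q where q: "\<forall>i. q i \<in> \<rat>" "x = (\<Sum>i<n. q i * \<theta> ^ i)" by (auto simp: E_def)
    have "q i * \<theta> ^ i \<in> Rats.adj \<theta>" for i
      using q(1) T.Rats_subset by (intro T.mult_mem T.power_mem Rats.gen_in_adj) blast
    then show "x \<in> Rats.adj \<theta>" unfolding q(2) by (intro T.sum_mem)
  next
    fix x assume "x \<in> Rats.adj \<theta>"
    then obtain p where p: "p \<in> Rats.polys" "x = poly p \<theta>" by (auto simp: Rats.adj_def)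
    obtain s q where sq: "s \<in> Rats.polys" "q \<in> Rats.polys" "p = s * f + q" "q = 0 \<or> degree q < degree f"
      using Rats.polys_divide_monic[OF fD(1,2) p(1)] by blast
    have "x = poly q \<theta>" using p(2) fD(3) by (simp add: sq(3))
    also have "\<dots> = (\<Sum>i\<le>degree q. coeff q i * \<theta> ^ i)" by (rule poly_altdef)
    also have "\<dots> = (\<Sum>i<n. coeff q i * \<theta> ^ i)"
      using sq(4) fD(5) by (intro sum.mono_neutral_left) (auto simp: n_def intro: coeff_eq_0)
    finally show "x \<in> E n" using Rats.polys_coeff[OF sq(2)] unfolding E_def by blast
  qed
  ultimately show ?thesis
    using CC.dimI[OF subfield_Rats_CC] unfolding ext_degree_def n_def over_def by simp
qed

lemma field_embeddings_iff:
  assumes "complex_subring K"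
  shows "\<sigma> \<in> field_embeddings K \<longleftrightarrow> complex_hom K \<sigma> \<and> \<sigma> \<in> extensional K"
proof -
  interpret complex_subring K by fact
  show ?thesis
    by (auto simp: field_embeddings_def Ring.ring_hom_def complex_hom_def complex_hom_axioms_def
        complex_subring_axioms)
qed

lemma complex_hom_cong:
  assumes "complex_hom K \<sigma>" "\<And>x. x \<in> K \<Longrightarrow> \<sigma>' x = \<sigma> x"
  shows "complex_hom K \<sigma>'"
proof -
  interpret complex_hom K \<sigma> by fact
  show ?thesis by unfold_locales (simp_all add: assms(2) hom_add hom_mult)
qed

text \<open>
  An embedding is determined by the image of \<open>\<theta>\<close>, which may be any conjugate of \<open>\<theta>\<close>.
\<close>

lemma field_embeddings_adj:
  assumes f: "Rats.minpoly f \<theta>"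
  shows "bij_betw (\<lambda>\<sigma>. \<sigma> \<theta>) (field_embeddings (Rats.adj \<theta>)) {r. poly f r = 0}"
proof -
  note fD = Rats.minpolyD[OF f]
  interpret K: complex_subfield "Rats.adj \<theta>" using integral_gen[OF f] by (rule Rats.adj_subfield)
  have ev: "\<sigma> (poly p \<theta>) = poly p (\<sigma> \<theta>)"
    if "\<sigma> \<in> field_embeddings (Rats.adj \<theta>)" "p \<in> Rats.polys" for \<sigma> p
  proof -
    interpret complex_hom "Rats.adj \<theta>" \<sigma>
      using that field_embeddings_iff[OF K.complex_subring_axioms] by blast
    show ?thesis using that by (intro hom_poly K.Rats_subset Rats.gen_in_adj)
  qed
  show ?thesis
    unfolding bij_betw_def
  proof (intro conjI inj_onI)
    fix \<sigma> \<sigma>' assume s: "\<sigma> \<in> field_embeddings (Rats.adj \<theta>)" "\<sigma>' \<in> field_embeddings (Rats.adj \<theta>)" "\<sigma> \<theta> = \<sigma>' \<theta>"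
    show "\<sigma> = \<sigma>'"
    proof (rule extensionalityI[of _ "Rats.adj \<theta>"])
      show "\<sigma> \<in> extensional (Rats.adj \<theta>)" "\<sigma>' \<in> extensional (Rats.adj \<theta>)"
        using s by (auto simp: field_embeddings_def)
      fix x assume "x \<in> Rats.adj \<theta>"
      then obtain p where "p \<in> Rats.polys" "x = poly p \<theta>" by (auto simp: Rats.adj_def)
      then show "\<sigma> x = \<sigma>' x" using ev[OF s(1)] ev[OF s(2)] s(3) by simp
    qed
  next
    show "(\<lambda>\<sigma>. \<sigma> \<theta>) ` field_embeddings (Rats.adj \<theta>) = {r. poly f r = 0}"
    proof safe
      fix \<sigma> assume s: "\<sigma> \<in> field_embeddings (Rats.adj \<theta>)"
      then have "complex_hom (Rats.adj \<theta>) \<sigma>"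
        using field_embeddings_iff[OF K.complex_subring_axioms] by blast
      then show "poly f (\<sigma> \<theta>) = 0"
        using ev[OF s fD(1)] fD(3) complex_hom.hom_zero by metis
    next
      fix r assume r: "poly f r = 0"
      have "restrict (conj_map \<theta> r) (Rats.adj \<theta>) \<in> field_embeddings (Rats.adj \<theta>)"
        unfolding field_embeddings_iff[OF K.complex_subring_axioms]
        using complex_hom_cong[OF conj_map_hom[OF f r]] by auto
      moreover have "restrict (conj_map \<theta> r) (Rats.adj \<theta>) \<theta> = r"
        using Rats.gen_in_adj conj_map_gen[OF f r] by simp
      ultimately show "r \<in> (\<lambda>\<sigma>. \<sigma> \<theta>) ` field_embeddings (Rats.adj \<theta>)" by (metis imageI)
    qed
  qed
qed

lemma card_field_embeddings:
  assumes f: "Rats.minpoly f \<theta>"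
  shows "card (field_embeddings (Rats.adj \<theta>)) = degree f" "finite (field_embeddings (Rats.adj \<theta>))"
  using bij_betw_same_card[OF field_embeddings_adj[OF f]] bij_betw_finite[OF field_embeddings_adj[OF f]]
    Rats.minpoly_card_roots[OF f] poly_roots_finite[OF Rats.minpolyD(4)[OF f]] by auto

text \<open>
  A vector in the kernel is the coefficient vector of a polynomial of degree less than \<open>n\<close> with
  \<open>n\<close> distinct roots.
\<close>

lemma det_vandermonde_nonzero:
  fixes a :: "nat \<Rightarrow> complex"
  assumes inj: "inj_on a {..<n}"
  shows "Determinant.det (mat n n (\<lambda>(i, j). a i ^ j)) \<noteq> 0"
proof
  let ?V = "mat n n (\<lambda>(i, j). a i ^ j)"
  assume "Determinant.det ?V = 0"
  then obtain v where v: "v \<in> carrier_vec n" "v \<noteq> 0\<^sub>v n" "?V *\<^sub>v v = 0\<^sub>v n"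
    using det_0_iff_vec_prod_zero_field[of ?V n] by auto
  define P where "P = (\<Sum>j<n. monom (v $ j) j)"
  have cP: "coeff P k = (if k < n then v $ k else 0)" for k
    by (auto simp: P_def coeff_sum)
  have root: "poly P (a i) = 0" if "i < n" for i
  proof -
    have "poly P (a i) = (\<Sum>j<n. a i ^ j * v $ j)"
      by (simp add: P_def poly_sum poly_monom mult.commute)
    also have "\<dots> = (?V *\<^sub>v v) $ i"
      using that v(1) by (simp add: scalar_prod_def atLeast0LessThan)
    finally show ?thesis using v(3) that by simp
  qed
  have "P = 0"
  proof (rule ccontr)
    assume P: "P \<noteq> 0"
    have n: "n > 0" using v by (metis gr0I carrier_vecD eq_vecI index_zero_vec(2) less_nat_zero_code)
    have "n = card (a ` {..<n})" using inj by (simp add: card_image)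
    also have "\<dots> \<le> card {x. poly P x = 0}"
      using root P by (intro card_mono poly_roots_finite) auto
    also have "\<dots> \<le> degree P" using P by (rule card_poly_roots_bound)
    also have "\<dots> < n" using n by (intro degree_lessI) (auto simp: cP)
    finally show False by simp
  qed
  then have "v $ k = 0" if "k < n" for k using cP[of k] that by simp
  then have "v = 0\<^sub>v n" using v(1) by (intro eq_vecI) auto
  then show False using v(2) by simp
qed

section \<open>Integral bases\<close>

lemma of_real_of_rat_complex: "complex_of_real (of_rat t) = of_rat t"
proof -
  obtain a b where "quotient_of t = (a, b)" by fastforce
  then have "t = of_int a / of_int b" by (rule quotient_of_div)
  then show ?thesis by (simp add: of_rat_divide)
qed

lemma cmod_of_rat: "cmod (of_rat t) = \<bar>of_rat t\<bar>"
  by (metis norm_of_real of_real_of_rat_complex)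

locale embedded_number_field =
  fixes K \<theta> f \<sigma>s n
  assumes minpoly: "Rats.minpoly f \<theta>"
    and K_def: "K = Rats.adj \<theta>"
    and gen_integer: "algebraic_int \<theta>"
    and distinct_\<sigma>s: "distinct \<sigma>s"
    and set_\<sigma>s: "set \<sigma>s = field_embeddings K"
    and n_def: "n = length \<sigma>s"
begin

sublocale K: complex_subfield K
  unfolding K_def using Rats.adj_subfield[OF integral_gen[OF minpoly]] .

lemma \<sigma>_hom: "i < n \<Longrightarrow> complex_hom K (\<sigma>s ! i)"
  using set_\<sigma>s nth_mem field_embeddings_iff[OF K.complex_subring_axioms] unfolding n_def by blast

lemma \<sigma>_extensional: "i < n \<Longrightarrow> \<sigma>s ! i \<in> extensional K"
  using set_\<sigma>s nth_mem field_embeddings_iff[OF K.complex_subring_axioms] unfolding n_def by blast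

lemma embedding_cases:
  assumes "complex_hom K \<sigma>"
  shows "\<exists>i<n. \<forall>x\<in>K. \<sigma> x = (\<sigma>s ! i) x"
proof -
  have "restrict \<sigma> K \<in> set \<sigma>s"
    unfolding set_\<sigma>s field_embeddings_iff[OF K.complex_subring_axioms]
    using complex_hom_cong[OF assms] by auto
  then obtain i where "i < n" "\<sigma>s ! i = restrict \<sigma> K" by (auto simp: in_set_conv_nth n_def)
  then show ?thesis by auto
qed

lemma \<sigma>_eq_imp: "i < n \<Longrightarrow> j < n \<Longrightarrow> (\<And>x. x \<in> K \<Longrightarrow> (\<sigma>s ! i) x = (\<sigma>s ! j) x) \<Longrightarrow> i = j"
  using extensionalityI[OF \<sigma>_extensional \<sigma>_extensional] distinct_\<sigma>s
  by (metis n_def nth_eq_iff_index_eq)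

text \<open>
  The determinant \<open>det (\<sigma>\<^sub>i c\<^sub>j)\<close>, whose square is the discriminant of the system \<open>c\<close>.
\<close>

definition D :: "(nat \<Rightarrow> complex) \<Rightarrow> complex" where
  "D c = Determinant.det (mat n n (\<lambda>(i, j). (\<sigma>s ! i) (c j)))"

lemma \<sigma>_mem:
  assumes "galois_field \<delta> g" "K \<subseteq> Rats.adj \<delta>" "i < n" "x \<in> K"
  shows "(\<sigma>s ! i) x \<in> Rats.adj \<delta>"
proof -
  interpret G: galois_field \<delta> g by fact
  interpret S: complex_hom K "\<sigma>s ! i" using \<sigma>_hom assms(3) .
  have "x \<in> G.M" using assms by (auto simp: G.M_def)
  moreover have "poly p ((\<sigma>s ! i) x) = 0" if "p \<in> Rats.polys" "poly p x = 0" for p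
    using S.hom_poly[OF K.Rats_subset that(1) assms(4)] that(2) by simp
  ultimately obtain s where "s \<in> G.\<Gamma>" "(\<sigma>s ! i) x = G.\<tau> s x"
    using G.conjugate_in_orbit by blast
  then show ?thesis using G.\<tau>_M \<open>x \<in> G.M\<close> unfolding G.M_def by simp
qed

text \<open>
  Composing with an automorphism permutes the embeddings.
\<close>

lemma galois_permutes:
  assumes "galois_field \<delta> g" "K \<subseteq> Rats.adj \<delta>" "r \<in> galois_field.\<Gamma> g"
  shows "\<exists>p. p permutes {0..<n} \<and>
    (\<forall>i<n. \<forall>x\<in>K. galois_field.\<tau> \<delta> r ((\<sigma>s ! i) x) = (\<sigma>s ! p i) x)"
proof -
  interpret G: galois_field \<delta> g by fact
  interpret T: complex_hom G.M "G.\<tau> r" using G.\<tau>_hom assms(3) .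
  have mem: "(\<sigma>s ! i) x \<in> G.M" if "i < n" "x \<in> K" for i x
    using \<sigma>_mem[OF assms(1,2) that] by (simp add: G.M_def)
  have "\<exists>k<n. \<forall>x\<in>K. G.\<tau> r ((\<sigma>s ! i) x) = (\<sigma>s ! k) x" if "i < n" for i
  proof -
    interpret S: complex_hom K "\<sigma>s ! i" using \<sigma>_hom that .
    have "complex_hom K (\<lambda>x. G.\<tau> r ((\<sigma>s ! i) x))"
      by unfold_locales (simp_all add: mem[OF that] S.hom_add S.hom_mult T.hom_add T.hom_mult)
    then show ?thesis by (rule embedding_cases)
  qed
  then obtain q where q: "\<And>i. i < n \<Longrightarrow> q i < n"
    "\<And>i x. i < n \<Longrightarrow> x \<in> K \<Longrightarrow> G.\<tau> r ((\<sigma>s ! i) x) = (\<sigma>s ! q i) x" by metis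
  define p where "p i = (if i < n then q i else i)" for i
  have "inj_on p {0..<n}"
  proof (rule inj_onI)
    fix i j assume ij: "i \<in> {0..<n}" "j \<in> {0..<n}" "p i = p j"
    show "i = j"
    proof (rule \<sigma>_eq_imp)
      fix x assume x: "x \<in> K"
      have "G.\<tau> r ((\<sigma>s ! i) x) = G.\<tau> r ((\<sigma>s ! j) x)"
        using ij q x by (simp add: p_def)
      then show "(\<sigma>s ! i) x = (\<sigma>s ! j) x"
        using G.\<tau>_inj[OF assms(3)] mem[OF _ x] ij by (auto dest: inj_onD)
    qed (use ij in auto)
  qed
  moreover have "p ` {0..<n} \<subseteq> {0..<n}" using q by (auto simp: p_def)
  ultimately have "bij_betw p {0..<n} {0..<n}"
    unfolding bij_betw_def using endo_inj_surj[of "{0..<n}" p] by auto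
  then have "p permutes {0..<n}" by (rule bij_imp_permutes) (auto simp: p_def)
  then show ?thesis using q by (intro exI[of _ p]) (auto simp: p_def)
qed

text \<open>
  The automorphism permutes the rows. The sign is the same for all systems \<open>c\<close>, so quotients of two
  such determinants are fixed and hence rational (\<open>D_ratio_rational\<close>).
\<close>

lemma galois_D:
  assumes "galois_field \<delta> g" "K \<subseteq> Rats.adj \<delta>" "r \<in> galois_field.\<Gamma> g"
  shows "\<exists>s::int. \<bar>s\<bar> = 1 \<and> (\<forall>c. (\<forall>j<n. c j \<in> K) \<longrightarrow> galois_field.\<tau> \<delta> r (D c) = of_int s * D c)"
proof -
  interpret G: galois_field \<delta> g by fact
  interpret T: complex_hom G.M "G.\<tau> r" using G.\<tau>_hom assms(3) .
  obtain p where p: "p permutes {0..<n}"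
    "\<And>i x. i < n \<Longrightarrow> x \<in> K \<Longrightarrow> G.\<tau> r ((\<sigma>s ! i) x) = (\<sigma>s ! p i) x"
    using galois_permutes[OF assms] by blast
  have "G.\<tau> r (D c) = signof p * D c" if c: "\<forall>j<n. c j \<in> K" for c
  proof -
    let ?A = "mat n n (\<lambda>(i, j). (\<sigma>s ! i) (c j))"
    have "G.\<tau> r (D c) = Determinant.det (map_mat (G.\<tau> r) ?A)"
      unfolding D_def using \<sigma>_mem[OF assms(1,2)] c by (intro T.hom_det[of _ n]) (auto simp: G.M_def)
    also have "map_mat (G.\<tau> r) ?A = mat n n (\<lambda>(i, j). ?A $$ (p i, j))"
      using p(2) c permutes_in_image[OF p(1)] by (intro eq_matI) auto
    also have "Determinant.det \<dots> = signof p * Determinant.det ?A"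
      by (rule det_permute_rows[OF _ p(1)]) auto
    finally show ?thesis by (simp add: D_def)
  qed
  then show ?thesis by (intro exI[of _ "sign p"]) (auto simp: sign_def)
qed

lemma galois_exists: "\<exists>\<delta> g. galois_field \<delta> g \<and> K \<subseteq> Rats.adj \<delta>"
proof -
  have "algebraic \<theta>" using integral_gen[OF minpoly] by (simp add: algebraic_iff_integral)
  then obtain \<delta> g where dg: "galois_field \<delta> g" "{\<theta>} \<subseteq> Rats.adj \<delta>"
    using galois_closure_exists[of "{\<theta>}"] by blast
  interpret G: galois_field \<delta> g by fact
  have "K \<subseteq> Rats.adj \<delta>"
    unfolding K_def using dg(2) Rats.adj_subset[OF G.M.complex_subring_axioms G.Rats_M]
    by (simp add: G.M_def)
  then show ?thesis using dg by blast
qed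

lemma D_mem:
  assumes "galois_field \<delta> g" "K \<subseteq> Rats.adj \<delta>" "\<And>j. j < n \<Longrightarrow> c j \<in> K"
  shows "D c \<in> Rats.adj \<delta>"
proof -
  interpret G: galois_field \<delta> g by fact
  show ?thesis
    unfolding D_def using \<sigma>_mem[OF assms(1,2)] assms(3)
    by (intro G.M.det_mem[of _ n, unfolded G.M_def]) auto
qed

lemma D_ratio_rational:
  assumes c: "\<And>j. j < n \<Longrightarrow> c j \<in> K" and c': "\<And>j. j < n \<Longrightarrow> c' j \<in> K"
  shows "D c' / D c \<in> \<rat>" "D c ^ 2 \<in> \<rat>"
proof -
  obtain \<delta> g where dg: "galois_field \<delta> g" "K \<subseteq> Rats.adj \<delta>" using galois_exists by blast
  interpret G: galois_field \<delta> g by fact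
  have mem: "D c \<in> G.M" "D c' \<in> G.M" using D_mem[OF dg] c c' by (auto simp: G.M_def)
  have *: "G.\<tau> r (D c' / D c) = D c' / D c \<and> G.\<tau> r (D c ^ 2) = D c ^ 2" if r: "r \<in> G.\<Gamma>" for r
  proof -
    interpret T: complex_hom G.M "G.\<tau> r" using G.\<tau>_hom r .
    obtain s :: int where s: "\<bar>s\<bar> = 1" "G.\<tau> r (D c) = of_int s * D c" "G.\<tau> r (D c') = of_int s * D c'"
      using galois_D[OF dg r] c c' by blast
    have s2: "s = 1 \<or> s = -1" using s(1) by auto
    have "G.\<tau> r (D c' / D c) = D c' / D c"
    proof (cases "D c = 0")
      case False
      have "G.\<tau> r (D c' / D c) * G.\<tau> r (D c) = G.\<tau> r (D c')"
        using False mem T.hom_mult[of "D c' / D c" "D c"] by simp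
      then show ?thesis using s s2 False by (auto simp: field_simps)
    qed simp
    moreover have "G.\<tau> r (D c ^ 2) = D c ^ 2"
      using mem s s2 by (auto simp: T.hom_power)
    ultimately show ?thesis ..
  qed
  show "D c' / D c \<in> \<rat>" "D c ^ 2 \<in> \<rat>"
    using * mem by (auto intro!: G.fixed_rational)
qed

lemma D_algebraic_int:
  assumes "\<And>j. j < n \<Longrightarrow> c j \<in> ring_of_integers K"
  shows "algebraic_int (D c)"
proof -
  have "algebraic_int ((\<sigma>s ! i) (c j))" if "i < n" "j < n" for i j
    using complex_hom.hom_algebraic_int[OF \<sigma>_hom[OF that(1)]] assms[OF that(2)] K.Rats_subset
    by (simp add: ring_of_integers_def)
  then show ?thesis
    unfolding D_def using Alg_ints.det_mem[of _ n] by simp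
qed

lemma embedding_matrix_mult:
  assumes c: "\<And>k. k < n \<Longrightarrow> c k \<in> K" and q: "\<And>k. k < n \<Longrightarrow> q k \<in> \<rat>"
  shows "mat n n (\<lambda>(i, j). (\<sigma>s ! i) (c j)) *\<^sub>v vec n q = vec n (\<lambda>i. (\<sigma>s ! i) (\<Sum>k<n. q k * c k))"
proof (rule eq_vecI)
  fix i assume "i < dim_vec (vec n (\<lambda>i. (\<sigma>s ! i) (\<Sum>k<n. q k * c k)))"
  then have i: "i < n" by simp
  interpret S: complex_hom K "\<sigma>s ! i" using \<sigma>_hom i .
  have "(\<sigma>s ! i) (\<Sum>k<n. q k * c k) = (\<Sum>k<n. q k * (\<sigma>s ! i) (c k))"
    using c q K.Rats_subset by (subst S.hom_sum) (auto simp: S.hom_mult S.hom_rat subset_iff)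
  then show "(mat n n (\<lambda>(i, j). (\<sigma>s ! i) (c j)) *\<^sub>v vec n q) $ i = vec n (\<lambda>i. (\<sigma>s ! i) (\<Sum>k<n. q k * c k)) $ i"
    using i by (simp add: scalar_prod_def atLeast0LessThan mult.commute)
qed simp

text \<open>
  Cramer's rule for the linear system \<open>\<sigma>\<^sub>i y = \<Sum>\<^sub>k q\<^sub>k \<sigma>\<^sub>i c\<^sub>k\<close>.
\<close>

lemma D_replace:
  assumes c: "\<And>k. k < n \<Longrightarrow> c k \<in> K" and q: "\<And>k. k < n \<Longrightarrow> q k \<in> \<rat>"
    and y: "y = (\<Sum>k<n. q k * c k)" and j: "j < n"
  shows "D (c(j := y)) = q j * D c"
proof -
  let ?A = "mat n n (\<lambda>(i, j). (\<sigma>s ! i) (c j))"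
  let ?q = "vec n q"
  have "?A *\<^sub>v ?q = vec n (\<lambda>i. (\<sigma>s ! i) y)"
    unfolding y by (rule embedding_matrix_mult[OF c q])
  then have "replace_col ?A (?A *\<^sub>v ?q) j = mat n n (\<lambda>(i, k). (\<sigma>s ! i) ((c(j := y)) k))"
    unfolding replace_col_def by (intro eq_matI) auto
  then have "D (c(j := y)) = Determinant.det (replace_col ?A (?A *\<^sub>v ?q) j)" by (simp add: D_def)
  also have "\<dots> = ?q $ j * Determinant.det ?A"
    by (rule cramer_lemma_mat) (use j in auto)
  finally show ?thesis using j by (simp add: D_def)
qed

text \<open>
  The system \<open>\<sigma>\<^sub>i y = \<Sum>\<^sub>k q\<^sub>k \<sigma>\<^sub>i c\<^sub>k\<close> has a unique complex solution. By Cramer's rule it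
  consists of quotients of determinants, so it is rational. The row of the identity embedding is the
  required expansion.
\<close>

lemma coordinates:
  assumes c: "\<And>k. k < n \<Longrightarrow> c k \<in> K" and D: "D c \<noteq> 0" and y: "y \<in> K"
  shows "\<exists>q. (\<forall>k. q k \<in> \<rat>) \<and> y = (\<Sum>k<n. q k * c k)"
proof -
  let ?A = "mat n n (\<lambda>(i, j). (\<sigma>s ! i) (c j))"
  let ?b = "vec n (\<lambda>i. (\<sigma>s ! i) y)"
  have A: "?A \<in> carrier_mat n n" by simp
  obtain B where B: "B \<in> carrier_mat n n" "?A * B = 1\<^sub>m n"
    using det_non_zero_imp_unit[OF A D[unfolded D_def]]
    unfolding Units_def ring_mat_def by auto
  define x where "x = B *\<^sub>v ?b"
  have x: "x \<in> carrier_vec n" using B by (simp add: x_def)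
  have Ax: "?A *\<^sub>v x = ?b"
    unfolding x_def using B by (subst assoc_mult_mat_vec[symmetric, OF A B(1)]) auto
  define q where "q k = (if k < n then D (c(k := y)) / D c else 0)" for k
  have xq: "x $ k = q k" if k: "k < n" for k
  proof -
    have "replace_col ?A ?b k = mat n n (\<lambda>(i, j). (\<sigma>s ! i) ((c(k := y)) j))"
      unfolding replace_col_def by (intro eq_matI) auto
    then have "D (c(k := y)) = x $ k * D c"
      using cramer_lemma_mat[OF A x k] by (simp add: Ax D_def)
    then show ?thesis using D k by (simp add: q_def)
  qed
  have qQ: "q k \<in> \<rat>" for k
  proof (cases "k < n")
    case True
    then show ?thesis
      unfolding q_def using D_ratio_rational(1)[of c "c(k := y)"] c y by auto
  qed (auto simp: q_def)
  obtain i where i: "i < n" "\<forall>x\<in>K. x = (\<sigma>s ! i) x"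
    using embedding_cases[of "\<lambda>x. x"] by (auto simp: complex_hom_def complex_hom_axioms_def K.complex_subring_axioms)
  have "y = (?A *\<^sub>v x) $ i" using i y by (simp add: Ax)
  also have "\<dots> = (\<Sum>k<n. (\<sigma>s ! i) (c k) * x $ k)"
    using i(1) x by (simp add: scalar_prod_def atLeast0LessThan)
  also have "\<dots> = (\<Sum>k<n. q k * c k)"
    using i(2) c xq by (intro sum.cong) (auto simp: mult.commute)
  finally show ?thesis using qQ by blast
qed

lemma int_module: "Modules.module (\<lambda>(k::int) x::complex. of_int k * x)"
  by unfold_locales (auto simp: algebra_simps)

lemma independent_system_exists: "\<exists>c. (\<forall>j. c j \<in> ring_of_integers K) \<and> D c \<noteq> 0"
proof -
  have "(\<sigma>s ! i) (\<theta> ^ j) = (\<sigma>s ! i) \<theta> ^ j" if "i < n" for i j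
    using complex_hom.hom_power[OF \<sigma>_hom[OF that]] Rats.gen_in_adj by (simp add: K_def)
  then have "D (\<lambda>j. \<theta> ^ j) = Determinant.det (mat n n (\<lambda>(i, j). (\<sigma>s ! i) \<theta> ^ j))"
    unfolding D_def by (intro arg_cong[of _ _ Determinant.det] eq_matI) auto
  also have "inj_on (\<lambda>i. (\<sigma>s ! i) \<theta>) {..<n}"
  proof (rule inj_onI)
    fix i k assume ik: "i \<in> {..<n}" "k \<in> {..<n}" "(\<sigma>s ! i) \<theta> = (\<sigma>s ! k) \<theta>"
    then have "\<sigma>s ! i \<in> field_embeddings K" "\<sigma>s ! k \<in> field_embeddings K"
      using set_\<sigma>s nth_mem unfolding n_def by auto
    then have "\<sigma>s ! i = \<sigma>s ! k"
      using inj_onD[OF bij_betw_imp_inj_on[OF field_embeddings_adj[OF minpoly], folded K_def]] ik(3)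
      by blast
    then show "i = k" using ik distinct_\<sigma>s by (simp add: n_def nth_eq_iff_index_eq)
  qed
  then have "Determinant.det (mat n n (\<lambda>(i, j). (\<sigma>s ! i) \<theta> ^ j)) \<noteq> 0"
    by (rule det_vandermonde_nonzero)
  finally have "D (\<lambda>j. \<theta> ^ j) \<noteq> 0" .
  moreover have "\<theta> ^ j \<in> ring_of_integers K" for j
    using gen_integer Alg_ints.power_mem[of \<theta>] Rats.gen_in_adj K.power_mem
    by (simp add: ring_of_integers_def K_def)
  ultimately show ?thesis by blast
qed

text \<open>
  A system of integers with nonzero determinant for which \<open>\<bar>D c\<bar>\<^sup>2\<close>, a positive integer, is minimal
  is an integral basis: if an integer \<open>y\<close> had a non-integral coordinate at \<open>c\<^sub>j\<close>, then replacing
  \<open>c\<^sub>j\<close> by \<open>y\<close> minus the integral part would multiply \<open>D c\<close> by the fractional part of the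
  coordinate.
\<close>

lemma integral_basis_exists: "\<exists>bs. integral_basis K bs \<and> length bs = n"
proof -
  define P where "P = (\<lambda>c. (\<forall>j. c j \<in> ring_of_integers K) \<and> D c \<noteq> 0)"
  obtain c where c: "P c" and
    min: "\<And>c'. P c' \<Longrightarrow> nat \<lfloor>cmod (D c ^ 2)\<rfloor> \<le> nat \<lfloor>cmod (D c' ^ 2)\<rfloor>"
    using ex_has_least_nat[of P _ "\<lambda>c. nat \<lfloor>cmod (D c ^ 2)\<rfloor>"] independent_system_exists
    unfolding P_def by blast
  have cO: "c j \<in> ring_of_integers K" for j using c by (simp add: P_def)
  have cK: "c j \<in> K" for j using cO by (simp add: ring_of_integers_def)
  have D0: "D c \<noteq> 0" using c by (simp add: P_def)
  have intD: "\<exists>k::int. D c' ^ 2 = of_int k" if "P c'" for c'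
  proof -
    have "algebraic_int (D c' ^ 2)"
      using D_algebraic_int[of c'] that Alg_ints.power_mem[of "D c'" 2] by (simp add: P_def)
    moreover have "D c' ^ 2 \<in> \<rat>"
      using D_ratio_rational(2)[of c' c] that cK by (auto simp: P_def ring_of_integers_def)
    ultimately show ?thesis using rational_algebraic_int_is_int Ints_cases by metis
  qed
  have coords_int: "q j \<in> \<int>"
    if q: "\<And>k. q k \<in> \<rat>" and y: "(\<Sum>k<n. q k * c k) \<in> ring_of_integers K" and j: "j < n" for q j
  proof (rule ccontr)
    assume nonint: "q j \<notin> \<int>"
    obtain a :: rat where a: "q j = of_rat a" using q Rats_cases by metis
    define t where "t = a - of_int \<lfloor>a\<rfloor>"
    have t: "0 \<le> t" "t < 1" by (auto simp: t_def) linarith+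
    have "t \<noteq> 0" using nonint a unfolding t_def by (metis Ints_of_int eq_iff_diff_eq_0 of_rat_of_int_eq)
    define y' where "y' = (\<Sum>k<n. q k * c k) - of_int \<lfloor>a\<rfloor> * c j"
    define q' where "q' = q(j := of_rat t)"
    have "y' = (\<Sum>k<n. q' k * c k)"
    proof -
      have "(\<Sum>k<n. q' k * c k) = (\<Sum>k<n. q k * c k - (if k = j then of_int \<lfloor>a\<rfloor> * c j else 0))"
        by (intro sum.cong) (auto simp: q'_def t_def a of_rat_diff algebra_simps)
      also have "\<dots> = y'" using j by (simp add: sum_subtractf y'_def)
      finally show ?thesis ..
    qed
    then have D': "D (c(j := y')) = of_rat t * D c"
      using D_replace[of c q' y' j] cK q j by (auto simp: q'_def)
    have y'K: "y' \<in> ring_of_integers K"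
    proof -
      have "algebraic_int (of_int \<lfloor>a\<rfloor> * c j)"
        using Alg_ints.mult_mem[OF Alg_ints.of_int_mem, of "c j"] cO by (simp add: ring_of_integers_def)
      then have "algebraic_int y'"
        unfolding y'_def using Alg_ints.diff_mem y by (simp add: ring_of_integers_def)
      then show ?thesis
        using y cK unfolding y'_def by (simp add: ring_of_integers_def)
    qed
    have P': "P (c(j := y'))" using y'K cO D' D0 \<open>t \<noteq> 0\<close> by (auto simp: P_def)
    obtain k k' :: int where k: "D c ^ 2 = of_int k" "D (c(j := y')) ^ 2 = of_int k'"
      using intD[OF c] intD[OF P'] by blast
    have "\<bar>k\<bar> \<le> \<bar>k'\<bar>" using min[OF P'] by (simp add: k flip: of_int_abs)
    have "cmod (D (c(j := y')) ^ 2) = real_of_rat t ^ 2 * cmod (D c ^ 2)"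
    proof -
      have "cmod (of_rat t) = real_of_rat t" using t by (simp add: cmod_of_rat)
      then show ?thesis by (simp add: D' norm_mult norm_power power_mult_distrib)
    qed
    also have "\<dots> < 1 * cmod (D c ^ 2)"
    proof (rule mult_strict_right_mono)
      have "real_of_rat t < 1" using t by simp
      moreover have "0 \<le> real_of_rat t" using t by simp
      ultimately show "real_of_rat t ^ 2 < 1" by (simp add: power_less_one_iff)
      show "0 < cmod (D c ^ 2)" using D0 by simp
    qed
    finally have "real_of_int \<bar>k'\<bar> < real_of_int \<bar>k\<bar>" by (simp add: k)
    with \<open>\<bar>k\<bar> \<le> \<bar>k'\<bar>\<close> show False by linarith
  qed
  have indep: "q j = 0" if q: "\<And>k. q k \<in> \<rat>" and z: "(\<Sum>k<n. q k * c k) = 0" and j: "j < n" for q j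
  proof -
    have "D (c(j := 0)) = q j * D c" using D_replace[of c q 0 j] cK q z j by simp
    moreover have "D (c(j := 0)) = 0 * D c" using D_replace[of c "\<lambda>_. 0" 0 j] cK j by simp
    ultimately show ?thesis using D0 by simp
  qed
  have inj: "inj_on c {..<n}"
  proof (rule inj_onI, rule ccontr)
    fix j k assume jk: "j \<in> {..<n}" "k \<in> {..<n}" "c j = c k" "j \<noteq> k"
    define q where "q = (\<lambda>i. if i = j then 1 else if i = k then -1 else 0 :: complex)"
    have "(\<Sum>i<n. q i * c i) = (\<Sum>i<n. (if i = j then c j else 0) - (if i = k then c j else 0))"
      using jk by (intro sum.cong) (auto simp: q_def)
    also have "\<dots> = 0" using jk by (simp add: sum_subtractf)
    finally have "(\<Sum>i<n. q i * c i) = 0" .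
    moreover have "q i \<in> \<rat>" for i by (simp add: q_def)
    ultimately have "q j = 0" using jk(1) by (intro indep[of q j]) auto
    then show False by (simp add: q_def)
  qed
  define bs where "bs = map c [0..<n]"
  have set_bs: "set bs = c ` {..<n}" by (auto simp: bs_def)
  have reindex: "(\<Sum>v\<in>set bs. of_int (u v) * v) = (\<Sum>k<n. of_int (u (c k)) * c k)" for u :: "complex \<Rightarrow> int"
    unfolding set_bs using inj by (simp add: sum.reindex)
  interpret ZM: Modules.module "\<lambda>(k::int) x::complex. of_int k * x" by (rule int_module)
  have "integral_basis K bs"
    unfolding integral_basis_def
  proof (intro conjI)
    show "distinct bs" using inj by (auto simp: bs_def distinct_map inj_on_def)
    show "\<not> ZM.dependent (set bs)"
    proof
      assume "ZM.dependent (set bs)"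
      then obtain u :: "complex \<Rightarrow> int" where u: "(\<Sum>v\<in>set bs. of_int (u v) * v) = 0" "\<exists>v\<in>set bs. u v \<noteq> 0"
        by (subst (asm) ZM.dependent_finite) auto
      have "of_int (u (c k)) = (0 :: complex)" if "k < n" for k
        by (rule indep[of "\<lambda>k. of_int (u (c k))"]) (use u(1) that reindex[of u] in auto)
      then show False using u(2) by (auto simp: set_bs)
    qed
    show "ZM.span (set bs) = ring_of_integers K"
    proof (rule antisym)
      show "ZM.span (set bs) \<subseteq> ring_of_integers K"
      proof (rule ZM.span_minimal)
        show "set bs \<subseteq> ring_of_integers K" using cO by (auto simp: set_bs)
        show "ZM.subspace (ring_of_integers K)"
          unfolding ZM.subspace_def ring_of_integers_def
          using Alg_ints.add_mem Alg_ints.mult_mem[OF Alg_ints.of_int_mem] by auto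
      qed
      show "ring_of_integers K \<subseteq> ZM.span (set bs)"
      proof
        fix y assume y: "y \<in> ring_of_integers K"
        then obtain q where q: "\<forall>k. q k \<in> \<rat>" "y = (\<Sum>k<n. q k * c k)"
          using coordinates[of c y] cK D0 by (auto simp: ring_of_integers_def)
        have "\<forall>k. \<exists>m::int. k < n \<longrightarrow> q k = of_int m"
          using coords_int[of q] q y Ints_cases by metis
        then obtain m :: "nat \<Rightarrow> int" where m: "\<And>k. k < n \<Longrightarrow> q k = of_int (m k)" by metis
        have "y = (\<Sum>k<n. of_int (m k) * c k)" using q m by simp
        also have "\<dots> \<in> ZM.span (set bs)"
          unfolding set_bs by (intro ZM.span_sum ZM.span_scale ZM.span_base) auto
        finally show "y \<in> ZM.span (set bs)" .
      qed
    qed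
  qed
  moreover have "length bs = n" by (simp add: bs_def)
  ultimately show ?thesis by blast
qed

end

lemma embedded_number_field_exists:
  assumes "number_field K"
  shows "\<exists>\<theta> f \<sigma>s. embedded_number_field K \<theta> f \<sigma>s (ext_degree K)"
proof -
  obtain \<theta> f where tf: "Rats.minpoly f \<theta>" "K = Rats.adj \<theta>" "algebraic_int \<theta>"
    using number_field_primitive[OF assms] by blast
  obtain \<sigma>s where s: "set \<sigma>s = field_embeddings K" "distinct \<sigma>s"
    using finite_distinct_list card_field_embeddings(2)[OF tf(1)] tf(2) by blast
  have "length \<sigma>s = ext_degree K"
    using distinct_card[OF s(2)] s(1) card_field_embeddings(1)[OF tf(1)] ext_degree_adj[OF tf(1)] tf(2) by simp
  then have "embedded_number_field K \<theta> f \<sigma>s (ext_degree K)"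
    using tf s by unfold_locales auto
  then show ?thesis by blast
qed

lemma discriminant_witness:
  assumes K: "number_field K"
  shows "\<exists>bs \<theta> f \<sigma>s. integral_basis K bs \<and> length bs = ext_degree K
    \<and> embedded_number_field K \<theta> f \<sigma>s (ext_degree K)
    \<and> discriminant K = (embedded_number_field.D \<sigma>s (ext_degree K) (\<lambda>j. bs ! j)) ^ 2"
proof -
  let ?Q = "\<lambda>D. \<exists>bs \<sigma>s. integral_basis K bs
     \<and> distinct \<sigma>s \<and> set \<sigma>s = field_embeddings K \<and> length \<sigma>s = length bs
     \<and> D = (Determinant.det (mat (length bs) (length bs) (\<lambda>(i, j). (\<sigma>s ! i) (bs ! j)))) ^ 2"
  obtain \<theta> f \<sigma>s where e: "embedded_number_field K \<theta> f \<sigma>s (ext_degree K)"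
    using embedded_number_field_exists[OF K] by blast
  interpret E: embedded_number_field K \<theta> f \<sigma>s "ext_degree K" by fact
  obtain bs where bs: "integral_basis K bs" "length bs = ext_degree K"
    using E.integral_basis_exists by blast
  have "?Q ((Determinant.det (mat (length bs) (length bs) (\<lambda>(i, j). (\<sigma>s ! i) (bs ! j)))) ^ 2)"
    using bs E.distinct_\<sigma>s E.set_\<sigma>s E.n_def by metis
  then have "?Q (discriminant K)"
    unfolding discriminant_def by (rule someI[of ?Q])
  then obtain bs' \<sigma>s' where b: "integral_basis K bs'" "distinct \<sigma>s'" "set \<sigma>s' = field_embeddings K"
    "length \<sigma>s' = length bs'"
    "discriminant K = (Determinant.det (mat (length bs') (length bs') (\<lambda>(i, j). (\<sigma>s' ! i) (bs' ! j)))) ^ 2"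
    by blast
  have len: "length \<sigma>s' = ext_degree K"
    using distinct_card[OF b(2)] distinct_card[OF E.distinct_\<sigma>s] b(3) E.set_\<sigma>s E.n_def by simp
  have e': "embedded_number_field K \<theta> f \<sigma>s' (ext_degree K)"
    using E.minpoly E.K_def E.gen_integer b len by unfold_locales auto
  then show ?thesis
    using b len embedded_number_field.D_def[OF e'] by (intro exI[of _ bs'] exI[of _ \<theta>] exI[of _ f] exI[of _ \<sigma>s']) auto
qed

section \<open>Archimedean absolute values\<close>

locale absolute_value = K: complex_subfield K for K +
  fixes v :: "complex \<Rightarrow> real"
  assumes abs_val: "absolute_value_on K v"
begin

lemma nonneg: "x \<in> K \<Longrightarrow> 0 \<le> v x"
  and eq_0: "x \<in> K \<Longrightarrow> v x = 0 \<longleftrightarrow> x = 0"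
  and mult: "x \<in> K \<Longrightarrow> y \<in> K \<Longrightarrow> v (x * y) = v x * v y"
  and triangle: "x \<in> K \<Longrightarrow> y \<in> K \<Longrightarrow> v (x + y) \<le> v x + v y"
  and extensional: "v \<in> extensional K"
  using abs_val by (auto simp: absolute_value_on_def)

lemma one [simp]: "v 1 = 1"
  using mult[of 1 1] eq_0[of 1] by simp

lemma pos: "x \<in> K \<Longrightarrow> x \<noteq> 0 \<Longrightarrow> 0 < v x"
  using nonneg eq_0 by (simp add: less_le)

lemma power: "x \<in> K \<Longrightarrow> v (x ^ k) = v x ^ k"
  by (induction k) (auto simp: mult)

lemma inverse: "x \<in> K \<Longrightarrow> x \<noteq> 0 \<Longrightarrow> v (inverse x) = inverse (v x)"
  using mult[of x "inverse x"] by (simp add: inverse_unique)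

lemma divide: "x \<in> K \<Longrightarrow> y \<in> K \<Longrightarrow> y \<noteq> 0 \<Longrightarrow> v (x / y) = v x / v y"
  by (simp add: divide_inverse mult inverse)

lemma sum_le: "(\<And>i. i \<in> A \<Longrightarrow> f i \<in> K) \<Longrightarrow> v (sum f A) \<le> (\<Sum>i\<in>A. v (f i))"
proof (induction A rule: infinite_finite_induct)
  case (insert i A)
  have "v (f i + sum f A) \<le> v (f i) + v (sum f A)"
    using insert.prems by (intro triangle K.sum_mem) auto
  then show ?case using insert by simp
qed (use eq_0[of 0] in simp_all)

end

text \<open>
  Only the triangle inequality is available, so the equation is used for all powers at once: each
  \<open>\<alpha>\<^sup>k\<close> is an integral combination of the first \<open>n\<close> powers, hence the powers of \<open>v \<alpha>\<close> are bounded.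
\<close>

lemma integral_bound:
  assumes abs: "absolute_value K v" and \<alpha>: "\<alpha> \<in> K" "algebraic_int \<alpha>"
    and int: "\<And>k::int. v (of_int k) \<le> 1"
  shows "v \<alpha> \<le> 1"
proof (rule ccontr)
  interpret absolute_value K v by fact
  assume "\<not> v \<alpha> \<le> 1"
  obtain h where h: "h \<in> Ints.polys" "lead_coeff h = 1" "poly h \<alpha> = 0"
    using \<alpha>(2) unfolding algebraic_int_iff_integral Ints.integral_def by blast
  define n where "n = degree h"
  have npos: "n > 0"
    using h unfolding n_def by (metis degree_eq_zeroE gr0I coeff_pCons_0 poly_const_conv zero_neq_one)
  define C where "C = (\<Sum>i<n. v \<alpha> ^ i)"
  have "v \<alpha> ^ k \<le> C" for k
  proof -
    obtain s r where r: "r \<in> Ints.polys" "monom 1 k = s * h + r" "r = 0 \<or> degree r < degree h"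
      using Ints.polys_divide_monic[OF h(1,2), of "monom 1 k"] by auto
    have "\<alpha> ^ k = poly (monom 1 k) \<alpha>" by (simp add: poly_monom)
    also have "\<dots> = poly r \<alpha>" using h(3) by (simp add: r(2))
    also have "\<dots> = (\<Sum>i<n. coeff r i * \<alpha> ^ i)"
    proof -
      have "degree r < n" using r(3) npos by (auto simp: n_def)
      then show ?thesis
        unfolding poly_altdef by (intro sum.mono_neutral_left) (auto intro: coeff_eq_0)
    qed
    finally have eq: "\<alpha> ^ k = (\<Sum>i<n. coeff r i * \<alpha> ^ i)" .
    have cr: "coeff r i \<in> K \<and> v (coeff r i) \<le> 1" for i
      using Ints.polys_coeff[OF r(1), of i] int by (elim Ints_cases) auto
    have "v \<alpha> ^ k = v (\<Sum>i<n. coeff r i * \<alpha> ^ i)" using \<alpha>(1) eq by (simp flip: power)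
    also have "\<dots> \<le> (\<Sum>i<n. v (coeff r i * \<alpha> ^ i))"
      using cr \<alpha>(1) by (intro sum_le) auto
    also have "\<dots> \<le> C"
      unfolding C_def
    proof (rule sum_mono)
      fix i
      have "v (coeff r i * \<alpha> ^ i) = v (coeff r i) * v \<alpha> ^ i"
        using cr \<alpha>(1) by (simp add: mult power)
      also have "\<dots> \<le> 1 * v \<alpha> ^ i"
        using cr nonneg[OF \<alpha>(1)] by (intro mult_right_mono) auto
      finally show "v (coeff r i * \<alpha> ^ i) \<le> v \<alpha> ^ i" by simp
    qed
    finally show ?thesis .
  qed
  moreover obtain k where "C < v \<alpha> ^ k"
    using real_arch_pow[of "v \<alpha>" C] \<open>\<not> v \<alpha> \<le> 1\<close> by auto
  ultimately show False by (simp add: not_less[symmetric])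
qed

lemma padic_abs_of_int_le_1:
  assumes "Factorial_Ring.prime p"
  shows "padic_abs p (of_int k) \<le> 1"
proof (cases "k = 0")
  case False
  have "real p \<ge> 1" using assms prime_ge_1_nat[of p] by simp
  then have "real p powi (- int (multiplicity (int p) k)) \<le> 1"
    by (simp add: power_int_minus inverse_le_1_iff one_le_power)
  then show ?thesis using False by (simp add: padic_abs_def)
qed (simp add: padic_abs_def)

lemma power_ratio_limit:
  fixes z :: "'a :: real_normed_field"
  assumes "1 < norm z"
  shows "(\<lambda>k. z ^ k / (1 + z ^ k)) \<longlonglongrightarrow> 1"
proof -
  have z: "z \<noteq> 0" using assms by auto
  have "(\<lambda>k. inverse z ^ k) \<longlonglongrightarrow> 0"
    using assms by (intro LIMSEQ_power_zero) (simp add: norm_inverse inverse_less_1_iff)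
  then have "(\<lambda>k. 1 / (inverse z ^ k + 1)) \<longlonglongrightarrow> 1 / (0 + 1)"
    by (rule tendsto_divide[OF tendsto_const tendsto_add[OF _ tendsto_const]]) simp
  moreover have "1 / (inverse z ^ k + 1) = z ^ k / (1 + z ^ k)" for k
  proof -
    have "z ^ k * (inverse z ^ k + 1) = 1 + z ^ k"
      using z unfolding distrib_left power_mult_distrib[symmetric] by simp
    moreover have "z ^ k * 1 / (z ^ k * (inverse z ^ k + 1)) = 1 / (inverse z ^ k + 1)"
      using z by (intro mult_divide_mult_cancel_left) auto
    ultimately show ?thesis by simp
  qed
  ultimately show ?thesis by (simp only: add_0 div_by_1)
qed

context embedded_number_field
begin

text \<open>
  The coordinates are a fixed linear function of the conjugates.
\<close>

lemma coordinate_bound: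
  assumes c: "\<And>k. k < n \<Longrightarrow> c k \<in> K" and D: "D c \<noteq> 0"
  shows "\<exists>C\<ge>0. \<forall>q y B. (\<forall>k. q k \<in> \<rat>) \<longrightarrow> y = (\<Sum>k<n. q k * c k) \<longrightarrow>
    (\<forall>i<n. cmod ((\<sigma>s ! i) y) \<le> B) \<longrightarrow> (\<forall>k<n. cmod (q k) \<le> C * B)"
proof -
  let ?A = "mat n n (\<lambda>(i, j). (\<sigma>s ! i) (c j))"
  have A: "?A \<in> carrier_mat n n" by simp
  obtain B where B: "B \<in> carrier_mat n n" "B * ?A = 1\<^sub>m n"
    using det_non_zero_imp_unit[OF A D[unfolded D_def]]
    unfolding Units_def ring_mat_def by auto
  define C where "C = (\<Sum>k<n. \<Sum>i<n. cmod (B $$ (k, i)))"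
  have "cmod (q k) \<le> C * b"
    if q: "\<forall>k. q k \<in> \<rat>" and y: "y = (\<Sum>k<n. q k * c k)" and b: "\<forall>i<n. cmod ((\<sigma>s ! i) y) \<le> b"
      and k: "k < n" for q y b k
  proof -
    have b0: "0 \<le> b" using b k norm_ge_zero order_trans by blast
    have Aq: "?A *\<^sub>v vec n q = vec n (\<lambda>i. (\<sigma>s ! i) y)"
      unfolding y using q by (intro embedding_matrix_mult c) auto
    have "vec n q = (B * ?A) *\<^sub>v vec n q" using B(2) by simp
    also have "\<dots> = B *\<^sub>v vec n (\<lambda>i. (\<sigma>s ! i) y)"
      using assoc_mult_mat_vec[OF B(1) A, of "vec n q"] Aq by simp
    finally have "vec n q $ k = (B *\<^sub>v vec n (\<lambda>i. (\<sigma>s ! i) y)) $ k" by simp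
    then have "q k = (\<Sum>i<n. B $$ (k, i) * (\<sigma>s ! i) y)"
      using k B(1) by (simp add: scalar_prod_def atLeast0LessThan)
    then have "cmod (q k) \<le> (\<Sum>i<n. cmod (B $$ (k, i) * (\<sigma>s ! i) y))"
      by (simp add: norm_sum)
    also have "\<dots> \<le> (\<Sum>i<n. cmod (B $$ (k, i)) * b)"
      using b by (intro sum_mono) (auto simp: norm_mult intro!: mult_left_mono)
    also have "\<dots> = (\<Sum>i<n. cmod (B $$ (k, i))) * b" by (simp add: sum_distrib_right)
    also have "\<dots> \<le> C * b"
      unfolding C_def using k b0
      by (intro mult_right_mono member_le_sum[of k "{..<n}" "\<lambda>k. \<Sum>i<n. cmod (B $$ (k, i))"]) (auto intro: sum_nonneg)
    finally show ?thesis .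
  qed
  moreover have "0 \<le> C" unfolding C_def by (intro sum_nonneg) auto
  ultimately show ?thesis by blast
qed

text \<open>
  By \<open>coordinate_bound\<close> the inequality holds up to a constant factor. Applying this to the powers of
  \<open>x\<close> removes the factor.
\<close>

lemma archimedean_bound:
  assumes abs: "absolute_value K v" and rat: "\<And>q::rat. v (of_rat q) = \<bar>of_rat q\<bar>"
    and x: "x \<in> K" and B: "\<And>i. i < n \<Longrightarrow> cmod ((\<sigma>s ! i) x) \<le> B" and B0: "0 \<le> B"
  shows "v x \<le> B"
proof (rule ccontr)
  interpret V: absolute_value K v by fact
  assume "\<not> v x \<le> B"
  then have Bv: "B < v x" by simp
  have vQ: "v q = cmod q" if "q \<in> \<rat>" for q
    using that rat cmod_of_rat by (elim Rats_cases) simp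
  obtain c where c: "\<And>k. c k \<in> K" and D: "D c \<noteq> 0"
    using independent_system_exists unfolding ring_of_integers_def by blast
  obtain C where C0: "C \<ge> 0" and C1: "\<forall>q y B. (\<forall>k. q k \<in> \<rat>) \<longrightarrow> y = (\<Sum>k<n. q k * c k) \<longrightarrow>
    (\<forall>i<n. cmod ((\<sigma>s ! i) y) \<le> B) \<longrightarrow> (\<forall>k<n. cmod (q k) \<le> C * B)"
    using coordinate_bound[of c, OF c D] by (elim exE conjE)
  define E where "E = C * (\<Sum>k<n. v (c k))"
  have bound: "v x ^ m \<le> E * B ^ m" for m
  proof -
    have xm: "x ^ m \<in> K" using x by simp
    obtain q where q: "\<forall>k. q k \<in> \<rat>" "x ^ m = (\<Sum>k<n. q k * c k)"
      using coordinates[of c "x ^ m"] c D xm by blast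
    have "cmod ((\<sigma>s ! i) (x ^ m)) \<le> B ^ m" if "i < n" for i
      using complex_hom.hom_power[OF \<sigma>_hom[OF that] x] B[OF that]
      by (simp add: norm_power power_mono)
    then have qB: "cmod (q k) \<le> C * B ^ m" if "k < n" for k
      using C1[rule_format, OF _ q(2), of "B ^ m" k] q(1) that by blast
    have qK: "q k \<in> K" for k using q(1) K.Rats_subset by blast
    have "v x ^ m = v (\<Sum>k<n. q k * c k)" using q(2) x by (simp flip: V.power)
    also have "\<dots> \<le> (\<Sum>k<n. v (q k * c k))"
      using qK c by (intro V.sum_le) auto
    also have "\<dots> \<le> (\<Sum>k<n. C * B ^ m * v (c k))"
    proof (rule sum_mono)
      fix k assume "k \<in> {..<n}"
      have "v (q k * c k) = cmod (q k) * v (c k)"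
        using q(1) c qK vQ by (subst V.mult) auto
      then show "v (q k * c k) \<le> C * B ^ m * v (c k)"
        using qB \<open>k \<in> {..<n}\<close> V.nonneg[OF c] by (simp add: mult_right_mono)
    qed
    also have "\<dots> = E * B ^ m" by (simp add: E_def sum_distrib_left mult_ac)
    finally show ?thesis .
  qed
  show False
  proof (cases "B = 0")
    case True
    then show False using bound[of 1] Bv by simp
  next
    case False
    then have "B > 0" using B0 by simp
    then have "(v x / B) ^ m \<le> E" for m
      using bound[of m] by (simp add: power_divide field_simps)
    moreover have "1 < v x / B" using Bv \<open>B > 0\<close> by simp
    then obtain m where "E < (v x / B) ^ m" using real_arch_pow by blast
    ultimately show False by (simp add: not_less[symmetric])
  qed
qed

text \<open>
  By \<open>archimedean_bound\<close>, at each element \<open>v\<close> is dominated by one of the embeddings. Take a minimal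
  set of embeddings with this property, and \<open>\<sigma>\<close> in it. By minimality some \<open>x\<close> is smaller at the
  others than at \<open>v\<close>; after scaling, \<open>\<bar>x\<bar>\<close> is less than 1 at the others and greater than 1 at \<open>v\<close>, and
  therefore at \<open>\<sigma>\<close>. Then \<open>x\<^sup>k / (1 + x\<^sup>k)\<close> tends to 1 at \<open>v\<close> and \<open>\<sigma>\<close> and to 0 at the others, so
  multiplication by it shows that \<open>\<sigma>\<close> alone dominates \<open>v\<close>. Inverses give the reverse inequality.
\<close>

lemma archimedean_place:
  assumes abs: "absolute_value K v" and rat: "\<And>q::rat. v (of_rat q) = \<bar>of_rat q\<bar>"
  shows "\<exists>i<n. \<forall>x\<in>K. v x = cmod ((\<sigma>s ! i) x)"
proof -
  interpret V: absolute_value K v by fact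
  define dom where "dom A \<longleftrightarrow> A \<subseteq> {..<n} \<and> (\<forall>x\<in>K. \<exists>i\<in>A. v x \<le> cmod ((\<sigma>s ! i) x))" for A
  have "dom {..<n}"
    unfolding dom_def
  proof (intro conjI ballI subset_refl, rule ccontr)
    fix x assume x: "x \<in> K" and "\<not> (\<exists>i\<in>{..<n}. v x \<le> cmod ((\<sigma>s ! i) x))"
    then have less: "\<forall>i<n. cmod ((\<sigma>s ! i) x) < v x" by (auto simp: not_le)
    obtain i where "i < n"
      using embedding_cases[of "\<lambda>x. x"] by (auto simp: complex_hom_def complex_hom_axioms_def K.complex_subring_axioms)
    then have vx: "0 < v x" using less norm_ge_zero le_less_trans by blast
    let ?B = "Max (insert 0 ((\<lambda>i. cmod ((\<sigma>s ! i) x)) ` {..<n}))"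
    have "v x \<le> ?B" by (rule archimedean_bound[OF abs rat x]) auto
    moreover have "?B < v x" using less vx by (subst Max_less_iff) auto
    ultimately show False by simp
  qed
  then obtain A where A: "dom A" and min: "\<And>A'. dom A' \<Longrightarrow> card A \<le> card A'"
    using ex_has_least_nat[of dom _ card] by blast
  have finA: "finite A" using A finite_subset unfolding dom_def by blast
  obtain i where iA: "i \<in> A" using A K.one_mem unfolding dom_def by blast
  have "v w \<le> cmod ((\<sigma>s ! i) w)" if w: "w \<in> K" for w
  proof (cases "A - {i} = {}")
    case True
    then show ?thesis using A w unfolding dom_def by blast
  next
    case False
    then obtain j0 where j0: "j0 \<in> A - {i}" by blast
    have "card (A - {i}) < card A" by (rule card_Diff1_less[OF finA iA])
    then have "\<not> dom (A - {i})" using min[of "A - {i}"] by auto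
    then obtain y where y: "y \<in> K" "\<And>j. j \<in> A - {i} \<Longrightarrow> cmod ((\<sigma>s ! j) y) < v y"
      using A unfolding dom_def by (auto simp: not_le)
    have "Max ((\<lambda>j. cmod ((\<sigma>s ! j) y)) ` (A - {i})) < v y"
      using finA False y(2) by (subst Max_less_iff) auto
    then obtain q :: rat where q: "Max ((\<lambda>j. cmod ((\<sigma>s ! j) y)) ` (A - {i})) < of_rat q" "of_rat q < v y"
      using of_rat_dense by blast
    have yq: "cmod ((\<sigma>s ! j) y) < of_rat q" if "j \<in> A - {i}" for j
      using q(1) finA that by (subst (asm) Max_less_iff) auto
    have q0: "(0::real) < of_rat q" using yq[OF j0] norm_ge_zero le_less_trans by blast
    have qK: "of_rat q \<in> K" by (rule subsetD[OF K.Rats_subset Rats_of_rat])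
    \<comment> \<open>Scaling by a rational number moves the values to both sides of 1.\<close>
    define x where "x = y / of_rat q"
    have xK: "x \<in> K" using y(1) qK by (simp add: x_def)
    have vx: "1 < v x" using q0 q(2) y(1) qK rat[of q] by (simp add: x_def V.divide)
    have sx: "cmod ((\<sigma>s ! j) x) < 1" if j: "j \<in> A - {i}" for j
    proof -
      interpret T: complex_hom K "\<sigma>s ! j" using \<sigma>_hom j A unfolding dom_def by blast
      have "(\<sigma>s ! j) x * of_rat q = (\<sigma>s ! j) y"
        using T.hom_mult[OF xK qK] q0 T.hom_rat[OF Rats_of_rat qK] by (simp add: x_def)
      then have "cmod ((\<sigma>s ! j) x) * of_rat q = cmod ((\<sigma>s ! j) y)"
        using q0 by (metis norm_mult cmod_of_rat abs_of_pos)
      then have "cmod ((\<sigma>s ! j) x) * of_rat q < 1 * of_rat q" using yq[OF j] by simp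
      then show ?thesis using q0 by (simp only: mult_less_cancel_right_pos)
    qed
    have "\<exists>j\<in>A. v x \<le> cmod ((\<sigma>s ! j) x)" using A xK unfolding dom_def by blast
    then have six: "1 < cmod ((\<sigma>s ! i) x)" using sx vx by force
    show ?thesis
    proof (rule ccontr)
      assume contra: "\<not> v w \<le> cmod ((\<sigma>s ! i) w)"
      define c where "c = (v w + cmod ((\<sigma>s ! i) w)) / 2"
      have c: "cmod ((\<sigma>s ! i) w) < c" "c < v w" using contra by (auto simp: c_def)
      then have c0: "0 < c" using norm_ge_zero le_less_trans by blast
      let ?u = "\<lambda>z k. z ^ k / (1 + z ^ k)"
      have "(\<lambda>k. v w * ?u (v x) k) \<longlonglongrightarrow> v w * 1"
        using vx by (intro tendsto_mult tendsto_const power_ratio_limit) simp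
      then have e1: "eventually (\<lambda>k. c < v w * ?u (v x) k) sequentially"
        by (rule order_tendstoD) (use c in simp)
      have "(\<lambda>k. cmod ((\<sigma>s ! i) w * ?u ((\<sigma>s ! i) x) k)) \<longlonglongrightarrow> cmod ((\<sigma>s ! i) w * 1)"
        by (intro tendsto_norm tendsto_mult tendsto_const power_ratio_limit six)
      then have e2: "eventually (\<lambda>k. cmod ((\<sigma>s ! i) w * ?u ((\<sigma>s ! i) x) k) < c) sequentially"
        by (rule order_tendstoD) (use c in simp)
      have e3: "eventually (\<lambda>k. \<forall>j\<in>A - {i}. cmod ((\<sigma>s ! j) w * ?u ((\<sigma>s ! j) x) k) < c) sequentially"
      proof (rule eventually_ball_finite, use finA in simp, rule ballI)
        fix j assume j: "j \<in> A - {i}"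
        have "(\<lambda>k. (\<sigma>s ! j) x ^ k) \<longlonglongrightarrow> 0" using sx[OF j] by (rule LIMSEQ_power_zero)
        then have "(\<lambda>k. cmod ((\<sigma>s ! j) w * ?u ((\<sigma>s ! j) x) k)) \<longlonglongrightarrow> cmod ((\<sigma>s ! j) w * (0 / (1 + 0)))"
          by (intro tendsto_norm tendsto_mult tendsto_divide tendsto_add tendsto_const) auto
        then show "eventually (\<lambda>k. cmod ((\<sigma>s ! j) w * ?u ((\<sigma>s ! j) x) k) < c) sequentially"
          by (rule order_tendstoD) (use c0 in simp)
      qed
      obtain k where k: "k > 0" "c < v w * ?u (v x) k"
        "cmod ((\<sigma>s ! i) w * ?u ((\<sigma>s ! i) x) k) < c"
        "\<forall>j\<in>A - {i}. cmod ((\<sigma>s ! j) w * ?u ((\<sigma>s ! j) x) k) < c"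
        using eventually_happens'[OF sequentially_bot eventually_conj[OF eventually_gt_at_top[of 0]
          eventually_conj[OF e1 eventually_conj[OF e2 e3]]]] by blast
      have nz: "1 + x ^ k \<noteq> 0"
      proof
        assume "1 + x ^ k = 0"
        then have "x ^ k = - 1" by (simp only: add_eq_0_iff)
        then have "(x ^ k) ^ 2 = 1" by (simp only: power2_minus power_one)
        then have "v ((x ^ k) ^ 2) = 1" by (simp only: V.one)
        then have "(v x ^ k) ^ 2 = 1" using xK by (simp only: V.power K.power_mem)
        moreover have "1 < (v x ^ k) ^ 2" using vx k(1) by (intro one_less_power) auto
        ultimately show False by simp
      qed
      have uK: "w * ?u x k \<in> K" using w xK by simp
      obtain j where j: "j \<in> A" "v (w * ?u x k) \<le> cmod ((\<sigma>s ! j) (w * ?u x k))"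
        using A uK unfolding dom_def by blast
      interpret T: complex_hom K "\<sigma>s ! j" using \<sigma>_hom j(1) A unfolding dom_def by blast
      have "(\<sigma>s ! j) (?u x k) * (1 + (\<sigma>s ! j) x ^ k) = (\<sigma>s ! j) x ^ k"
        using T.hom_mult[of "?u x k" "1 + x ^ k"] nz xK by (simp add: T.hom_add T.hom_power)
      moreover have "1 + (\<sigma>s ! j) x ^ k \<noteq> 0"
        using T.hom_nonzero[OF K.complex_subfield_axioms _ nz] xK by (simp add: T.hom_add T.hom_power)
      ultimately have "(\<sigma>s ! j) (?u x k) = ?u ((\<sigma>s ! j) x) k"
        by (simp add: eq_divide_eq)
      moreover have "(\<sigma>s ! j) (w * ?u x k) = (\<sigma>s ! j) w * (\<sigma>s ! j) (?u x k)"
        by (rule T.hom_mult[OF w]) (use xK in simp)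
      ultimately have "(\<sigma>s ! j) (w * ?u x k) = (\<sigma>s ! j) w * ?u ((\<sigma>s ! j) x) k"
        by (simp only:)
      then have "cmod ((\<sigma>s ! j) (w * ?u x k)) < c" using k(3,4) j(1) by (cases "j = i") auto
      moreover have "v w * ?u (v x) k \<le> v (w * ?u x k)"
      proof -
        have "v (1 + x ^ k) \<le> 1 + v x ^ k"
          using V.triangle[of 1 "x ^ k"] xK by (simp add: V.power)
        moreover have "0 < v (1 + x ^ k)" using nz xK by (intro V.pos) auto
        ultimately have "?u (v x) k \<le> v x ^ k / v (1 + x ^ k)"
          using vx by (intro divide_left_mono mult_pos_pos) (auto simp: add_pos_pos)
        also have "\<dots> = v (?u x k)" using nz xK by (simp add: V.divide V.power)
        finally have "v w * ?u (v x) k \<le> v w * v (?u x k)" by (rule mult_left_mono[OF _ V.nonneg[OF w]])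
        also have "v w * v (?u x k) = v (w * ?u x k)"
          by (rule V.mult[OF w, symmetric]) (use xK in simp)
        finally show ?thesis .
      qed
      ultimately show False using k(2) j(2) by linarith
    qed
  qed
  then obtain i where i: "i < n" "\<And>x. x \<in> K \<Longrightarrow> v x \<le> cmod ((\<sigma>s ! i) x)"
    using iA A unfolding dom_def by blast
  interpret S: complex_hom K "\<sigma>s ! i" using \<sigma>_hom i(1) .
  have "v x = cmod ((\<sigma>s ! i) x)" if x: "x \<in> K" for x
  proof (cases "x = 0")
    case True
    then show ?thesis using V.eq_0[of 0] by simp
  next
    case False
    have "(\<sigma>s ! i) x * (\<sigma>s ! i) (inverse x) = 1"
      using S.hom_mult[of x "inverse x"] x False by simp
    then have "cmod ((\<sigma>s ! i) x) * cmod ((\<sigma>s ! i) (inverse x)) = 1"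
      by (metis norm_mult norm_one)
    then have "cmod ((\<sigma>s ! i) (inverse x)) = inverse (cmod ((\<sigma>s ! i) x))"
      by (metis inverse_unique)
    moreover have "v (inverse x) = inverse (v x)" using V.inverse x False by simp
    ultimately have "inverse (v x) \<le> inverse (cmod ((\<sigma>s ! i) x))"
      using i(2)[of "inverse x"] x by simp
    then have "cmod ((\<sigma>s ! i) x) \<le> v x"
      using V.pos[OF x False] S.hom_nonzero[OF K.complex_subfield_axioms x False]
      by (simp add: inverse_le_iff_le)
    then show ?thesis using i(2)[OF x] by simp
  qed
  then show ?thesis using i(1) by blast
qed

end

section \<open>Completions at archimedean places\<close>

lemma Rats_seq_approx: "\<exists>q :: nat \<Rightarrow> complex. (\<forall>k. q k \<in> \<rat>) \<and> q \<longlonglongrightarrow> of_real a"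
proof -
  have "\<forall>k. \<exists>t::rat. a < of_rat t \<and> of_rat t < a + 1 / real (Suc k)"
    by (intro allI of_rat_dense) simp
  then obtain t :: "nat \<Rightarrow> rat" where t: "\<And>k. a < of_rat (t k)" "\<And>k. of_rat (t k) < a + 1 / real (Suc k)"
    by metis
  have lim: "(\<lambda>k. a + 1 / real (Suc k)) \<longlonglongrightarrow> a"
    using tendsto_add[OF tendsto_const[of a] LIMSEQ_Suc[OF lim_1_over_n]] by simp
  have "(\<lambda>k. real_of_rat (t k)) \<longlonglongrightarrow> a"
    by (rule real_tendsto_sandwich[OF _ _ tendsto_const lim])
       (intro always_eventually allI less_imp_le t)+
  then have "(\<lambda>k. complex_of_real (of_rat (t k))) \<longlonglongrightarrow> of_real a" by (rule tendsto_of_real)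
  then show ?thesis by (intro exI[of _ "\<lambda>k. of_rat (t k)"]) (simp add: of_real_of_rat_complex)
qed

interpretation Reals: complex_subfield \<real>
  by unfold_locales auto

text \<open>
  The place \<open>v = \<bar>\<sigma>\<bar>\<close>. Taking limits of \<open>\<sigma>\<close> along Cauchy sequences identifies the completion with
  a subring of \<open>\<complex>\<close> in which the completion of \<open>\<rat>\<close> is \<open>\<real>\<close>.
\<close>

locale archimedean_completion = K: complex_subfield K + complex_hom K \<sigma> for K \<sigma> +
  fixes v :: "complex \<Rightarrow> real"
  assumes v_eq: "x \<in> K \<Longrightarrow> v x = cmod (\<sigma> x)"
begin

abbreviation "R \<equiv> cauchy_ring K v"

lemma cauchy_seqs_iff:
  assumes "E \<subseteq> K"
  shows "x \<in> cauchy_seqs E v \<longleftrightarrow> (\<forall>k. x k \<in> E) \<and> convergent (\<lambda>k. \<sigma> (x k))"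
proof (cases "\<forall>k. x k \<in> E")
  case True
  then have "v (x m - x n) = cmod (\<sigma> (x m) - \<sigma> (x n))" for m n
    using assms by (subst v_eq) (auto simp: hom_diff subset_iff)
  then show ?thesis
    using True unfolding cauchy_seqs_def Cauchy_convergent_iff[symmetric] Cauchy_iff by simp
qed (auto simp: cauchy_seqs_def)

lemma carrier_R: "carrier R = {x. (\<forall>k. x k \<in> K) \<and> convergent (\<lambda>k. \<sigma> (x k))}"
  using cauchy_seqs_iff[of K] by (auto simp: cauchy_ring_def)

lemma R_simps:
  "x \<otimes>\<^bsub>R\<^esub> y = (\<lambda>k. x k * y k)" "x \<oplus>\<^bsub>R\<^esub> y = (\<lambda>k. x k + y k)" "\<one>\<^bsub>R\<^esub> = (\<lambda>_. 1)" "\<zero>\<^bsub>R\<^esub> = (\<lambda>_. 0)"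
  by (auto simp: cauchy_ring_def)

lemma ring_R: "ring R"
proof (rule ringI)
  show "abelian_group R"
  proof (rule abelian_groupI)
    fix x assume "x \<in> carrier R"
    then have "(\<lambda>k. - x k) \<in> carrier R"
      using convergent_minus_iff[of "\<lambda>k. \<sigma> (x k)"] by (simp add: carrier_R hom_uminus)
    then show "\<exists>y\<in>carrier R. y \<oplus>\<^bsub>R\<^esub> x = \<zero>\<^bsub>R\<^esub>"
      by (intro bexI[of _ "\<lambda>k. - x k"]) (auto simp: R_simps)
  qed (auto simp: carrier_R R_simps hom_add algebra_simps intro: convergent_add convergent_const)
  show "monoid R"
    by unfold_locales (auto simp: carrier_R R_simps hom_mult algebra_simps intro: convergent_mult convergent_const)
qed (auto simp: R_simps algebra_simps)

definition limit :: "(nat \<Rightarrow> complex) \<Rightarrow> complex" where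
  "limit x = lim (\<lambda>k. \<sigma> (x k))"

lemma limit_LIMSEQ: "x \<in> carrier R \<Longrightarrow> (\<lambda>k. \<sigma> (x k)) \<longlonglongrightarrow> limit x"
  unfolding limit_def by (simp add: carrier_R convergent_LIMSEQ_iff)

lemma limit_eqI: "(\<lambda>k. \<sigma> (x k)) \<longlonglongrightarrow> l \<Longrightarrow> limit x = l"
  unfolding limit_def by (rule limI)

lemma limit_ring_hom: "limit \<in> Ring.ring_hom R CC"
proof (rule ring_hom_memI)
  fix x y assume xy: "x \<in> carrier R" "y \<in> carrier R"
  then have mem: "x k \<in> K" "y k \<in> K" for k by (auto simp: carrier_R)
  show "limit (x \<otimes>\<^bsub>R\<^esub> y) = limit x \<otimes>\<^bsub>CC\<^esub> limit y"
    using tendsto_mult[OF limit_LIMSEQ limit_LIMSEQ, OF xy] mem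
    by (intro limit_eqI) (simp add: R_simps hom_mult)
  show "limit (x \<oplus>\<^bsub>R\<^esub> y) = limit x \<oplus>\<^bsub>CC\<^esub> limit y"
    using tendsto_add[OF limit_LIMSEQ limit_LIMSEQ, OF xy] mem
    by (intro limit_eqI) (simp add: R_simps hom_add)
next
  show "limit \<one>\<^bsub>R\<^esub> = \<one>\<^bsub>CC\<^esub>"
    by (rule limit_eqI) (simp add: R_simps)
qed simp

sublocale L: ring_hom_ring R CC limit
  by (rule ring_hom_ringI2[OF ring_R CC.ring_axioms limit_ring_hom])

lemma kernel_limit: "a_kernel R CC limit = null_seqs K v"
proof -
  have *: "x \<in> carrier R \<and> limit x = 0 \<longleftrightarrow> (\<forall>k. x k \<in> K) \<and> (\<lambda>k. v (x k)) \<longlonglongrightarrow> 0" for x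
  proof (cases "\<forall>k. x k \<in> K")
    case True
    then have "(\<lambda>k. v (x k)) \<longlonglongrightarrow> 0 \<longleftrightarrow> (\<lambda>k. \<sigma> (x k)) \<longlonglongrightarrow> 0"
      by (simp add: v_eq tendsto_norm_zero_iff)
    also have "\<dots> \<longleftrightarrow> x \<in> carrier R \<and> limit x = 0"
    proof
      assume "(\<lambda>k. \<sigma> (x k)) \<longlonglongrightarrow> 0"
      then show "x \<in> carrier R \<and> limit x = 0"
        using True limit_eqI[of x 0] unfolding carrier_R convergent_def by blast
    next
      assume "x \<in> carrier R \<and> limit x = 0"
      then show "(\<lambda>k. \<sigma> (x k)) \<longlonglongrightarrow> 0" using limit_LIMSEQ[of x] by simp
    qed
    finally show ?thesis using True by blast
  qed (auto simp: carrier_R)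
  show ?thesis
    unfolding a_kernel_def' null_seqs_def CC_simps by (rule Collect_cong) (rule *)
qed

definition lift :: "(nat \<Rightarrow> complex) set \<Rightarrow> complex" where
  "lift Y = the_elem (limit ` Y)"

lemma completion_eq: "completion K v = R Quot (a_kernel R CC limit)"
  unfolding completion_def kernel_limit ..

lemma ring_completion: "ring (completion K v)"
  unfolding completion_eq by (rule ideal.quotient_is_ring[OF L.kernel_is_ideal])

lemma lift_iso: "lift \<in> ring_iso (completion K v) (CC\<lparr>carrier := limit ` carrier R\<rparr>)"
  unfolding completion_eq lift_def by (rule L.FactRing_iso_set_aux)

lemma lift_coset: "x \<in> carrier R \<Longrightarrow> lift (null_seqs K v +>\<^bsub>R\<^esub> x) = limit x"
  unfolding lift_def kernel_limit[symmetric] by (rule L.the_elem_simp)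

lemma coset_in_completion: "x \<in> carrier R \<Longrightarrow> null_seqs K v +>\<^bsub>R\<^esub> x \<in> carrier (completion K v)"
  unfolding completion_eq kernel_limit[symmetric] FactRing_def by (auto simp: A_RCOSETS_def')

lemma rat_cauchy_subset: "cauchy_seqs \<rat> v \<subseteq> carrier R"
proof
  fix x assume "x \<in> cauchy_seqs \<rat> v"
  then have "\<forall>k. x k \<in> \<rat>" "convergent (\<lambda>k. \<sigma> (x k))"
    using cauchy_seqs_iff[OF K.Rats_subset] by blast+
  then show "x \<in> carrier R" using K.Rats_subset unfolding carrier_R by blast
qed

lemma rat_completion_eq: "rat_completion K v = (\<lambda>x. null_seqs K v +>\<^bsub>R\<^esub> x) ` cauchy_seqs \<rat> v"
  unfolding rat_completion_def by blast

lemma lift_rat_completion: "lift ` rat_completion K v = \<real>"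
proof -
  have "lift ` rat_completion K v = limit ` cauchy_seqs \<rat> v"
    unfolding rat_completion_eq image_image
    by (intro image_cong refl lift_coset subsetD[OF rat_cauchy_subset])
  also have "\<dots> = \<real>"
  proof safe
    fix x assume x: "x \<in> cauchy_seqs \<rat> v"
    then have xQ: "x k \<in> \<rat>" for k by (simp add: cauchy_seqs_def)
    have eq: "(\<lambda>k. \<sigma> (x k)) = x"
      using hom_rat[OF xQ] xQ K.Rats_subset by blast
    have "x \<in> carrier R" using x rat_cauchy_subset by blast
    then have "x \<longlonglongrightarrow> limit x" using limit_LIMSEQ[of x] unfolding eq by simp
    moreover have "x k \<in> \<real>" for k using xQ Reals.Rats_subset by blast
    ultimately show "limit x \<in> \<real>"
      using closed_sequentially[OF closed_complex_Reals] by blast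
  next
    fix z :: complex assume "z \<in> \<real>"
    then obtain a where "z = of_real a" by (elim Reals_cases)
    then obtain q :: "nat \<Rightarrow> complex" where q: "\<And>k. q k \<in> \<rat>" "q \<longlonglongrightarrow> z" using Rats_seq_approx by blast
    then have "(\<lambda>k. \<sigma> (q k)) = q" using hom_rat K.Rats_subset by blast
    then have "q \<in> cauchy_seqs \<rat> v" "limit q = z"
      using q cauchy_seqs_iff[OF K.Rats_subset] by (auto intro: limit_eqI simp: convergent_def)
    then show "z \<in> limit ` cauchy_seqs \<rat> v" by blast
  qed
  finally show ?thesis .
qed

lemma rat_completion_subset: "rat_completion K v \<subseteq> carrier (completion K v)"
  unfolding rat_completion_eq using coset_in_completion rat_cauchy_subset by blast

text \<open>
  Dimensions are transported along the inverse of the isomorphism \<open>lift\<close>.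
\<close>

lemma local_degree_eqI:
  assumes I: "limit ` carrier R = I" and sub: "subring I CC"
    and sf: "subfield \<real> (CC\<lparr>carrier := I\<rparr>)"
    and dim: "ring.dimension (CC\<lparr>carrier := I\<rparr>) n \<real> I"
  shows "local_degree K v = n"
proof -
  let ?Q = "completion K v" and ?S = "CC\<lparr>carrier := I\<rparr>"
  interpret Q: ring ?Q by (rule ring_completion)
  have iso: "lift \<in> ring_iso ?Q ?S" using lift_iso I by simp
  define g where "g = inv_into (carrier ?Q) lift"
  have g: "g \<in> ring_iso ?S ?Q"
    unfolding g_def by (rule ring_iso_set_sym[OF ring_completion iso])
  have bij: "bij_betw lift (carrier ?Q) I" using iso by (simp add: ring_iso_def)
  have ringS: "ring ?S" by (rule CC.subring_is_ring[OF sub])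
  interpret g: ring_hom_ring ?S ?Q g
    using ring_hom_ringI2[OF ringS ring_completion] g by (simp add: ring_iso_def)
  have ginj: "inj_on g I" and gim: "g ` I = carrier ?Q"
    using g by (auto simp: ring_iso_def bij_betw_def)
  have gR: "g ` \<real> = rat_completion K v"
  proof -
    have "g ` lift ` rat_completion K v = rat_completion K v"
      unfolding g_def using bij_betw_imp_inj_on[OF bij] rat_completion_subset
      by (rule inv_into_image_cancel)
    then show ?thesis by (simp only: lift_rat_completion)
  qed
  have one_zero: "\<one>\<^bsub>?Q\<^esub> \<noteq> \<zero>\<^bsub>?Q\<^esub>"
  proof
    assume "\<one>\<^bsub>?Q\<^esub> = \<zero>\<^bsub>?Q\<^esub>"
    then have "g \<one>\<^bsub>?S\<^esub> = g \<zero>\<^bsub>?S\<^esub>" using g.hom_one g.hom_zero by simp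
    then have "g 1 = g 0" by simp
    moreover have "1 \<in> I" "0 \<in> I" using g.R.one_closed g.R.zero_closed by simp_all
    ultimately have "(1::complex) = 0" using ginj by (blast dest: inj_onD)
    then show False by simp
  qed
  have "Q.dimension n (g ` \<real>) (g ` I)"
    by (rule g.inj_hom_dimension[OF sf one_zero ginj dim])
  moreover have "subfield (g ` \<real>) ?Q" by (rule g.img_is_subfield(2)[OF sf one_zero])
  ultimately show ?thesis
    using Q.dimI unfolding gR gim local_degree_def over_def by blast
qed

lemma local_degree_real:
  assumes "\<sigma> ` K \<subseteq> \<real>"
  shows "local_degree K v = 1"
proof (rule local_degree_eqI)
  have sf: "subfield \<real> CC" by (simp add: subfield_CC_iff Reals.complex_subfield_axioms)
  then show sr: "subring \<real> CC" by (rule subfieldE(1))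
  show "limit ` carrier R = \<real>"
  proof
    show "limit ` carrier R \<subseteq> \<real>"
    proof safe
      fix x assume x: "x \<in> carrier R"
      have "\<sigma> (x k) \<in> \<real>" for k using x assms by (auto simp: carrier_R)
      then show "limit x \<in> \<real>"
        by (rule closed_sequentially[OF closed_complex_Reals _ limit_LIMSEQ[OF x]])
    qed
    have "rat_completion K v \<subseteq> carrier (completion K v)" by (rule rat_completion_subset)
    then have "lift ` rat_completion K v \<subseteq> lift ` carrier (completion K v)" by blast
    also have "\<dots> = limit ` carrier R"
      using lift_iso by (simp add: ring_iso_def bij_betw_def)
    finally show "\<real> \<subseteq> limit ` carrier R" by (simp only: lift_rat_completion)
  qed
  have "Ring.field (CC\<lparr>carrier := \<real>\<rparr>)" using CC.subfield_iff(2)[OF sf] .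
  then show sfR: "subfield \<real> (CC\<lparr>carrier := \<real>\<rparr>)" using field.carrier_is_subfield by fastforce
  show "ring.dimension (CC\<lparr>carrier := \<real>\<rparr>) 1 \<real> \<real>"
    by (rule ring.dimension_one[OF CC.subring_is_ring[OF sr] sfR])
qed

text \<open>
  If \<open>\<sigma> y\<close> is not real, then 1 and \<open>\<sigma> y\<close> span \<open>\<complex>\<close> over \<open>\<real>\<close>, and every complex number is a
  limit of numbers \<open>p \<cdot> \<sigma> y + q\<close> with rational \<open>p\<close>, \<open>q\<close>.
\<close>

lemma local_degree_complex:
  assumes y: "y \<in> K" "\<sigma> y \<notin> \<real>"
  shows "local_degree K v = 2"
proof (rule local_degree_eqI)
  have UNIV: "CC\<lparr>carrier := UNIV\<rparr> = CC" by (simp add: ring_of_type_algebra_def)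
  have sf: "subfield \<real> CC" by (simp add: subfield_CC_iff Reals.complex_subfield_axioms)
  show "subring UNIV CC" using CC.carrier_is_subring by simp
  show "subfield \<real> (CC\<lparr>carrier := UNIV\<rparr>)" using sf by (simp only: UNIV)
  have combo: "\<exists>a b. z = of_real a * \<sigma> y + of_real b" for z
  proof -
    have im: "Im (\<sigma> y) \<noteq> 0" using y(2) by (simp add: complex_is_Real_iff)
    show ?thesis
      by (intro exI[of _ "Im z / Im (\<sigma> y)"] exI[of _ "Re z - Im z / Im (\<sigma> y) * Re (\<sigma> y)"])
        (simp add: complex_eq_iff im)
  qed
  have "z \<in> limit ` carrier R" for z
  proof -
    obtain a b where z: "z = of_real a * \<sigma> y + of_real b" using combo by blast
    obtain p q :: "nat \<Rightarrow> complex" where pq: "\<And>k. p k \<in> \<rat>" "p \<longlonglongrightarrow> of_real a" "\<And>k. q k \<in> \<rat>" "q \<longlonglongrightarrow> of_real b"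
      using Rats_seq_approx[of a] Rats_seq_approx[of b] by blast
    define x where "x k = p k * y + q k" for k
    have pqK: "p k \<in> K" "q k \<in> K" for k using pq K.Rats_subset by auto
    have sx: "\<sigma> (x k) = p k * \<sigma> y + q k" for k
      using pqK pq y(1) by (simp add: x_def hom_add hom_mult hom_rat)
    have "(\<lambda>k. \<sigma> (x k)) \<longlonglongrightarrow> z"
      unfolding sx z by (intro tendsto_intros pq)
    moreover from this have "x \<in> carrier R"
      using pqK y(1) by (auto simp: carrier_R convergent_def x_def)
    ultimately show ?thesis using limit_eqI by blast
  qed
  then show "limit ` carrier R = UNIV" by blast
  have "CC.dimension (Suc 1) \<real> (CC.line_extension \<real> (\<sigma> y) \<real>)"
    by (rule CC.Suc_dim[OF _ y(2) CC.dimension_one[OF sf]]) simp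
  moreover have "CC.line_extension \<real> (\<sigma> y) \<real> = UNIV"
    using combo by (force simp: CC.line_extension_mem_iff)
  ultimately show "ring.dimension (CC\<lparr>carrier := UNIV\<rparr>) 2 \<real> UNIV"
    by (simp only: UNIV numeral_2_eq_2 One_nat_def)
qed

end

section \<open>The Weil height of an algebraic integer\<close>

lemma generate_field_singleton:
  assumes "algebraic \<alpha>"
  shows "generate_field CC {\<alpha>} = Rats.adj \<alpha>"
proof
  interpret K: complex_subfield "Rats.adj \<alpha>"
    using assms by (intro Rats.adj_subfield) (simp add: algebraic_iff_integral)
  have "subfield (generate_field CC {\<alpha>}) CC"
    by (rule field.generate_field_is_subfield[OF field_CC]) simp
  then interpret G: complex_subfield "generate_field CC {\<alpha>}" by (simp add: subfield_CC_iff)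
  show "generate_field CC {\<alpha>} \<subseteq> Rats.adj \<alpha>"
    by (rule field.generate_field_min_subfield1[OF field_CC])
       (auto simp: subfield_CC_iff K.complex_subfield_axioms Rats.gen_in_adj)
  show "Rats.adj \<alpha> \<subseteq> generate_field CC {\<alpha>}"
    by (rule Rats.adj_subset[OF G.complex_subring_axioms G.Rats_subset]) (rule generate_field.incl, simp)
qed

text \<open>
  Circles around 0 and 1 meet in at most two points, which are complex conjugate.
\<close>

lemma equidistant_cases:
  assumes "cmod y = cmod z" "cmod (y - 1) = cmod (z - 1)"
  shows "y = z \<or> y = cnj z"
proof -
  have "(cmod y)\<^sup>2 = (cmod z)\<^sup>2" "(cmod (y - 1))\<^sup>2 = (cmod (z - 1))\<^sup>2" using assms by simp_all
  then have 1: "(Re y)\<^sup>2 + (Im y)\<^sup>2 = (Re z)\<^sup>2 + (Im z)\<^sup>2"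
    and 2: "(Re y - 1)\<^sup>2 + (Im y)\<^sup>2 = (Re z - 1)\<^sup>2 + (Im z)\<^sup>2"
    by (simp_all add: cmod_power2)
  have re: "Re y = Re z" using 1 2 by (simp add: power2_diff)
  then have "(Im y)\<^sup>2 = (Im z)\<^sup>2" using 1 by simp
  then have "Im y = Im z \<or> Im y = - Im z" by (simp add: power2_eq_iff)
  then show ?thesis using re by (auto simp: complex_eq_iff)
qed

text \<open>
  Two embeddings define the same place only if they are equal or complex conjugate, by comparing
  them at \<open>\<theta>\<close> and \<open>\<theta> - 1\<close>.
\<close>

lemma card_embedding_fiber:
  assumes f: "Rats.minpoly f \<theta>" and \<sigma>: "\<sigma> \<in> field_embeddings (Rats.adj \<theta>)"
  defines "V \<equiv> \<lambda>\<sigma>. restrict (\<lambda>x. cmod (\<sigma> x)) (Rats.adj \<theta>)"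
  shows "card {\<sigma>' \<in> field_embeddings (Rats.adj \<theta>). V \<sigma>' = V \<sigma>} \<le> local_degree (Rats.adj \<theta>) (V \<sigma>)"
proof -
  let ?K = "Rats.adj \<theta>"
  interpret K: complex_subfield ?K using integral_gen[OF f] by (rule Rats.adj_subfield)
  have hom: "complex_hom ?K s" if "s \<in> field_embeddings ?K" for s
    using that field_embeddings_iff[OF K.complex_subring_axioms] by blast
  interpret S: complex_hom ?K \<sigma> using hom[OF \<sigma>] .
  interpret A: archimedean_completion ?K \<sigma> "V \<sigma>"
    by unfold_locales (simp add: V_def)
  define F where "F = {\<sigma>' \<in> field_embeddings ?K. V \<sigma>' = V \<sigma>}"
  have \<theta>K: "\<theta> \<in> ?K" by (rule Rats.gen_in_adj)
  have inj: "inj_on (\<lambda>s. s \<theta>) F"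
    using bij_betw_imp_inj_on[OF field_embeddings_adj[OF f]] by (rule inj_on_subset) (simp add: F_def)
  have img: "(\<lambda>s. s \<theta>) ` F \<subseteq> {\<sigma> \<theta>, cnj (\<sigma> \<theta>)}"
  proof (rule image_subsetI)
    fix s assume s: "s \<in> F"
    interpret T: complex_hom ?K s using hom s by (simp add: F_def)
    have eq: "cmod (s x) = cmod (\<sigma> x)" if "x \<in> ?K" for x
    proof -
      have "V s x = V \<sigma> x" using s by (simp add: F_def)
      then show ?thesis using that by (simp add: V_def)
    qed
    have "cmod (s \<theta> - 1) = cmod (\<sigma> \<theta> - 1)"
      using eq[of "\<theta> - 1"] \<theta>K by (simp add: T.hom_diff S.hom_diff)
    then show "s \<theta> \<in> {\<sigma> \<theta>, cnj (\<sigma> \<theta>)}" using equidistant_cases[OF eq[OF \<theta>K]] by blast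
  qed
  have card: "card F = card ((\<lambda>s. s \<theta>) ` F)" using inj by (simp add: card_image)
  show ?thesis
  proof (cases "\<sigma> \<theta> \<in> \<real>")
    case True
    have "\<sigma> ` ?K \<subseteq> \<real>"
    proof safe
      fix x assume "x \<in> ?K"
      then obtain p where p: "p \<in> Rats.polys" "x = poly p \<theta>" by (auto simp: Rats.adj_def)
      have "\<sigma> x = poly p (\<sigma> \<theta>)" unfolding p(2) by (rule S.hom_poly[OF K.Rats_subset p(1) \<theta>K])
      moreover have "p \<in> Reals.polys" using p(1) Reals.Rats_subset by (auto simp: Rats.polys_def Reals.polys_def)
      ultimately show "\<sigma> x \<in> \<real>" using True by simp
    qed
    then have "local_degree ?K (V \<sigma>) = 1" by (rule A.local_degree_real)
    moreover have "cnj (\<sigma> \<theta>) = \<sigma> \<theta>" using True by (simp add: Reals_cnj_iff)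
    then have "card ((\<lambda>s. s \<theta>) ` F) \<le> card {\<sigma> \<theta>}" using img by (intro card_mono) auto
    ultimately show ?thesis using card by (simp add: F_def)
  next
    case False
    then have "local_degree ?K (V \<sigma>) = 2" using A.local_degree_complex[OF \<theta>K] by simp
    moreover have "card ((\<lambda>s. s \<theta>) ` F) \<le> card {\<sigma> \<theta>, cnj (\<sigma> \<theta>)}" using img by (intro card_mono) auto
    moreover have "card {\<sigma> \<theta>, cnj (\<sigma> \<theta>)} \<le> 2" by (simp add: card_insert_if)
    ultimately show ?thesis using card by (simp add: F_def)
  qed
qed

lemma embedding_place:
  assumes f: "Rats.minpoly f \<theta>" and \<sigma>: "\<sigma> \<in> field_embeddings (Rats.adj \<theta>)"
  shows "restrict (\<lambda>x. cmod (\<sigma> x)) (Rats.adj \<theta>) \<in> places (Rats.adj \<theta>)"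
proof -
  let ?K = "Rats.adj \<theta>"
  interpret K: complex_subfield ?K using integral_gen[OF f] by (rule Rats.adj_subfield)
  interpret S: complex_hom ?K \<sigma> using \<sigma> field_embeddings_iff[OF K.complex_subring_axioms] by blast
  have "\<sigma> x = 0 \<longleftrightarrow> x = 0" if "x \<in> ?K" for x
    using S.hom_nonzero[OF K.complex_subfield_axioms that] by auto
  then have "absolute_value_on ?K (restrict (\<lambda>x. cmod (\<sigma> x)) ?K)"
    unfolding absolute_value_on_def by (auto simp: S.hom_mult S.hom_add norm_mult norm_triangle_ineq)
  moreover have "restrict (\<lambda>x. cmod (\<sigma> x)) ?K (of_rat q) = \<bar>of_rat q\<bar>" for q
  proof -
    have "of_rat q \<in> ?K" by (rule subsetD[OF K.Rats_subset Rats_of_rat])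
    then show ?thesis using S.hom_rat[OF Rats_of_rat] by (simp add: cmod_of_rat)
  qed
  ultimately show ?thesis unfolding places_def by blast
qed

lemma large_place_is_embedding:
  assumes f: "Rats.minpoly f \<theta>" and int: "algebraic_int \<theta>"
    and v: "v \<in> places (Rats.adj \<theta>)" "v \<theta> > 1"
  shows "\<exists>\<sigma>\<in>field_embeddings (Rats.adj \<theta>). v = restrict (\<lambda>x. cmod (\<sigma> x)) (Rats.adj \<theta>)"
proof -
  let ?K = "Rats.adj \<theta>"
  interpret K: complex_subfield ?K using integral_gen[OF f] by (rule Rats.adj_subfield)
  have V: "absolute_value ?K v"
    using v(1) by unfold_locales (simp add: places_def)
  interpret V: absolute_value ?K v by fact
  show ?thesis
  proof (cases "\<forall>q. v (of_rat q) = \<bar>of_rat q\<bar>")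
    case True
    obtain \<sigma>s where s: "set \<sigma>s = field_embeddings ?K" "distinct \<sigma>s"
      using finite_distinct_list card_field_embeddings(2)[OF f] by blast
    interpret E: embedded_number_field ?K \<theta> f \<sigma>s "length \<sigma>s"
      using f int s by unfold_locales auto
    obtain i where i: "i < length \<sigma>s" "\<forall>x\<in>?K. v x = cmod ((\<sigma>s ! i) x)"
      using E.archimedean_place[OF V] True by blast
    have "v = restrict (\<lambda>x. cmod ((\<sigma>s ! i) x)) ?K"
      by (rule extensionalityI[OF V.extensional]) (use i(2) in auto)
    moreover have "\<sigma>s ! i \<in> field_embeddings ?K" using i(1) s(1) nth_mem by blast
    ultimately show ?thesis by blast
  next
    case False
    then obtain p where p: "Factorial_Ring.prime p" "\<forall>q. v (of_rat q) = padic_abs p q"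
      using v(1) by (auto simp: places_def)
    have "v (of_int k) \<le> 1" for k
      using p(2)[rule_format, of "of_int k"] padic_abs_of_int_le_1[OF p(1), of k] by simp
    then have "v \<theta> \<le> 1" by (intro integral_bound[OF V Rats.gen_in_adj int])
    then show ?thesis using v(2) by simp
  qed
qed

text \<open>
  The places that contribute to the height are the \<open>\<bar>\<sigma>\<bar>\<close> with \<open>\<bar>\<sigma> \<alpha>\<bar> > 1\<close>; in particular they are
  finite in number. Grouping the embeddings by their places, each group has at most as many members
  as the local degree.
\<close>

lemma weil_height_ge:
  assumes int: "algebraic_int \<alpha>" and g: "Rats.minpoly g \<alpha>"
  shows "(\<Prod>y | poly g y = 0. max 1 (cmod y)) \<le> weil_height \<alpha> ^ degree g" "weil_height \<alpha> \<ge> 0"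
proof -
  let ?K = "Rats.adj \<alpha>"
  define n where "n = degree g"
  have npos: "n > 0" using Rats.minpolyD(5)[OF g] by (simp add: n_def)
  interpret K: complex_subfield ?K using integral_gen[OF g] by (rule Rats.adj_subfield)
  have \<alpha>K: "\<alpha> \<in> ?K" by (rule Rats.gen_in_adj)
  define V where "V = (\<lambda>\<sigma>. restrict (\<lambda>x. cmod (\<sigma> x)) ?K)"
  have V\<alpha>: "V \<sigma> \<alpha> = cmod (\<sigma> \<alpha>)" for \<sigma> using \<alpha>K by (simp add: V_def)
  define \<Sigma> where "\<Sigma> = {\<sigma> \<in> field_embeddings ?K. cmod (\<sigma> \<alpha>) > 1}"
  have fin: "finite (field_embeddings ?K)" by (rule card_field_embeddings(2)[OF g])
  then have fin\<Sigma>: "finite \<Sigma>" by (simp add: \<Sigma>_def)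
  have P: "{v \<in> places ?K. max 1 (v \<alpha>) \<noteq> 1} = V ` \<Sigma>"
  proof safe
    fix v assume v: "v \<in> places ?K" "max 1 (v \<alpha>) \<noteq> 1"
    then have "v \<alpha> > 1" by (simp add: max_def split: if_splits)
    then obtain \<sigma> where "\<sigma> \<in> field_embeddings ?K" "v = V \<sigma>"
      using large_place_is_embedding[OF g int v(1)] unfolding V_def by blast
    then show "v \<in> V ` \<Sigma>" using \<open>v \<alpha> > 1\<close> V\<alpha> by (auto simp: \<Sigma>_def)
  next
    fix \<sigma> assume s: "\<sigma> \<in> \<Sigma>"
    then show "V \<sigma> \<in> places ?K" using embedding_place[OF g] by (simp add: V_def \<Sigma>_def)
    assume "max 1 (V \<sigma> \<alpha>) = 1"
    then show False using s by (simp add: \<Sigma>_def V\<alpha> max_def split: if_splits)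
  qed
  have deg: "ext_degree ?K = n" unfolding n_def by (rule ext_degree_adj[OF g])
  have "algebraic \<alpha>" using int by blast
  then have H: "weil_height \<alpha> = (\<Prod>v\<in>V ` \<Sigma>. max 1 (v \<alpha>) powr (real (local_degree ?K v) / real n))"
    unfolding weil_height_def weil_height_in_def by (simp only: generate_field_singleton P deg)
  then show "weil_height \<alpha> \<ge> 0" by (auto intro!: prod_nonneg)
  have "(\<Prod>y | poly g y = 0. max 1 (cmod y)) = (\<Prod>\<sigma>\<in>field_embeddings ?K. max 1 (cmod (\<sigma> \<alpha>)))"
    using prod.reindex_bij_betw[OF field_embeddings_adj[OF g], of "\<lambda>y. max 1 (cmod y)"] by simp
  also have "\<dots> = (\<Prod>\<sigma>\<in>\<Sigma>. cmod (\<sigma> \<alpha>))"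
    using fin by (intro prod.mono_neutral_cong_right) (auto simp: \<Sigma>_def max_def)
  also have "\<dots> = (\<Prod>v\<in>V ` \<Sigma>. \<Prod>\<sigma> | \<sigma> \<in> \<Sigma> \<and> V \<sigma> = v. cmod (\<sigma> \<alpha>))"
    using fin\<Sigma> by (intro prod.group[symmetric]) auto
  also have "\<dots> = (\<Prod>v\<in>V ` \<Sigma>. v \<alpha> ^ card {\<sigma> \<in> \<Sigma>. V \<sigma> = v})"
  proof (rule prod.cong)
    fix v assume "v \<in> V ` \<Sigma>"
    have "(\<Prod>\<sigma> | \<sigma> \<in> \<Sigma> \<and> V \<sigma> = v. cmod (\<sigma> \<alpha>)) = (\<Prod>\<sigma> | \<sigma> \<in> \<Sigma> \<and> V \<sigma> = v. v \<alpha>)"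
      by (intro prod.cong) (auto simp: V\<alpha>)
    then show "(\<Prod>\<sigma> | \<sigma> \<in> \<Sigma> \<and> V \<sigma> = v. cmod (\<sigma> \<alpha>)) = v \<alpha> ^ card {\<sigma> \<in> \<Sigma>. V \<sigma> = v}" by simp
  qed simp
  also have "\<dots> \<le> (\<Prod>v\<in>V ` \<Sigma>. (max 1 (v \<alpha>) powr (real (local_degree ?K v) / real n)) ^ n)"
  proof (rule prod_mono, rule conjI)
    fix v assume "v \<in> V ` \<Sigma>"
    then obtain \<sigma> where s: "\<sigma> \<in> \<Sigma>" "v = V \<sigma>" by blast
    have v1: "v \<alpha> > 1" using s by (simp add: \<Sigma>_def V\<alpha>)
    then show "0 \<le> v \<alpha> ^ card {\<sigma> \<in> \<Sigma>. V \<sigma> = v}" by simp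
    have "card {\<sigma>' \<in> \<Sigma>. V \<sigma>' = v} \<le> card {\<sigma>' \<in> field_embeddings ?K. V \<sigma>' = v}"
      using fin by (intro card_mono) (auto simp: \<Sigma>_def)
    also have "\<dots> \<le> local_degree ?K v"
      using card_embedding_fiber[OF g, of \<sigma>] s unfolding \<Sigma>_def V_def by blast
    finally have "v \<alpha> ^ card {\<sigma>' \<in> \<Sigma>. V \<sigma>' = v} \<le> v \<alpha> ^ local_degree ?K v"
      using v1 by (intro power_increasing) auto
    also have "\<dots> = (v \<alpha> powr (real (local_degree ?K v) / real n)) ^ n"
      using v1 npos by (simp add: powr_realpow[symmetric] powr_powr)
    finally show "v \<alpha> ^ card {\<sigma>' \<in> \<Sigma>. V \<sigma>' = v} \<le> (max 1 (v \<alpha>) powr (real (local_degree ?K v) / real n)) ^ n"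
      using v1 by (simp add: max_def)
  qed
  also have "\<dots> = weil_height \<alpha> ^ degree g" by (simp add: H n_def prod_power_distrib)
  finally show "(\<Prod>y | poly g y = 0. max 1 (cmod y)) \<le> weil_height \<alpha> ^ degree g" .
qed

section \<open>Linear disjointness and extension of embeddings\<close>

text \<open>
  The linear extension of a function on tuples to the free vector space. Multilinear functions
  vanish on the tensor relations, so they are functions on the tensor product.
\<close>

definition tensor_functional :: "(('i \<Rightarrow> complex) \<Rightarrow> complex) \<Rightarrow> (('i \<Rightarrow> complex) \<Rightarrow>\<^sub>0 rat) \<Rightarrow> complex" where
  "tensor_functional \<phi> x = (\<Sum>t\<in>Poly_Mapping.keys x. of_rat (Poly_Mapping.lookup x t) * \<phi> t)"

lemma tensor_functional_superset:
  assumes "finite A" "Poly_Mapping.keys x \<subseteq> A"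
  shows "tensor_functional \<phi> x = (\<Sum>t\<in>A. of_rat (Poly_Mapping.lookup x t) * \<phi> t)"
  unfolding tensor_functional_def using assms
  by (intro sum.mono_neutral_left) (auto simp: in_keys_iff)

lemma tensor_functional_add:
  "tensor_functional \<phi> (x + y) = tensor_functional \<phi> x + tensor_functional \<phi> y"
proof -
  let ?A = "Poly_Mapping.keys x \<union> Poly_Mapping.keys y"
  have "Poly_Mapping.keys (x + y) \<subseteq> ?A" by (rule Poly_Mapping.keys_add)
  then show ?thesis
    by (subst (1 2 3) tensor_functional_superset[of ?A])
       (auto simp: Poly_Mapping.lookup_add of_rat_add distrib_right sum.distrib)
qed

lemma tensor_functional_scale:
  "tensor_functional \<phi> (tensor_scale c x) = of_rat c * tensor_functional \<phi> x"
proof -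
  have "Poly_Mapping.keys (tensor_scale c x) \<subseteq> Poly_Mapping.keys x"
    by (auto simp: in_keys_iff)
  then show ?thesis
    by (subst (1 2) tensor_functional_superset[of "Poly_Mapping.keys x"])
       (auto simp: of_rat_mult sum_distrib_left mult.assoc)
qed

lemma tensor_scale_minus_one: "tensor_scale (- 1) x = - x"
  by (rule poly_mapping_eqI) simp

lemma tensor_functional_uminus: "tensor_functional \<phi> (- x) = - tensor_functional \<phi> x"
  using tensor_functional_scale[of \<phi> "- 1" x] by (simp add: tensor_scale_minus_one of_rat_minus)

lemma tensor_functional_diff:
  "tensor_functional \<phi> (x - y) = tensor_functional \<phi> x - tensor_functional \<phi> y"
  using tensor_functional_add[of \<phi> x "- y"] by (simp add: tensor_functional_uminus)

lemma tensor_functional_single: "tensor_functional \<phi> (Poly_Mapping.single t 1) = \<phi> t"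
  by (simp add: tensor_functional_def)

lemma tensor_functional_relations:
  assumes multilinear: "\<And>t i a b x y. t \<in> PiE I F \<Longrightarrow> i \<in> I \<Longrightarrow> x \<in> F i \<Longrightarrow> y \<in> F i \<Longrightarrow>
      \<phi> (t(i := of_rat a * x + of_rat b * y)) = of_rat a * \<phi> (t(i := x)) + of_rat b * \<phi> (t(i := y))"
    and z: "z \<in> tensor_relations I F"
  shows "tensor_functional \<phi> z = 0"
proof -
  interpret T: vector_space tensor_scale by (rule vector_space_tensor_scale)
  have "T.subspace {x. tensor_functional \<phi> x = 0}"
    unfolding T.subspace_def
    by (auto simp: tensor_functional_add tensor_functional_scale) (simp add: tensor_functional_def)
  then have "tensor_relations I F \<subseteq> {x. tensor_functional \<phi> x = 0}"
    unfolding tensor_relations_def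
  proof (intro T.span_minimal subsetI CollectI)
    fix w assume "w \<in> {Poly_Mapping.single (t(i := of_rat a * x + of_rat b * y)) 1
        - tensor_scale a (Poly_Mapping.single (t(i := x)) 1)
        - tensor_scale b (Poly_Mapping.single (t(i := y)) 1)
      | t i a b x y. t \<in> PiE I F \<and> i \<in> I \<and> x \<in> F i \<and> y \<in> F i}"
    then obtain t i a b x y where w: "w = Poly_Mapping.single (t(i := of_rat a * x + of_rat b * y)) 1
        - tensor_scale a (Poly_Mapping.single (t(i := x)) 1)
        - tensor_scale b (Poly_Mapping.single (t(i := y)) 1)"
      and t: "t \<in> PiE I F" "i \<in> I" "x \<in> F i" "y \<in> F i"
      by blast
    show "tensor_functional \<phi> w = 0"
      unfolding w using multilinear[OF t]
      by (simp add: tensor_functional_diff tensor_functional_scale tensor_functional_single)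
  qed
  then show ?thesis using z by blast
qed

text \<open>
  The graph of the map that sends \<open>\<Prod>\<^sub>i t\<^sub>i\<close> to \<open>\<sigma> t\<^sub>m \<cdot> \<Prod>\<^sub>i\<^sub>\<noteq>\<^sub>m t\<^sub>i\<close>, extended additively. That it is a
  ring homomorphism is evident on the graph; that it is well defined is the content of linear
  disjointness.
\<close>

inductive_set twisted_graph ::
  "'i set \<Rightarrow> ('i \<Rightarrow> complex set) \<Rightarrow> 'i \<Rightarrow> (complex \<Rightarrow> complex) \<Rightarrow> (complex \<times> complex) set"
  for I F m \<sigma> where
    tuple: "t \<in> PiE I F \<Longrightarrow> (\<Prod>i\<in>I. t i, \<sigma> (t m) * (\<Prod>i\<in>I - {m}. t i)) \<in> twisted_graph I F m \<sigma>"
  | add: "(a, b) \<in> twisted_graph I F m \<sigma> \<Longrightarrow> (a', b') \<in> twisted_graph I F m \<sigma> \<Longrightarrow>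
      (a + a', b + b') \<in> twisted_graph I F m \<sigma>"
  | uminus: "(a, b) \<in> twisted_graph I F m \<sigma> \<Longrightarrow> (- a, - b) \<in> twisted_graph I F m \<sigma>"

locale twisted_compositum =
  fixes I :: "'i set" and F :: "'i \<Rightarrow> complex set" and m :: 'i and \<sigma> :: "complex \<Rightarrow> complex"
  assumes fin: "finite I" and m: "m \<in> I"
    and fields: "\<And>i. i \<in> I \<Longrightarrow> complex_subfield (F i)"
    and hom: "complex_hom (F m) \<sigma>"
    and disjoint: "linearly_disjoint_finite I F"
begin

abbreviation "G \<equiv> twisted_graph I F m \<sigma>"

lemma graph_tensor:
  assumes "(a, b) \<in> G"
  shows "\<exists>x\<in>tensor_free I F. tensor_eval I x = a \<and>
    tensor_functional (\<lambda>t. \<sigma> (t m) * (\<Prod>i\<in>I - {m}. t i)) x = b"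
  using assms
proof (induction rule: twisted_graph.induct)
  case (tuple t)
  then show ?case
    by (intro bexI[of _ "Poly_Mapping.single t 1"])
       (simp_all add: tensor_free_def tensor_functional_single tensor_eval_def)
next
  case (add a b a' b')
  then obtain x y where xy: "x \<in> tensor_free I F" "y \<in> tensor_free I F"
    "tensor_eval I x = a" "tensor_eval I y = a'"
    "tensor_functional (\<lambda>t. \<sigma> (t m) * (\<Prod>i\<in>I - {m}. t i)) x = b"
    "tensor_functional (\<lambda>t. \<sigma> (t m) * (\<Prod>i\<in>I - {m}. t i)) y = b'" by blast
  have "x + y \<in> tensor_free I F"
    using xy(1,2) Poly_Mapping.keys_add[of x y] unfolding tensor_free_def by blast
  moreover have "tensor_eval I z = tensor_functional (\<lambda>t. \<Prod>i\<in>I. t i) z" for z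
    by (simp add: tensor_eval_def tensor_functional_def)
  ultimately show ?case
    using xy by (intro bexI[of _ "x + y"]) (simp_all add: tensor_functional_add)
next
  case (uminus a b)
  then obtain x where x: "x \<in> tensor_free I F" "tensor_eval I x = a"
    "tensor_functional (\<lambda>t. \<sigma> (t m) * (\<Prod>i\<in>I - {m}. t i)) x = b" by blast
  have "- x \<in> tensor_free I F"
    using x(1) unfolding tensor_free_def by (auto simp: in_keys_iff subset_iff)
  moreover have "tensor_eval I z = tensor_functional (\<lambda>t. \<Prod>i\<in>I. t i) z" for z
    by (simp add: tensor_eval_def tensor_functional_def)
  ultimately show ?case
    using x by (intro bexI[of _ "- x"]) (simp_all add: tensor_functional_uminus)
qed

text \<open>
  The second component is a multilinear function of the tensor whose evaluation is the first
  component, and by disjointness equal evaluations come from equal tensors.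
\<close>

lemma graph_single_valued:
  assumes "(a, b) \<in> G" "(a, b') \<in> G"
  shows "b = b'"
proof -
  let ?\<phi> = "\<lambda>t. \<sigma> (t m) * (\<Prod>i\<in>I - {m}. t i)"
  interpret S: complex_hom "F m" \<sigma> by (rule hom)
  interpret Fm: complex_subfield "F m" using fields[OF m] .
  obtain x where x: "x \<in> tensor_free I F" "tensor_eval I x = a" "tensor_functional ?\<phi> x = b"
    using graph_tensor[OF assms(1)] by blast
  obtain y where y: "y \<in> tensor_free I F" "tensor_eval I y = a" "tensor_functional ?\<phi> y = b'"
    using graph_tensor[OF assms(2)] by blast
  have "tensor_eval I x = tensor_eval I y" by (simp only: x(2) y(2))
  then have "x - y \<in> tensor_relations I F"
    using disjoint x(1) y(1) unfolding linearly_disjoint_finite_def by blast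
  then have "tensor_functional ?\<phi> (x - y) = 0"
  proof (rule tensor_functional_relations[rotated])
    fix t i a b x y assume t: "t \<in> PiE I F" "i \<in> I" "x \<in> F i" "y \<in> F i"
    show "?\<phi> (t(i := of_rat a * x + of_rat b * y)) = of_rat a * ?\<phi> (t(i := x)) + of_rat b * ?\<phi> (t(i := y))"
    proof (cases "i = m")
      case True
      have "of_rat q \<in> F m" for q using Fm.Rats_subset by auto
      moreover have "(\<Prod>j\<in>I - {m}. if j = m then u else t j) = (\<Prod>j\<in>I - {m}. t j)" for u
        by (intro prod.cong) auto
      ultimately show ?thesis
        using True t by (simp add: S.hom_add S.hom_mult S.hom_rat fun_upd_def algebra_simps)
    next
      case False
      have "(\<Prod>j\<in>I - {m}. (t(i := u)) j) = u * (\<Prod>j\<in>I - {m} - {i}. t j)" for u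
      proof -
        have "(\<Prod>j\<in>I - {m}. (t(i := u)) j) = (t(i := u)) i * (\<Prod>j\<in>I - {m} - {i}. (t(i := u)) j)"
          using fin t(2) False by (intro prod.remove) auto
        also have "(\<Prod>j\<in>I - {m} - {i}. (t(i := u)) j) = (\<Prod>j\<in>I - {m} - {i}. t j)"
          by (intro prod.cong) auto
        finally show ?thesis by simp
      qed
      then show ?thesis using False by (simp add: algebra_simps)
    qed
  qed
  then show ?thesis using x(3) y(3) by (simp add: tensor_functional_diff)
qed

lemma graph_mult:
  assumes "(a, b) \<in> G" "(a', b') \<in> G"
  shows "(a * a', b * b') \<in> G"
  using assms(1)
proof (induction rule: twisted_graph.induct)
  case (tuple t)
  note t = this
  interpret S: complex_hom "F m" \<sigma> by (rule hom)
  show ?case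
    using assms(2)
  proof (induction rule: twisted_graph.induct)
    case (tuple u)
    let ?w = "\<lambda>i\<in>I. t i * u i"
    have "?w \<in> PiE I F"
    proof
      fix i assume i: "i \<in> I"
      interpret Fi: complex_subfield "F i" using fields[OF i] .
      show "?w i \<in> F i" using t tuple i by (auto simp: PiE_iff)
    qed auto
    then have "(\<Prod>i\<in>I. ?w i, \<sigma> (?w m) * (\<Prod>i\<in>I - {m}. ?w i)) \<in> G" by (rule twisted_graph.tuple)
    moreover have "(\<Prod>i\<in>I. ?w i) = (\<Prod>i\<in>I. t i) * (\<Prod>i\<in>I. u i)"
      by (simp add: prod.distrib)
    moreover have "(\<Prod>i\<in>I - {m}. ?w i) = (\<Prod>i\<in>I - {m}. t i) * (\<Prod>i\<in>I - {m}. u i)"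
      by (simp add: prod.distrib)
    moreover have "\<sigma> (?w m) = \<sigma> (t m) * \<sigma> (u m)"
      using t tuple m by (simp add: PiE_iff S.hom_mult)
    ultimately show ?case by (simp only: mult_ac)
  next
    case (add a b a' b')
    then show ?case by (simp add: distrib_left twisted_graph.add)
  next
    case (uminus a b)
    then show ?case by (simp add: twisted_graph.uminus)
  qed
next
  case (add a b a' b')
  then show ?case by (simp add: distrib_right twisted_graph.add)
next
  case (uminus a b)
  then show ?case by (simp add: twisted_graph.uminus)
qed

lemma graph_component:
  assumes i: "i \<in> I" and x: "x \<in> F i"
  shows "(x, if i = m then \<sigma> x else x) \<in> G"
proof -
  interpret S: complex_hom "F m" \<sigma> by (rule hom)
  let ?t = "\<lambda>j\<in>I. if j = i then x else 1"
  have "?t \<in> PiE I F"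
  proof
    fix j assume j: "j \<in> I"
    interpret Fj: complex_subfield "F j" using fields[OF j] .
    show "?t j \<in> F j" using x j by auto
  qed auto
  then have G: "(\<Prod>j\<in>I. ?t j, \<sigma> (?t m) * (\<Prod>j\<in>I - {m}. ?t j)) \<in> G" by (rule twisted_graph.tuple)
  have "(\<Prod>j\<in>I. ?t j) = (\<Prod>j\<in>I. if j = i then x else 1)" by (intro prod.cong) auto
  also have "\<dots> = x" using fin i by simp
  finally have 1: "(\<Prod>j\<in>I. ?t j) = x" .
  have "(\<Prod>j\<in>I - {m}. ?t j) = (\<Prod>j\<in>I - {m}. if j = i then x else 1)" by (intro prod.cong) auto
  also have "\<dots> = (if i = m then 1 else x)" using fin i by simp
  finally have "\<sigma> (?t m) * (\<Prod>j\<in>I - {m}. ?t j) = (if i = m then \<sigma> x else x)"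
    using m by simp
  then show ?thesis using G 1 by simp
qed

lemma graph_one: "(1, 1) \<in> G"
proof -
  interpret S: complex_hom "F m" \<sigma> by (rule hom)
  show ?thesis using graph_component[OF m S.one_mem] by simp
qed

lemma graph_base:
  assumes "a \<in> generate_ring CC (\<Union>i\<in>I - {m}. F i)"
  shows "(a, a) \<in> G"
  using assms
proof (induction rule: generate_ring.induct)
  case one
  then show ?case using graph_one by simp
next
  case (incl h)
  then obtain i where "i \<in> I" "i \<noteq> m" "h \<in> F i" by blast
  then show ?case using graph_component[of i h] by simp
next
  case (a_inv h)
  then show ?case by (simp add: twisted_graph.uminus)
next
  case (eng_add h1 h2)
  then show ?case by (simp add: twisted_graph.add)
next
  case (eng_mult h1 h2)
  then show ?case by (simp add: graph_mult)
qed

lemma graph_total: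
  assumes "a \<in> generate_ring CC (\<Union>i\<in>I. F i)"
  shows "\<exists>b. (a, b) \<in> G"
  using assms
proof (induction rule: generate_ring.induct)
  case one
  then show ?case using graph_one by auto
next
  case (incl h)
  then show ?case using graph_component by blast
next
  case (a_inv h)
  then show ?case using twisted_graph.uminus by fastforce
next
  case (eng_add h1 h2)
  then show ?case using twisted_graph.add by fastforce
next
  case (eng_mult h1 h2)
  then show ?case using graph_mult by fastforce
qed

lemma extension_exists:
  "\<exists>h. complex_hom (generate_ring CC (\<Union>i\<in>I. F i)) h \<and>
    (\<forall>a\<in>generate_ring CC (\<Union>i\<in>I - {m}. F i). h a = a) \<and> (\<forall>x\<in>F m. h x = \<sigma> x)"
proof -
  let ?W = "generate_ring CC (\<Union>i\<in>I. F i)"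
  have "subring ?W CC" by (rule CC.generate_ring_is_subring) simp
  then interpret W: complex_subring ?W by (simp add: subring_CC_iff)
  define h where "h a = (THE b. (a, b) \<in> G)" for a
  have h: "h a = b" if "(a, b) \<in> G" for a b
    unfolding h_def using that graph_single_valued by blast
  have hW: "(a, h a) \<in> G" if "a \<in> ?W" for a
    using graph_total[OF that] h by auto
  have "complex_hom ?W h"
    by unfold_locales (auto intro!: h graph_one twisted_graph.add graph_mult hW)
  moreover have "h a = a" if "a \<in> generate_ring CC (\<Union>i\<in>I - {m}. F i)" for a
    by (rule h[OF graph_base[OF that]])
  moreover have "h x = \<sigma> x" if "x \<in> F m" for x
    using h[OF graph_component[OF m that]] by simp
  ultimately show ?thesis by blast
qed

end

section \<open>The height inequality\<close>

lemma integral_basis_coordinates: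
  assumes "integral_basis K bs"
  shows "set bs \<subseteq> ring_of_integers K"
    and "y \<in> ring_of_integers K \<Longrightarrow> \<exists>c::nat \<Rightarrow> int. y = (\<Sum>j<length bs. of_int (c j) * bs ! j)"
proof -
  interpret Modules.module "\<lambda>(k::int) x::complex. of_int k * x"
    by unfold_locales (auto simp: algebra_simps)
  have span: "span (set bs) = ring_of_integers K" and dist: "distinct bs"
    using assms by (auto simp: integral_basis_def)
  then show "set bs \<subseteq> ring_of_integers K" using span_superset by blast
  assume "y \<in> ring_of_integers K"
  then obtain u :: "complex \<Rightarrow> int" where "y = (\<Sum>v\<in>set bs. of_int (u v) * v)"
    using span span_finite[of "set bs"] by auto
  also have "\<dots> = (\<Sum>j<length bs. of_int (u (bs ! j)) * bs ! j)"
    using dist by (intro sum.reindex_bij_betw[symmetric, of "\<lambda>j. bs ! j"]) (auto simp: bij_betw_nth)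
  finally show "\<exists>c::nat \<Rightarrow> int. y = (\<Sum>j<length bs. of_int (c j) * bs ! j)"
    by (intro exI[of _ "\<lambda>j. u (bs ! j)"])
qed

text \<open>
  Closed under multiplication because the products of the basis elements are integers of \<open>K\<close>, hence
  again integral combinations of the basis.
\<close>

lemma basis_combinations_subring:
  assumes S: "complex_subring S" and K: "complex_subring K" and bs: "integral_basis K bs"
  shows "complex_subring {\<Sum>j<length bs. a j * bs ! j |a. \<forall>j. a j \<in> S}"
    and "S \<subseteq> {\<Sum>j<length bs. a j * bs ! j |a. \<forall>j. a j \<in> S}"
    and "ring_of_integers K \<subseteq> {\<Sum>j<length bs. a j * bs ! j |a. \<forall>j. a j \<in> S}"
proof -
  interpret S: complex_subring S by fact
  interpret K: complex_subring K by fact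
  let ?n = "length bs"
  let ?N = "{\<Sum>j<length bs. a j * bs ! j |a. \<forall>j. a j \<in> S}"
  have O: "y \<in> ?N" if y: "y \<in> ring_of_integers K" for y
  proof -
    obtain c :: "nat \<Rightarrow> int" where "y = (\<Sum>j<?n. of_int (c j) * bs ! j)"
      using integral_basis_coordinates(2)[OF bs y] by blast
    then show ?thesis by (intro CollectI exI[of _ "\<lambda>j. of_int (c j)"]) auto
  qed
  then show "ring_of_integers K \<subseteq> ?N" by blast
  have add: "x + y \<in> ?N" if xy: "x \<in> ?N" "y \<in> ?N" for x y
  proof -
    obtain a b where "x = (\<Sum>j<?n. a j * bs ! j)" "y = (\<Sum>j<?n. b j * bs ! j)" "\<forall>j. a j \<in> S" "\<forall>j. b j \<in> S"
      using xy by blast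
    then show ?thesis
      by (intro CollectI exI[of _ "\<lambda>j. a j + b j"]) (auto simp: sum.distrib distrib_right)
  qed
  have scale: "s * y \<in> ?N" if s: "s \<in> S" and y: "y \<in> ?N" for s y
  proof -
    obtain b where "y = (\<Sum>j<?n. b j * bs ! j)" "\<forall>j. b j \<in> S" using y by blast
    then show ?thesis using s
      by (intro CollectI exI[of _ "\<lambda>j. s * b j"]) (auto simp: sum_distrib_left mult.assoc)
  qed
  have sum: "sum f A \<in> ?N" if "finite A" "\<And>i. i \<in> A \<Longrightarrow> f i \<in> ?N" for f and A :: "nat set"
    using that
  proof (induction A rule: finite_induct)
    case empty
    have "(0::complex) = (\<Sum>j<?n. 0 * bs ! j)" by simp
    then show ?case by (simp only: sum.empty) (intro CollectI exI[of _ "\<lambda>_. 0"], simp)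
  next
    case (insert i A)
    have "f i + sum f A \<in> ?N" by (intro add insert.prems insert.IH) auto
    then show ?case by (simp only: sum.insert[OF insert.hyps])
  qed
  have one: "1 \<in> ?N" by (rule O) (simp add: ring_of_integers_def)
  show "S \<subseteq> ?N"
  proof
    fix s assume "s \<in> S"
    from scale[OF this one] show "s \<in> ?N" by (simp only: mult_1_right)
  qed
  have bO: "bs ! j \<in> ring_of_integers K" if "j < ?n" for j
    using integral_basis_coordinates(1)[OF bs] that nth_mem by blast
  show "complex_subring ?N"
  proof
    show "1 \<in> ?N" by (rule one)
    show "x + y \<in> ?N" if "x \<in> ?N" "y \<in> ?N" for x y using add that .
    show "- x \<in> ?N" if "x \<in> ?N" for x
    proof -
      have "(- 1) * x \<in> ?N" by (rule scale[OF _ that]) simp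
      then show ?thesis by (simp only: mult_minus1)
    qed
    show "x * y \<in> ?N" if xy: "x \<in> ?N" "y \<in> ?N" for x y
    proof -
      obtain a b where ab: "x = (\<Sum>j<?n. a j * bs ! j)" "y = (\<Sum>j<?n. b j * bs ! j)"
        "\<forall>j. a j \<in> S" "\<forall>j. b j \<in> S" using xy by blast
      have "x * y = (\<Sum>j<?n. \<Sum>k<?n. (a j * b k) * (bs ! j * bs ! k))"
        unfolding ab by (simp add: sum_product mult_ac)
      also have "\<dots> \<in> ?N"
      proof (rule sum[OF finite_lessThan], rule sum[OF finite_lessThan], rule scale)
        fix j k assume "j \<in> {..<?n}" "k \<in> {..<?n}"
        then have "bs ! j \<in> ring_of_integers K" "bs ! k \<in> ring_of_integers K" using bO by auto
        then have "bs ! j * bs ! k \<in> ring_of_integers K"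
          unfolding ring_of_integers_def using Alg_ints.mult_mem by auto
        then show "bs ! j * bs ! k \<in> ?N" by (rule O)
        show "a j * b k \<in> S" using ab by simp
      qed
      finally show ?thesis .
    qed
  qed
qed

lemma norm_det_le:
  fixes A :: "complex mat"
  assumes A: "A \<in> carrier_mat n n" and b: "\<And>i j. i < n \<Longrightarrow> j < n \<Longrightarrow> cmod (A $$ (i, j)) \<le> b i"
  shows "cmod (Determinant.det A) \<le> fact n * (\<Prod>i<n. b i)"
proof -
  let ?P = "{p. p permutes {0..<n}}"
  have "cmod (Determinant.det A) \<le> (\<Sum>p\<in>?P. cmod (signof p * (\<Prod>i = 0..<n. A $$ (i, p i))))"
    unfolding det_def'[OF A] by (rule norm_sum)
  also have "\<dots> \<le> (\<Sum>p\<in>?P. \<Prod>i<n. b i)"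
  proof (rule sum_mono)
    fix p assume p: "p \<in> ?P"
    have "cmod (signof p * (\<Prod>i = 0..<n. A $$ (i, p i))) = (\<Prod>i<n. cmod (A $$ (i, p i)))"
      by (simp add: norm_mult sign_def prod_norm atLeast0LessThan)
    also have "\<dots> \<le> (\<Prod>i<n. b i)"
      using b p permutes_in_image[of p "{0..<n}"] by (intro prod_mono) auto
    finally show "cmod (signof p * (\<Prod>i = 0..<n. A $$ (i, p i))) \<le> (\<Prod>i<n. b i)" .
  qed
  also have "\<dots> = fact n * (\<Prod>i<n. b i)"
    using card_permutations[of "{0..<n}" n] by simp
  finally show ?thesis .
qed

lemma norm_det_vandermonde_le:
  fixes a :: "nat \<Rightarrow> complex"
  shows "cmod (Determinant.det (mat n n (\<lambda>(i, j). a i ^ j))) \<le> fact n * (\<Prod>i<n. max 1 (cmod (a i))) ^ (n - 1)"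
proof -
  have "cmod (Determinant.det (mat n n (\<lambda>(i, j). a i ^ j))) \<le> fact n * (\<Prod>i<n. max 1 (cmod (a i)) ^ (n - 1))"
  proof (rule norm_det_le)
    fix i j assume ij: "i < n" "j < n"
    have "cmod (a i) ^ j \<le> max 1 (cmod (a i)) ^ j" by (intro power_mono) auto
    also have "\<dots> \<le> max 1 (cmod (a i)) ^ (n - 1)" using ij by (intro power_increasing) auto
    finally show "cmod (mat n n (\<lambda>(i, j). a i ^ j) $$ (i, j)) \<le> max 1 (cmod (a i)) ^ (n - 1)"
      using ij by (simp add: norm_power)
  qed simp
  then show ?thesis by (simp add: prod_power_distrib)
qed

context embedded_number_field
begin

text \<open>
  The arithmetic core. The hypotheses record what is known about the images \<open>a i\<close> of \<open>\<alpha>\<close> under the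
  extended embeddings: they are distinct conjugates of \<open>\<alpha>\<close>, and their powers are combinations of the
  conjugates of the basis with coefficients \<open>B\<close> that do not depend on \<open>i\<close>.
\<close>

lemma height_bound:
  assumes bs: "set bs \<subseteq> ring_of_integers K" "length bs = n" and n: "n > 0"
    and \<alpha>: "algebraic_int \<alpha>"
    and conj: "\<And>i p. i < n \<Longrightarrow> p \<in> Rats.polys \<Longrightarrow> poly p \<alpha> = 0 \<Longrightarrow> poly p (a i) = 0"
    and inj: "inj_on a {..<n}"
    and B: "\<And>k j. k < n \<Longrightarrow> j < n \<Longrightarrow> algebraic_int (B k j)"
    and pow: "\<And>i k. i < n \<Longrightarrow> k < n \<Longrightarrow> a i ^ k = (\<Sum>j<n. B k j * (\<sigma>s ! i) (bs ! j))"
  shows "cmod (D (\<lambda>j. bs ! j)) \<le> fact n * weil_height \<alpha> ^ (n * (n - 1))"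
proof -
  let ?V = "mat n n (\<lambda>(i, k). a i ^ k)" and ?S = "mat n n (\<lambda>(i, j). (\<sigma>s ! i) (bs ! j))"
  let ?B = "mat n n (\<lambda>(j, k). B k j)"
  define S where "S = D (\<lambda>j. bs ! j)"
  define \<beta> where "\<beta> = Determinant.det ?B"
  have "?V = ?S * ?B"
    using pow by (intro eq_matI) (auto simp: scalar_prod_def atLeast0LessThan mult.commute)
  then have V: "Determinant.det ?V = S * \<beta>"
    using det_mult[of ?S n ?B] by (simp add: S_def D_def \<beta>_def)
  have \<beta>int: "algebraic_int \<beta>"
    using Alg_ints.det_mem[of ?B n] B by (simp add: \<beta>_def)
  have \<beta>0: "\<beta> \<noteq> 0" using det_vandermonde_nonzero[OF inj] V by auto
  have alg\<alpha>: "algebraic \<alpha>" using \<alpha> by blast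
  then obtain g where g: "Rats.minpoly g \<alpha>" using Rats.minpoly_exists algebraic_iff_integral by blast
  have alga: "algebraic (a i)" if "i < n" for i
  proof -
    have "poly g (a i) = 0" using conj[OF that] Rats.minpolyD[OF g] by blast
    then show ?thesis
      unfolding algebraic_iff_integral using Rats.integral_of_root Rats.minpolyD[OF g] by blast
  qed
  define A where "A = (\<lambda>(k, j). B k j) ` ({..<n} \<times> {..<n}) \<union> a ` {..<n} \<union> {\<theta>, \<alpha>}"
  have "finite A" by (simp add: A_def)
  moreover have "algebraic x" if "x \<in> A" for x
    using that B alga alg\<alpha> gen_integer by (auto simp: A_def)
  ultimately obtain \<delta> f' where dg: "galois_field \<delta> f'" "A \<subseteq> Rats.adj \<delta>"
    using galois_closure_exists by blast
  interpret G: galois_field \<delta> f' by fact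
  have AM: "A \<subseteq> G.M" using dg(2) by (simp add: G.M_def)
  have KM: "K \<subseteq> Rats.adj \<delta>"
    unfolding K_def using dg(2) Rats.adj_subset[OF G.M.complex_subring_axioms G.Rats_M, unfolded G.M_def]
    by (auto simp: A_def)
  have BM: "B k j \<in> G.M" if "k < n" "j < n" for k j using that AM by (force simp: A_def)
  have aM: "a i \<in> G.M" if "i < n" for i using that AM by (auto simp: A_def)
  have \<alpha>M: "\<alpha> \<in> G.M" using AM by (auto simp: A_def)
  have \<beta>M: "\<beta> \<in> G.M" unfolding \<beta>_def using BM by (intro G.M.det_mem[of _ n]) auto
  have bsK: "bs ! j \<in> K" if "j < n" for j
    using bs that nth_mem unfolding ring_of_integers_def by blast
  have SM: "S \<in> G.M" unfolding S_def G.M_def using bsK by (intro D_mem[OF dg(1) KM])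
  define N where "N = card G.\<Gamma>"
  have N0: "N > 0" unfolding N_def using G.finite_\<Gamma> G.\<delta>_\<Gamma> by (auto simp: card_gt_0_iff)
  define P where "P = (\<lambda>y. max 1 (cmod y))"
  have step: "cmod S * cmod (G.\<tau> r \<beta>) \<le> fact n * (\<Prod>i<n. P (G.\<tau> r (a i))) ^ (n - 1)"
    if r: "r \<in> G.\<Gamma>" for r
  proof -
    interpret T: complex_hom G.M "G.\<tau> r" using G.\<tau>_hom r .
    obtain s :: int where s: "\<bar>s\<bar> = 1" "G.\<tau> r S = of_int s * S"
      using galois_D[OF dg(1) KM r] bsK unfolding S_def by blast
    have "cmod (of_int s) = 1" using s(1) by (metis norm_of_int of_int_1 of_int_abs)
    then have "cmod (G.\<tau> r S) = cmod S" using s(2) by (simp add: norm_mult)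
    then have "cmod S * cmod (G.\<tau> r \<beta>) = cmod (G.\<tau> r (S * \<beta>))"
      using SM \<beta>M by (simp add: T.hom_mult norm_mult)
    also have "\<dots> = cmod (Determinant.det (map_mat (G.\<tau> r) ?V))"
      unfolding V[symmetric] using aM by (subst T.hom_det[of _ n]) auto
    also have "map_mat (G.\<tau> r) ?V = mat n n (\<lambda>(i, k). G.\<tau> r (a i) ^ k)"
      using aM by (intro eq_matI) (auto simp: T.hom_power)
    also have "cmod (Determinant.det \<dots>) \<le> fact n * (\<Prod>i<n. P (G.\<tau> r (a i))) ^ (n - 1)"
      unfolding P_def by (rule norm_det_vandermonde_le)
    finally show ?thesis .
  qed
  have orbit: "(\<Prod>r\<in>G.\<Gamma>. P (G.\<tau> r (a i))) \<le> weil_height \<alpha> ^ N" if i: "i < n" for i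
  proof -
    obtain c where c: "N = c * degree g" "(\<Prod>r\<in>G.\<Gamma>. P (G.\<tau> r \<alpha>)) = (\<Prod>y | poly g y = 0. P y) ^ c"
      using G.prod_orbit_power[OF \<alpha>M g, of P] unfolding N_def by blast
    have "(\<Prod>r\<in>G.\<Gamma>. P (G.\<tau> r (a i))) = (\<Prod>r\<in>G.\<Gamma>. P (G.\<tau> r \<alpha>))"
      by (rule G.prod_orbit_conjugate[OF \<alpha>M conj[OF i]])
    also have "\<dots> \<le> (weil_height \<alpha> ^ degree g) ^ c"
      unfolding c(2) using weil_height_ge(1)[OF \<alpha> g]
      by (intro power_mono prod_nonneg) (auto simp: P_def)
    also have "\<dots> = weil_height \<alpha> ^ N" by (simp add: c(1) power_mult[symmetric] mult.commute)
    finally show ?thesis .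
  qed
  have "cmod S ^ N * 1 \<le> cmod S ^ N * (\<Prod>r\<in>G.\<Gamma>. cmod (G.\<tau> r \<beta>))"
    by (intro mult_left_mono G.norm_ge_1 \<beta>M \<beta>int \<beta>0) auto
  also have "\<dots> = (\<Prod>r\<in>G.\<Gamma>. cmod S * cmod (G.\<tau> r \<beta>))"
    by (simp add: prod.distrib N_def)
  also have "\<dots> \<le> (\<Prod>r\<in>G.\<Gamma>. fact n * (\<Prod>i<n. P (G.\<tau> r (a i))) ^ (n - 1))"
    using step by (intro prod_mono) auto
  also have "\<dots> = fact n ^ N * (\<Prod>i<n. \<Prod>r\<in>G.\<Gamma>. P (G.\<tau> r (a i))) ^ (n - 1)"
    by (simp add: prod.distrib N_def prod_power_distrib prod.swap[of _ "{..<n}"])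
  also have "\<dots> \<le> fact n ^ N * (\<Prod>i<n. weil_height \<alpha> ^ N) ^ (n - 1)"
    using orbit by (intro mult_left_mono power_mono prod_mono prod_nonneg conjI) (auto simp: P_def intro!: prod_nonneg)
  also have "\<dots> = (fact n * weil_height \<alpha> ^ (n * (n - 1))) ^ N"
    by (simp add: power_mult_distrib power_mult[symmetric] mult_ac)
  finally have "cmod S ^ N \<le> (fact n * weil_height \<alpha> ^ (n * (n - 1))) ^ N" by simp
  then show ?thesis
    unfolding S_def[symmetric] using N0 weil_height_ge(2)[OF \<alpha> g]
    by (subst (asm) power_mono_iff) auto
qed

end

lemma complex_subring_generate_ring: "complex_subring (generate_ring CC H)"
  using CC.generate_ring_is_subring[of H] by (simp add: subring_CC_iff)

lemma generate_ring_subset: "complex_subring E \<Longrightarrow> H \<subseteq> E \<Longrightarrow> generate_ring CC H \<subseteq> E"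
  using CC.generate_ring_min_subring1[of H E] by (simp add: subring_CC_iff)

lemma generate_ring_base: "H \<subseteq> generate_ring CC H"
  by (auto intro: generate_ring.incl)

lemma generate_ring_mono: "H \<subseteq> H' \<Longrightarrow> generate_ring CC H \<subseteq> generate_ring CC H'"
  by (meson complex_subring_generate_ring generate_ring_base generate_ring_subset order_trans)

text \<open>
  Extracts the root of order \<open>k (k - 1)\<close>. The constant \<open>1 / d!\<close> is crude: the root of \<open>k!\<close> is
  bounded by \<open>k!\<close>, and this by \<open>d!\<close>.
\<close>

lemma root_bound:
  assumes S: "0 \<le> S" "S \<le> fact k * H ^ (k * (k - 1))" and H: "0 \<le> H" and k: "1 < k" "k \<le> d"
  shows "1 / fact d * (S\<^sup>2) powr (1 / (2 * real k * (real k - 1))) \<le> H"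
proof -
  define e where "e = k * (k - 1)"
  have e0: "e > 0" using k by (simp add: e_def)
  have er: "real k * (real k - 1) = real e" using k by (simp add: e_def of_nat_diff)
  have "(S\<^sup>2) powr (1 / (2 * real k * (real k - 1))) = (S\<^sup>2) powr (1 / (2 * real e))"
    using er by (simp add: mult.assoc)
  also have "\<dots> = S powr (1 / real e)"
  proof (cases "S = 0")
    case False
    then have "S\<^sup>2 = S powr 2" using S(1) by simp
    then show ?thesis by (simp add: powr_powr)
  qed simp
  also have "\<dots> \<le> (fact k * H ^ e) powr (1 / real e)"
    using S by (intro powr_mono2) (auto simp: e_def)
  also have "\<dots> = fact k powr (1 / real e) * (H ^ e) powr (1 / real e)"
    using H by (intro powr_mult)
  also have "(H ^ e) powr (1 / real e) = H"
  proof (cases "H = 0")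
    case False
    then show ?thesis using H e0 by (simp add: powr_realpow[symmetric] powr_powr)
  qed (use e0 in simp)
  also have "fact k powr (1 / real e) \<le> fact k powr 1"
    using e0 by (intro powr_mono) (auto simp: fact_ge_1)
  also have "fact k powr (1::real) \<le> fact d"
    using k fact_mono[of k d] by simp
  finally have "(S\<^sup>2) powr (1 / (2 * real k * (real k - 1))) \<le> fact d * H"
    using H by (simp add: mult_right_mono)
  then show ?thesis by (simp add: field_simps)
qed

text \<open>
  Carries out the reduction to \<open>height_bound\<close>: the embeddings of \<open>K\<^sub>m\<close> are extended to the
  compositum of all fields that are needed to express \<open>\<alpha>\<close>.
\<close>

lemma height_lower_bound:
  fixes L0 :: "complex set" and K :: "nat \<Rightarrow> complex set"
  assumes L0: "subfield L0 CC"
    and K: "\<And>i. i \<ge> 1 \<Longrightarrow> number_field (K i)" "1 < ext_degree (K m)" "ext_degree (K m) \<le> d"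
    and disj: "linearly_disjoint (UNIV :: nat set) (\<lambda>i. if i = 0 then L0 else K i)"
    and m: "m \<ge> 1" and \<alpha>: "\<alpha> \<in> R_ring L0 K l"
    and gen: "generate_field CC (L_field L0 K (m - 1) \<union> {\<alpha>}) = L_field L0 K m"
  shows "1 / fact d * cmod (discriminant (K m)) powr
      (1 / (2 * real (ext_degree (K m)) * (real (ext_degree (K m)) - 1))) \<le> weil_height \<alpha>"
proof -
  define F where "F = (\<lambda>i. if i = 0 then L0 else K i)"
  \<comment> \<open>The index set must contain \<open>m\<close> even if \<open>\<alpha>\<close> already lies in an earlier ring.\<close>
  define l' where "l' = max l m"
  define J where "J = {..l'}"
  define n where "n = ext_degree (K m)"
  have mJ: "m \<in> J" and Fm: "F m = K m" using m by (auto simp: J_def l'_def F_def)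
  have fields: "complex_subfield (F i)" for i
    using L0 K(1)[of i] by (auto simp: F_def number_field_def subfield_CC_iff)
  define W where "W = generate_ring CC (\<Union>i\<in>J. F i)"
  define W' where "W' = generate_ring CC (\<Union>i\<in>J - {m}. F i)"
  define R' where "R' = generate_ring CC (\<Union>i\<in>J - {m}. ring_of_integers (F i))"
  interpret W: complex_subring W unfolding W_def by (rule complex_subring_generate_ring)
  interpret R': complex_subring R' unfolding R'_def by (rule complex_subring_generate_ring)
  interpret F0: complex_subfield "F 0" by (rule fields)
  interpret Km: complex_subfield "K m" using fields[of m] Fm by simp
  have KW: "K m \<subseteq> W"
    unfolding W_def Fm[symmetric] by (rule order_trans[OF _ generate_ring_base]) (use mJ in blast)
  have Rats_W: "\<rat> \<subseteq> W"
    using Km.Rats_subset KW by blast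
  have R'W': "R' \<subseteq> W'"
    unfolding R'_def W'_def by (rule generate_ring_mono) (auto simp: ring_of_integers_def)
  have W'W: "W' \<subseteq> W"
    unfolding W_def W'_def by (rule generate_ring_mono) auto
  have R'_int: "algebraic_int x" if "x \<in> R'" for x
    using generate_ring_subset[OF Alg_ints.complex_subring_axioms, of "\<Union>i\<in>J - {m}. ring_of_integers (F i)"] that
    unfolding R'_def by (auto simp: ring_of_integers_def)
  have L_union: "L0 \<union> (\<Union>i\<in>{1..k}. K i) = (\<Union>i\<in>{..k}. F i)" for k
    by (force simp: F_def)
  have Lm_W: "L_field L0 K m \<subseteq> W"
    unfolding L_field_def L_union W_def by (rule generate_ring_mono, rule UN_mono) (auto simp: J_def l'_def)
  have Lm1_W': "L_field L0 K (m - 1) \<subseteq> W'"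
    unfolding L_field_def L_union W'_def by (rule generate_ring_mono, rule UN_mono) (use m in \<open>auto simp: J_def l'_def\<close>)
  have K_Lm: "K m \<subseteq> L_field L0 K m"
    unfolding L_field_def L_union Fm[symmetric] by (rule order_trans[OF _ generate_ring_base]) blast
  have "subfield (L_field L0 K m) CC"
    unfolding gen[symmetric] by (rule field.generate_field_is_subfield[OF field_CC]) simp
  then interpret Lm: complex_subfield "L_field L0 K m" by (simp add: subfield_CC_iff)
  have \<alpha>L: "\<alpha> \<in> L_field L0 K m" unfolding gen[symmetric] by (rule generate_field.incl) simp

  obtain bs \<theta> f \<sigma>s where bs: "integral_basis (K m) bs" "length bs = n"
    and E: "embedded_number_field (K m) \<theta> f \<sigma>s n"
    and disc: "discriminant (K m) = (embedded_number_field.D \<sigma>s n (\<lambda>j. bs ! j)) ^ 2"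
    using discriminant_witness[OF K(1)[OF m]] unfolding n_def by blast
  interpret E: embedded_number_field "K m" \<theta> f \<sigma>s n by (rule E)

  have "\<forall>i<n. \<exists>h. complex_hom W h \<and> (\<forall>a\<in>W'. h a = a) \<and> (\<forall>x\<in>K m. h x = (\<sigma>s ! i) x)"
  proof (intro allI impI)
    fix i assume i: "i < n"
    interpret T: twisted_compositum J F m "\<sigma>s ! i"
    proof (rule twisted_compositum.intro)
      show "linearly_disjoint_finite J F"
        using disj unfolding linearly_disjoint_def F_def J_def by simp
      show "complex_hom (F m) (\<sigma>s ! i)" unfolding Fm by (rule E.\<sigma>_hom[OF i])
    qed (use mJ fields in \<open>auto simp: J_def\<close>)
    show "\<exists>h. complex_hom W h \<and> (\<forall>a\<in>W'. h a = a) \<and> (\<forall>x\<in>K m. h x = (\<sigma>s ! i) x)"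
      using T.extension_exists unfolding W_def W'_def Fm .
  qed
  then obtain h where h: "\<And>i. i < n \<Longrightarrow> complex_hom W (h i)"
    "\<And>i a. i < n \<Longrightarrow> a \<in> W' \<Longrightarrow> h i a = a"
    "\<And>i x. i < n \<Longrightarrow> x \<in> K m \<Longrightarrow> h i x = (\<sigma>s ! i) x"
    by metis

  define N where "N = {\<Sum>j<length bs. a j * bs ! j |a. \<forall>j. a j \<in> R'}"
  note N = basis_combinations_subring[OF R'.complex_subring_axioms Km.complex_subring_axioms bs(1), folded N_def]
  interpret N: complex_subring N by (rule N(1))
  have "R_ring L0 K l \<subseteq> N"
    unfolding R_ring_def
  proof (rule generate_ring_subset[OF N(1)], rule subsetI)
    fix x assume "x \<in> ring_of_integers L0 \<union> (\<Union>i\<in>{1..l}. ring_of_integers (K i))"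
    then obtain i where i: "i \<le> l" "x \<in> ring_of_integers (F i)" by (force simp: F_def)
    show "x \<in> N"
    proof (cases "i = m")
      case True
      then show ?thesis using i N(3) Fm by auto
    next
      case False
      then have "x \<in> R'"
        unfolding R'_def using i by (intro generate_ring.incl) (auto simp: J_def l'_def)
      then show ?thesis using N(2) by blast
    qed
  qed
  then have "\<alpha> ^ k \<in> N" for k using \<alpha> by auto
  then have "\<forall>k. \<exists>b. \<alpha> ^ k = (\<Sum>j<n. b j * bs ! j) \<and> (\<forall>j. b j \<in> R')"
    unfolding N_def bs(2) by blast
  then obtain B where B: "\<And>k. \<alpha> ^ k = (\<Sum>j<n. B k j * bs ! j)" "\<And>k j. B k j \<in> R'"
    by metis
  have bsK: "bs ! j \<in> K m" if "j < n" for j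
    using integral_basis_coordinates(1)[OF bs(1)] that bs(2) nth_mem unfolding ring_of_integers_def by blast

  have \<alpha>int: "algebraic_int \<alpha>"
  proof -
    have "R_ring L0 K l \<subseteq> {x. algebraic_int x}"
      unfolding R_ring_def
      by (rule generate_ring_subset[OF Alg_ints.complex_subring_axioms]) (auto simp: ring_of_integers_def)
    then show ?thesis using \<alpha> by blast
  qed
  have \<alpha>W: "\<alpha> \<in> W" using \<alpha>L Lm_W by blast
  define a where "a i = h i \<alpha>" for i

  have inj: "inj_on a {..<n}"
  proof (rule inj_onI)
    fix i k assume ik: "i \<in> {..<n}" "k \<in> {..<n}" "a i = a k"
    interpret hi: complex_hom W "h i" using h(1) ik by simp
    interpret hk: complex_hom W "h k" using h(1) ik by simp
    \<comment> \<open>The equaliser of the two extensions is a field because \<open>L\<^sub>m\<close> is one.\<close>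
    define T where "T = {x \<in> L_field L0 K m. h i x = h k x}"
    have LW: "x \<in> W" if "x \<in> L_field L0 K m" for x using that Lm_W by blast
    have "complex_subfield T"
    proof
      show "1 \<in> T" by (simp add: T_def)
      show "x + y \<in> T" "x * y \<in> T" if "x \<in> T" "y \<in> T" for x y
        using that LW by (auto simp: T_def hi.hom_add hk.hom_add hi.hom_mult hk.hom_mult)
      show "- x \<in> T" if "x \<in> T" for x
        using that LW by (auto simp: T_def hi.hom_uminus hk.hom_uminus)
      show "inverse x \<in> T" if x: "x \<in> T" for x
      proof (cases "x = 0")
        case True
        then show ?thesis by (simp add: T_def)
      next
        case False
        have L: "x \<in> L_field L0 K m" "inverse x \<in> L_field L0 K m" using x by (auto simp: T_def)
        have "h i x * h i (inverse x) = 1" "h k x * h k (inverse x) = 1"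
          using False hi.hom_mult[OF L[THEN LW]] hk.hom_mult[OF L[THEN LW]] by auto
        moreover have "h i x = h k x" using x by (simp add: T_def)
        ultimately have "h i (inverse x) = h k (inverse x)" by (metis inverse_unique)
        then show ?thesis using L by (simp add: T_def)
      qed
    qed
    moreover have "L_field L0 K (m - 1) \<union> {\<alpha>} \<subseteq> T"
    proof -
      have "L_field L0 K (m - 1) \<subseteq> L_field L0 K m"
        unfolding gen[symmetric] by (auto intro: generate_field.incl)
      moreover have "h i x = h k x" if "x \<in> L_field L0 K (m - 1)" for x
      proof -
        have "x \<in> W'" using that Lm1_W' by blast
        then show ?thesis using h(2) ik by simp
      qed
      ultimately show ?thesis using \<alpha>L ik(3) by (auto simp: T_def a_def)
    qed
    ultimately have "generate_field CC (L_field L0 K (m - 1) \<union> {\<alpha>}) \<subseteq> T"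
      by (intro field.generate_field_min_subfield1[OF field_CC]) (auto simp: subfield_CC_iff)
    then have "K m \<subseteq> T" unfolding gen using K_Lm by blast
    show "i = k"
    proof (rule E.\<sigma>_eq_imp)
      fix x assume x: "x \<in> K m"
      then have "h i x = h k x" using \<open>K m \<subseteq> T\<close> by (auto simp: T_def)
      then show "(\<sigma>s ! i) x = (\<sigma>s ! k) x" using h(3) x ik by simp
    qed (use ik in auto)
  qed

  have "cmod (E.D (\<lambda>j. bs ! j)) \<le> fact n * weil_height \<alpha> ^ (n * (n - 1))"
  proof (rule E.height_bound[OF _ bs(2) _ \<alpha>int _ inj, where B = B])
    show "set bs \<subseteq> ring_of_integers (K m)" by (rule integral_basis_coordinates(1)[OF bs(1)])
    show "n > 0" using K(2) by (simp add: n_def)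
    show "algebraic_int (B k j)" for k j using R'_int B(2) by blast
    show "poly p (a i) = 0" if i: "i < n" and p: "p \<in> Rats.polys" "poly p \<alpha> = 0" for i p
    proof -
      interpret hi: complex_hom W "h i" using h(1) i by simp
      show ?thesis using hi.hom_poly[OF Rats_W p(1) \<alpha>W] p(2) by (simp add: a_def)
    qed
    show "a i ^ k = (\<Sum>j<n. B k j * (\<sigma>s ! i) (bs ! j))" if i: "i < n" for i k
    proof -
      interpret hi: complex_hom W "h i" using h(1) i by simp
      have BW': "B k j \<in> W'" for j using B(2) R'W' by blast
      then have BW: "B k j \<in> W" for j using W'W by blast
      have bW: "bs ! j \<in> W" if "j < n" for j using bsK[OF that] KW by blast
      have "a i ^ k = h i (\<Sum>j<n. B k j * bs ! j)"
        using hi.hom_power[OF \<alpha>W, of k] B(1)[of k] by (simp add: a_def)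
      also have "\<dots> = (\<Sum>j<n. h i (B k j * bs ! j))"
        using BW bW by (intro hi.hom_sum W.mult_mem) auto
      also have "\<dots> = (\<Sum>j<n. B k j * (\<sigma>s ! i) (bs ! j))"
        using BW bW BW' bsK i by (intro sum.cong) (auto simp: hi.hom_mult h(2,3))
      finally show ?thesis .
    qed
  qed
  moreover have "0 \<le> weil_height \<alpha>"
    using weil_height_ge(2)[OF \<alpha>int] Rats.minpoly_exists \<alpha>int algebraic_iff_integral by blast
  ultimately show ?thesis
    using root_bound[of "cmod (E.D (\<lambda>j. bs ! j))" n "weil_height \<alpha>" d] K(2,3)
    unfolding disc norm_power n_def[symmetric] by simp
qed

theorem theorem2:
  fixes d :: nat
  assumes "d > 1"
  shows "\<exists>c::real. c > 0 \<and>
    (\<forall>(L0 :: complex set) (K :: nat \<Rightarrow> complex set).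
       subfield L0 CC \<and> L0 \<subseteq> Qbar \<and>
       (\<forall>i\<ge>1. number_field (K i) \<and> 1 < ext_degree (K i) \<and> ext_degree (K i) \<le> d) \<and>
       linearly_disjoint (UNIV :: nat set) (\<lambda>i. if i = 0 then L0 else K i) \<longrightarrow>
       (\<forall>m\<ge>1. \<forall>\<alpha> \<in> (\<Union>n. R_ring L0 K n).
          generate_field CC (L_field L0 K (m - 1) \<union> {\<alpha>}) = L_field L0 K m \<longrightarrow>
          weil_height \<alpha> \<ge>
            c * cmod (discriminant (K m)) powr
              (1 / (2 * real (ext_degree (K m)) * (real (ext_degree (K m)) - 1)))))"
proof (intro exI[of _ "1 / fact d"] conjI allI impI ballI)
  fix L0 K m \<alpha>
  assume A: "subfield L0 CC \<and> L0 \<subseteq> Qbar \<and>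
       (\<forall>i\<ge>1. number_field (K i) \<and> 1 < ext_degree (K i) \<and> ext_degree (K i) \<le> d) \<and>
       linearly_disjoint (UNIV :: nat set) (\<lambda>i. if i = 0 then L0 else K i)"
    and m: "m \<ge> (1::nat)" and \<alpha>: "\<alpha> \<in> (\<Union>n. R_ring L0 K n)"
    and gen: "generate_field CC (L_field L0 K (m - 1) \<union> {\<alpha>}) = L_field L0 K m"
  obtain l where l: "\<alpha> \<in> R_ring L0 K l" using \<alpha> by blast
  show "weil_height \<alpha> \<ge> 1 / fact d * cmod (discriminant (K m)) powr
      (1 / (2 * real (ext_degree (K m)) * (real (ext_degree (K m)) - 1)))"
    by (rule height_lower_bound[OF _ _ _ _ _ m l gen]) (use A m in blast)+
qed simp

end
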